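(* Let $B$ be a bounded neighborhood of $\psi=0$ in $X$. (1) Uniformly on $B$, $\mu^i_n(\psi)=\mu^i_n(0)+\ell^{\infty,1}_n$ for $i=1,2$, i.e. $$\sup_{\psi\in B}\ \sup_{n\in\mathbb{Z}}\ (1+n^2)^{1/2}\,|\mu^i_n(\psi)-\mu^i_n(0)|<\infty,\qquad i=1,2,$$ where $\mu^i_n(0)=\operatorname{sgn}(n)\sqrt{(-1)^{i-1}|n|\pi/2}$. (2) There exists a neighborhood $W\subseteq B$ of the zero potential such that for all $\psi\in W$ and $i=1,2$: $\mu^i_n(\psi)\in D^i_n$ for all $|n|\ge1$, and $\mu^i_0(\psi)\in D_0$. (3) Let $W\subseteq B$ be an open neighborhood of the zero potential such that the property in (2) holds for all $\psi\in W$. Then the Dirichlet eigenvalues $\mu^i_n$, considered as functions of $\psi$, are analytic on $W$ for all $n\in\mathbb{Z}\setminus\{0\}$, $i=1,2$. Furthermore, for every $\psi\in W$ and every sequence $(\psi_k)_{k\in\mathbb{N}}$ in $W$ with $\psi_k\to\psi$ as $k\to\infty$, $$\lim_{k\to\infty}\Big(\sup_{n\in\mathbb{Z}\setminus\{0\}}(1+n^2)^{1/2}\big|\mu^i_n(\psi_k)-\mu^i_n(\psi)\big|\Big)=0,\qquad i=1,2.$$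
   Context: $X=H^1(\mathbb{T},\mathbb{C})^4$, $\mathbb{T}=\mathbb{R}/\mathbb{Z}$, with its Hilbert norm; $\psi=(\psi^1,\dots,\psi^4)\in X$. Let $\sigma_3=\mathrm{diag}(1,-1)$ and $V=\begin{pmatrix}-i\psi^1\psi^2 & 2\lambda\psi^1+i\psi^3\\ 2\lambda\psi^2-i\psi^4 & i\psi^1\psi^2\end{pmatrix}$. $M(t,\lambda,\psi)$ is the unique matrix solution of $\partial_tM=(-2i\lambda^2\sigma_3+V)M$, $M(0)=I$, and $\begin{pmatrix}\grave m_1&\grave m_2\\ \grave m_3&\grave m_4\end{pmatrix}=M(1,\lambda,\psi)$. The Dirichlet eigenvalues of $\psi$ are the roots (with multiplicity) of the entire function $\chi_D(\lambda,\psi)=\frac{1}{2i}(\grave m_4+\grave m_3-\grave m_2-\grave m_1)$ of $\lambda$; $\chi_D(\lambda,0)=\sin 2\lambda^2$. Discs: for $m\in\mathbb{Z}\setminus\{0\}$ let $U_m=\{\lambda\in\mathbb{C}:|2\lambda^2-m\pi|<\pi/4\}$. For $n\ge1$: $D^1_n=U_n\cap\{\operatorname{Re}\lambda>0\}$, $D^1_{-n}=U_n\cap\{\operatorname{Re}\lambda<0\}$, $D^2_n=U_{-n}\cap\{\operatorname{Im}\lambda>0\}$, $D^2_{-n}=U_{-n}\cap\{\operatorname{Im}\lambda<0\}$. Also $D_0=D^1_0=D^2_0=B_0=\{|\lambda|<\sqrt{\pi/8}\}$, and for $N\ge1$, $B_N=\{|\lambda|<\sqrt{(N+1/4)\pi/2}\}$.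 Convention: $\sqrt{-x}=i\sqrt{x}$ for $x\geq0$; $\operatorname{sgn}(0)=0$. Labeling: for each $\psi\in X$ there is a minimal integer $N\ge0$ such that for all $|n|>N$ and $i=1,2$ the disc $D^i_n$ contains precisely one Dirichlet eigenvalue, of multiplicity one, denoted $\mu^i_n(\psi)$, and $B_N$ contains the remaining $2(2N+1)$ eigenvalues counted with multiplicity. The latter are listed with multiplicity and labeled so that $\mu^1_{-N}\preceq\cdots\preceq\mu^1_{-1}\preceq\mu^2_{-N}\preceq\cdots\preceq\mu^2_{-1}\preceq\mu^1_0\preceq\mu^2_0\preceq\mu^2_1\preceq\cdots\preceq\mu^2_N\preceq\mu^1_1\preceq\cdots\preceq\mu^1_N$, where $\preceq$ is the lexicographic order ($z_1\preceq z_2$ iff $\operatorname{Re}z_1<\operatorname{Re}z_2$, or $\operatorname{Re}z_1=\operatorname{Re}z_2$ and $\operatorname{Im}z_1\le\operatorname{Im}z_2$). *)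

theory Defs
  imports "HOL-Complex_Analysis.Complex_Analysis" "HOL-Library.Multiset"
begin

section \<open>The Sobolev space \<open>H\<^sup>1(\<real>/\<int>, \<complex>)\<close>\<close>

text \<open>
  Functions on the circle are rendered as 1-periodic functions on the real line. Being in
  \<open>H\<^sup>1\<close> means being absolutely continuous with square integrable derivative, i.e. being an
  indefinite integral of a function in \<open>L\<^sup>2(0,1)\<close>; \<open>h1_deriv f g\<close> says that \<open>g\<close> represents
  the derivative of \<open>f\<close> on \<open>[0,1]\<close>.
\<close>

definition h1_deriv :: "(real \<Rightarrow> complex) \<Rightarrow> (real \<Rightarrow> complex) \<Rightarrow> bool" where
  "h1_deriv f g \<longleftrightarrow>
     g \<in> borel_measurable borel \<and>
     set_integrable lborel {0..1} (\<lambda>t. (cmod (g t))\<^sup>2) \<and>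
     (\<forall>t\<in>{0..1}. f t = f 0 + (LBINT s:{0..t}. g s))"

lemma h1_deriv_measurable: "h1_deriv f g \<Longrightarrow> g \<in> borel_measurable borel"
  and h1_deriv_square_integrable:
    "h1_deriv f g \<Longrightarrow> set_integrable lborel {0..1} (\<lambda>t. (cmod (g t))\<^sup>2)"
  and h1_deriv_integral: "h1_deriv f g \<Longrightarrow> t \<in> {0..1} \<Longrightarrow> f t = f 0 + (LBINT s:{0..t}. g s)"
  unfolding h1_deriv_def by blast+

lemma h1_deriv_set_integrable:
  assumes "h1_deriv f g"
  shows "set_integrable lborel {0..1} g"
proof -
  have [measurable]: "g \<in> borel_measurable borel"
    and sq: "set_integrable lborel {0..1} (\<lambda>t. (cmod (g t))\<^sup>2)"
    using assms by (rule h1_deriv_measurable, rule h1_deriv_square_integrable)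
  have one: "set_integrable lborel {0..1::real} (\<lambda>t. 1::real)"
    by (simp add: set_integrable_def)
  have "set_integrable lborel {0..1} (\<lambda>t. 1 + (cmod (g t))\<^sup>2)"
    by (rule set_integral_add(1)[OF one sq])
  then show ?thesis
    unfolding set_integrable_def
  proof (rule Bochner_Integration.integrable_bound)
    show "AE t in lborel. norm (indicat_real {0..1} t *\<^sub>R g t)
            \<le> norm (indicat_real {0..1} t *\<^sub>R (1 + (cmod (g t))\<^sup>2))"
    proof (rule AE_I2)
      fix t
      have "0 \<le> (cmod (g t) - 1)\<^sup>2" by simp
      then have "2 * cmod (g t) \<le> 1 + (cmod (g t))\<^sup>2"
        by (simp add: power2_diff)
      moreover have "0 \<le> cmod (g t)" by simp
      ultimately have "cmod (g t) \<le> 1 + (cmod (g t))\<^sup>2" by linarith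
      then show "norm (indicat_real {0..1} t *\<^sub>R g t)
            \<le> norm (indicat_real {0..1} t *\<^sub>R (1 + (cmod (g t))\<^sup>2))"
        by (auto simp: indicator_def)
    qed
  qed measurable
qed

lemma set_integrable_inner_L2:
  fixes g h :: "real \<Rightarrow> complex"
  assumes [measurable]: "g \<in> borel_measurable borel" "h \<in> borel_measurable borel"
    and g: "set_integrable lborel {0..1} (\<lambda>t. (cmod (g t))\<^sup>2)"
    and h: "set_integrable lborel {0..1} (\<lambda>t. (cmod (h t))\<^sup>2)"
  shows "set_integrable lborel {0..1} (\<lambda>t. g t \<bullet> h t)"
proof -
  have "set_integrable lborel {0..1} (\<lambda>t. (cmod (g t))\<^sup>2 + (cmod (h t))\<^sup>2)"
    by (rule set_integral_add(1)[OF g h])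
  then show ?thesis
    unfolding set_integrable_def
  proof (rule Bochner_Integration.integrable_bound)
    show "AE t in lborel. norm (indicat_real {0..1} t *\<^sub>R (g t \<bullet> h t))
            \<le> norm (indicat_real {0..1} t *\<^sub>R ((cmod (g t))\<^sup>2 + (cmod (h t))\<^sup>2))"
    proof (rule AE_I2)
      fix t
      have "0 \<le> (cmod (g t) - cmod (h t))\<^sup>2" by simp
      then have "2 * (cmod (g t) * cmod (h t)) \<le> (cmod (g t))\<^sup>2 + (cmod (h t))\<^sup>2"
        by (simp add: power2_diff)
      moreover have "0 \<le> cmod (g t) * cmod (h t)" by simp
      moreover have "\<bar>g t \<bullet> h t\<bar> \<le> cmod (g t) * cmod (h t)"
        by (rule Cauchy_Schwarz_ineq2)
      ultimately have "\<bar>g t \<bullet> h t\<bar> \<le> (cmod (g t))\<^sup>2 + (cmod (h t))\<^sup>2" by linarith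
      then show "norm (indicat_real {0..1} t *\<^sub>R (g t \<bullet> h t))
            \<le> norm (indicat_real {0..1} t *\<^sub>R ((cmod (g t))\<^sup>2 + (cmod (h t))\<^sup>2))"
        by (auto simp: indicator_def)
    qed
  qed measurable
qed

lemma h1_deriv_add:
  assumes f: "h1_deriv f1 g1" "h1_deriv f2 g2"
  shows "h1_deriv (\<lambda>t. f1 t + f2 t) (\<lambda>t. g1 t + g2 t)"
proof -
  have [measurable]: "g1 \<in> borel_measurable borel" "g2 \<in> borel_measurable borel"
    using f by (auto intro: h1_deriv_measurable)
  have i: "set_integrable lborel {0..1} (\<lambda>t. g1 t \<bullet> g2 t)"
    by (intro set_integrable_inner_L2 f[THEN h1_deriv_measurable]
        f[THEN h1_deriv_square_integrable])
  have "set_integrable lborel {0..1}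
          (\<lambda>t. (cmod (g1 t))\<^sup>2 + (cmod (g2 t))\<^sup>2 + 2 * (g1 t \<bullet> g2 t))"
    by (intro set_integral_add(1) set_integrable_mult_right i
        f[THEN h1_deriv_square_integrable])
  then have sq: "set_integrable lborel {0..1} (\<lambda>t. (cmod (g1 t + g2 t))\<^sup>2)"
    unfolding power2_norm_eq_inner
    by (simp add: inner_add_left inner_add_right inner_commute[of "g2 _" "g1 _"] algebra_simps)
  have eq: "f1 t + f2 t = f1 0 + f2 0 + (LBINT s:{0..t}. g1 s + g2 s)" if "t \<in> {0..1}" for t
  proof -
    have "set_integrable lborel {0..t} g1" "set_integrable lborel {0..t} g2"
      using h1_deriv_set_integrable[OF f(1)] h1_deriv_set_integrable[OF f(2)] that
      by (auto intro: set_integrable_subset)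
    moreover have "f1 t = f1 0 + (LBINT s:{0..t}. g1 s)" "f2 t = f2 0 + (LBINT s:{0..t}. g2 s)"
      using f that by (auto intro: h1_deriv_integral)
    ultimately show ?thesis by simp
  qed
  show ?thesis unfolding h1_deriv_def by (intro conjI ballI sq eq) measurable
qed

lemma h1_deriv_mult:
  assumes f: "h1_deriv f g"
  shows "h1_deriv (\<lambda>t. c * f t) (\<lambda>t. c * g t)"
  unfolding h1_deriv_def
proof (intro conjI ballI)
  have [measurable]: "g \<in> borel_measurable borel"
    using f by (rule h1_deriv_measurable)
  show "(\<lambda>t. c * g t) \<in> borel_measurable borel" by measurable
  show "set_integrable lborel {0..1} (\<lambda>t. (cmod (c * g t))\<^sup>2)"
    using h1_deriv_square_integrable[OF f] by (simp add: norm_mult power_mult_distrib)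
  fix t :: real
  assume "t \<in> {0..1}"
  from h1_deriv_integral[OF f this] show "c * f t = c * f 0 + (LBINT s:{0..t}. c * g s)"
    by (simp add: distrib_left)
qed

lemma h1_deriv_zero: "h1_deriv (\<lambda>t. 0) (\<lambda>t. 0)"
  by (simp add: h1_deriv_def set_integrable_def)

lemma AE_zero_if_tail_integrals_zero:
  fixes u :: "real \<Rightarrow> real"
  assumes u: "integrable lborel u" and z: "\<And>x. (LBINT s:{x<..}. u s) = 0"
  shows "AE x in lborel. u x = 0"
proof -
  have [measurable]: "u \<in> borel_measurable borel"
    using u by auto
  define p where "p x = max 0 (u x)" for x
  define q where "q x = max 0 (- u x)" for x
  have [measurable]: "p \<in> borel_measurable borel" "q \<in> borel_measurable borel"
    unfolding p_def q_def by measurable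
  have pi: "integrable lborel p" and qi: "integrable lborel q"
    using u unfolding p_def q_def by auto
  have em: "emeasure (density lborel (\<lambda>x. ennreal (r x))) {x<..} = ennreal (LBINT s:{x<..}. r s)"
    if r: "integrable lborel r" "\<And>x. 0 \<le> r x" for r :: "real \<Rightarrow> real" and x
  proof -
    have [measurable]: "r \<in> borel_measurable borel"
      using r by auto
    have ri: "integrable lborel (\<lambda>s. indicat_real {x<..} s *\<^sub>R r s)"
      using r by (intro integrable_mult_indicator) auto
    have "emeasure (density lborel (\<lambda>x. ennreal (r x))) {x<..}
        = (\<integral>\<^sup>+ s. ennreal (r s) * indicator {x<..} s \<partial>lborel)"
      by (rule emeasure_density) auto
    also have "\<dots> = (\<integral>\<^sup>+ s. ennreal (indicat_real {x<..} s *\<^sub>R r s) \<partial>lborel)"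
      by (intro nn_integral_cong) (auto simp: indicator_def)
    also have "\<dots> = ennreal (LBINT s:{x<..}. r s)"
      unfolding set_lebesgue_integral_def using r ri by (intro nn_integral_eq_integral) auto
    finally show ?thesis .
  qed
  have eq: "(LBINT s:{x<..}. p s) = (LBINT s:{x<..}. q s)" for x
  proof -
    have "set_integrable lborel {x<..} p" "set_integrable lborel {x<..} q"
      unfolding set_integrable_def using pi qi
      by (intro integrable_mult_indicator; simp)+
    then have "(LBINT s:{x<..}. p s) - (LBINT s:{x<..}. q s) = (LBINT s:{x<..}. p s - q s)"
      by simp
    also have "\<dots> = (LBINT s:{x<..}. u s)"
      by (intro arg_cong2[where f="set_lebesgue_integral lborel"]) (auto simp: p_def q_def fun_eq_iff)
    finally show ?thesis using z by simp
  qed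
  have "density lborel (\<lambda>x. ennreal (p x)) = density lborel (\<lambda>x. ennreal (q x))"
    using em[OF pi] em[OF qi] eq
    by (intro measure_eqI_lessThan) (auto simp: p_def q_def)
  then have "AE x in lborel. ennreal (p x) = ennreal (q x)"
    by (subst (asm) sigma_finite_measure.density_unique_iff[OF sigma_finite_lborel]) auto
  then show ?thesis
    by eventually_elim (auto simp: p_def q_def max_def split: if_splits)
qed

lemma h1_deriv_unique:
  assumes f: "h1_deriv f g1" "h1_deriv f g2"
  shows "AE t in lborel. t \<in> {0..1} \<longrightarrow> g1 t = g2 t"
proof -
  define h where "h t = indicat_real {0..1} t *\<^sub>R (g1 t - g2 t)" for t
  have [measurable]: "g1 \<in> borel_measurable borel" "g2 \<in> borel_measurable borel"
    using f by (auto intro: h1_deriv_measurable)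
  have si: "set_integrable lborel {0..1} (\<lambda>t. g1 t - g2 t)"
    using f[THEN h1_deriv_set_integrable] by simp
  then have hi: "integrable lborel h"
    unfolding h_def set_integrable_def .
  have I: "(LBINT s:{0..t}. g1 s - g2 s) = 0" if "t \<in> {0..1}" for t
  proof -
    have "set_integrable lborel {0..t} g1" "set_integrable lborel {0..t} g2"
      using f[THEN h1_deriv_set_integrable] that by (auto intro: set_integrable_subset)
    moreover have "f t = f 0 + (LBINT s:{0..t}. g1 s)" "f t = f 0 + (LBINT s:{0..t}. g2 s)"
      using f that by (auto intro: h1_deriv_integral)
    ultimately show ?thesis by simp
  qed
  have T: "(LBINT s:{x<..}. h s) = 0" for x
  proof -
    define y where "y = max 0 (min 1 x)"
    have y: "y \<in> {0..1}" by (auto simp: y_def)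
    have "(LBINT s:{x<..}. h s) = (LINT s|lborel. indicat_real ({x<..} \<inter> {0..1}) s *\<^sub>R (g1 s - g2 s))"
      unfolding set_lebesgue_integral_def h_def
      by (intro Bochner_Integration.integral_cong) (auto simp: indicator_def)
    also have "\<dots> = (LINT s|lborel. (indicat_real {0..1} s *\<^sub>R (g1 s - g2 s))
                                  - (indicat_real {0..y} s *\<^sub>R (g1 s - g2 s)))"
    proof (rule integral_cong_AE)
      have "AE s in lborel. s \<noteq> (0::real)" by (rule AE_lborel_singleton)
      then show "AE s in lborel. indicat_real ({x<..} \<inter> {0..1}) s *\<^sub>R (g1 s - g2 s)
          = (indicat_real {0..1} s *\<^sub>R (g1 s - g2 s)) - (indicat_real {0..y} s *\<^sub>R (g1 s - g2 s))"
        by eventually_elim (auto simp: indicator_def y_def max_def min_def split: if_splits)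
    qed measurable
    also have "\<dots> = (LBINT s:{0..1}. g1 s - g2 s) - (LBINT s:{0..y}. g1 s - g2 s)"
      unfolding set_lebesgue_integral_def
    proof (rule Bochner_Integration.integral_diff)
      have "set_integrable lborel {0..y} (\<lambda>t. g1 t - g2 t)"
        by (rule set_integrable_subset[OF si]) (use y in auto)
      then show "integrable lborel (\<lambda>s. indicat_real {0..y} s *\<^sub>R (g1 s - g2 s))"
        by (simp add: set_integrable_def)
    qed (use si in \<open>simp add: set_integrable_def\<close>)
    also have "\<dots> = 0" using I[of 1] I[OF y] by simp
    finally show ?thesis .
  qed
  have hx: "integrable lborel (\<lambda>s. indicat_real {x<..} s *\<^sub>R h s)" for x
    using hi by (intro integrable_mult_indicator) auto
  have "AE t in lborel. Re (h t) = 0"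
  proof (rule AE_zero_if_tail_integrals_zero)
    show "integrable lborel (\<lambda>t. Re (h t))" using hi by simp
    fix x
    have "(LBINT s:{x<..}. Re (h s)) = Re (LBINT s:{x<..}. h s)"
      unfolding set_lebesgue_integral_def using integral_Re[OF hx[of x]] by simp
    then show "(LBINT s:{x<..}. Re (h s)) = 0" by (simp add: T)
  qed
  moreover have "AE t in lborel. Im (h t) = 0"
  proof (rule AE_zero_if_tail_integrals_zero)
    show "integrable lborel (\<lambda>t. Im (h t))" using hi by simp
    fix x
    have "(LBINT s:{x<..}. Im (h s)) = Im (LBINT s:{x<..}. h s)"
      unfolding set_lebesgue_integral_def using integral_Im[OF hx[of x]] by simp
    then show "(LBINT s:{x<..}. Im (h s)) = 0" by (simp add: T)
  qed
  ultimately show ?thesis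
    by eventually_elim (auto simp: h_def complex_eq_iff)
qed

lemma h1_deriv_continuous:
  assumes f: "h1_deriv f g"
  shows "continuous_on {0..1} f"
proof -
  have si: "set_integrable lborel {0..1} g"
    by (rule h1_deriv_set_integrable[OF f])
  have go: "g integrable_on {0..1}"
    using set_borel_integral_eq_integral(1)[OF si] .
  have "continuous_on {0..1} (\<lambda>t. f 0 + integral {0..t} g)"
    by (intro continuous_intros indefinite_integral_continuous_1 go)
  moreover have "f 0 + integral {0..t} g = f t" if "t \<in> {0..1}" for t
  proof -
    have "set_integrable lborel {0..t} g"
      by (rule set_integrable_subset[OF si]) (use that in auto)
    then have "(LBINT s:{0..t}. g s) = integral {0..t} g"
      by (rule set_borel_integral_eq_integral(2))
    moreover have "f t = f 0 + (LBINT s:{0..t}. g s)"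
      using f that by (rule h1_deriv_integral)
    ultimately show ?thesis by simp
  qed
  ultimately show ?thesis
    using continuous_on_cong[of "{0..1}" "{0..1}" "\<lambda>t. f 0 + integral {0..t} g" f] by simp
qed

typedef h1 = "{f :: real \<Rightarrow> complex. (\<forall>t. f (t + 1) = f t) \<and> (\<exists>g. h1_deriv f g)}"
  morphisms h1_fun Abs_h1
  by (rule exI[of _ "\<lambda>t. 0"]) (auto intro: h1_deriv_zero)

lemma h1_eqI: "(\<And>t. h1_fun f t = h1_fun g t) \<Longrightarrow> f = g"
  by (metis ext h1_fun_inject)

text \<open>The derivative is only determined almost everywhere; we pick some representative.\<close>

definition h1_diff :: "h1 \<Rightarrow> real \<Rightarrow> complex" where
  "h1_diff f = (SOME g. h1_deriv (h1_fun f) g)"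

lemma h1_periodic: "h1_fun f (t + 1) = h1_fun f t"
  using h1_fun[of f] by simp

lemma h1_diff: "h1_deriv (h1_fun f) (h1_diff f)"
proof -
  have "\<exists>g. h1_deriv (h1_fun f) g" using h1_fun[of f] by blast
  then show ?thesis unfolding h1_diff_def by (rule someI_ex)
qed

definition h1_mult :: "complex \<Rightarrow> h1 \<Rightarrow> h1" where
  "h1_mult c f = Abs_h1 (\<lambda>t. c * h1_fun f t)"

lemma h1_fun_mult: "h1_fun (h1_mult c f) t = c * h1_fun f t"
proof -
  have "\<exists>g. h1_deriv (\<lambda>t. c * h1_fun f t) g"
    using h1_deriv_mult[OF h1_diff] by blast
  then show ?thesis
    unfolding h1_mult_def by (subst Abs_h1_inverse) (auto simp: h1_periodic)
qed

instantiation h1 :: real_vector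
begin

definition zero_h1 :: h1 where "0 = Abs_h1 (\<lambda>t. 0)"
definition plus_h1 :: "h1 \<Rightarrow> h1 \<Rightarrow> h1" where
  "f + g = Abs_h1 (\<lambda>t. h1_fun f t + h1_fun g t)"
definition scaleR_h1 :: "real \<Rightarrow> h1 \<Rightarrow> h1" where
  "r *\<^sub>R f = h1_mult (of_real r) f"
definition uminus_h1 :: "h1 \<Rightarrow> h1" where "- f = h1_mult (- 1) f"
definition minus_h1 :: "h1 \<Rightarrow> h1 \<Rightarrow> h1" where "f - g = f + (- g :: h1)"

lemma h1_fun_zero: "h1_fun 0 t = 0"
  unfolding zero_h1_def by (subst Abs_h1_inverse) (auto intro: h1_deriv_zero)

lemma h1_fun_add: "h1_fun (f + g) t = h1_fun f t + h1_fun g t"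
proof -
  have "\<exists>d. h1_deriv (\<lambda>t. h1_fun f t + h1_fun g t) d"
    using h1_deriv_add[OF h1_diff h1_diff] by blast
  then show ?thesis
    unfolding plus_h1_def by (subst Abs_h1_inverse) (auto simp: h1_periodic)
qed

lemma h1_fun_scaleR: "h1_fun (r *\<^sub>R f) t = of_real r * h1_fun f t"
  by (simp add: scaleR_h1_def h1_fun_mult)

lemma h1_fun_uminus: "h1_fun (- f) t = - h1_fun f t"
  by (simp add: uminus_h1_def h1_fun_mult)

lemma h1_fun_minus: "h1_fun (f - g) t = h1_fun f t - h1_fun g t"
  by (simp add: minus_h1_def h1_fun_add h1_fun_uminus)

instance
  by standard
    (auto intro!: h1_eqI simp: h1_fun_zero h1_fun_add h1_fun_scaleR h1_fun_uminus h1_fun_minus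
      algebra_simps)

end

lemma h1_fun_set_integrable: "set_integrable lborel {0..1} (\<lambda>t. h1_fun f t \<bullet> h1_fun g t)"
  by (intro borel_integrable_atLeastAtMost' continuous_intros
      h1_deriv_continuous[OF h1_diff])

lemma h1_diff_measurable [measurable]: "h1_diff f \<in> borel_measurable borel"
  by (rule h1_deriv_measurable[OF h1_diff])

lemma h1_diff_set_integrable: "set_integrable lborel {0..1} (\<lambda>t. h1_diff f t \<bullet> h1_diff g t)"
  by (intro set_integrable_inner_L2 h1_diff_measurable h1_deriv_square_integrable[OF h1_diff])

lemma h1_diff_add: "AE t in lborel. t \<in> {0..1} \<longrightarrow> h1_diff (f + g) t = h1_diff f t + h1_diff g t"
proof -
  have "h1_deriv (h1_fun (f + g)) (\<lambda>t. h1_diff f t + h1_diff g t)"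
    using h1_deriv_add[OF h1_diff h1_diff, of f g] by (simp add: h1_fun_add[abs_def])
  from h1_deriv_unique[OF h1_diff this] show ?thesis .
qed

lemma h1_diff_scaleR: "AE t in lborel. t \<in> {0..1} \<longrightarrow> h1_diff (r *\<^sub>R f) t = r *\<^sub>R h1_diff f t"
proof -
  have "h1_deriv (h1_fun (r *\<^sub>R f)) (\<lambda>t. of_real r * h1_diff f t)"
    using h1_deriv_mult[OF h1_diff, of "of_real r" f] by (simp add: h1_fun_scaleR[abs_def])
  from h1_deriv_unique[OF h1_diff this] show ?thesis by (simp add: scaleR_conv_of_real)
qed

instantiation h1 :: real_inner
begin

text \<open>
  On \<open>complex\<close>, \<open>z \<bullet> w\<close> is the real part of \<open>z * cnj w\<close>, so the following is the real part of
  the complex \<open>H\<^sup>1\<close> inner product and the norm is given by the integral of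
  \<open>\<bar>f\<bar>\<^sup>2 + \<bar>f'\<bar>\<^sup>2\<close> over a period.
\<close>

definition inner_h1 :: "h1 \<Rightarrow> h1 \<Rightarrow> real" where
  "f \<bullet> g = (LBINT t:{0..1}. h1_fun f t \<bullet> h1_fun g t) + (LBINT t:{0..1}. h1_diff f t \<bullet> h1_diff g t)"
definition norm_h1 :: "h1 \<Rightarrow> real" where "norm f = sqrt (f \<bullet> f)" for f :: h1
definition dist_h1 :: "h1 \<Rightarrow> h1 \<Rightarrow> real" where "dist f g = norm (f - g)" for f g :: h1
definition sgn_h1 :: "h1 \<Rightarrow> h1" where "sgn f = f /\<^sub>R norm f" for f :: h1
definition uniformity_h1 :: "(h1 \<times> h1) filter" where
  "uniformity = (INF e\<in>{0 <..}. principal {(x :: h1, y). dist x y < e})"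
definition open_h1 :: "h1 set \<Rightarrow> bool" where
  "open U \<longleftrightarrow> (\<forall>x\<in>U. eventually (\<lambda>(x', y). x' = x \<longrightarrow> y \<in> U) uniformity)" for U :: "h1 set"

instance
proof
  fix f g h :: h1 and r :: real and U :: "h1 set"
  show "dist f g = norm (f - g)" by (rule dist_h1_def)
  show "sgn f = f /\<^sub>R norm f" by (rule sgn_h1_def)
  show "uniformity = (INF e\<in>{0 <..}. principal {(x :: h1, y). dist x y < e})"
    by (rule uniformity_h1_def)
  show "open U \<longleftrightarrow> (\<forall>x\<in>U. eventually (\<lambda>(x', y). x' = x \<longrightarrow> y \<in> U) uniformity)"
    by (rule open_h1_def)
  show "norm f = sqrt (f \<bullet> f)" by (rule norm_h1_def)
  show "f \<bullet> g = g \<bullet> f" unfolding inner_h1_def by (simp add: inner_commute)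
  have 1: "(LBINT t:{0..1}. h1_diff (f + g) t \<bullet> h1_diff h t)
      = (LBINT t:{0..1}. h1_diff f t \<bullet> h1_diff h t + h1_diff g t \<bullet> h1_diff h t)"
    unfolding set_lebesgue_integral_def
  proof (rule integral_cong_AE)
    show "AE t in lborel. indicat_real {0..1} t *\<^sub>R (h1_diff (f + g) t \<bullet> h1_diff h t) =
        indicat_real {0..1} t *\<^sub>R (h1_diff f t \<bullet> h1_diff h t + h1_diff g t \<bullet> h1_diff h t)"
      using h1_diff_add[of f g]
      by eventually_elim (auto simp: indicator_def inner_add_left)
  qed measurable
  show "(f + g) \<bullet> h = f \<bullet> h + g \<bullet> h"
    unfolding inner_h1_def 1
    by (simp add: h1_fun_add inner_add_left h1_fun_set_integrable h1_diff_set_integrable)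
  have 2: "(LBINT t:{0..1}. h1_diff (r *\<^sub>R f) t \<bullet> h1_diff g t)
      = (LBINT t:{0..1}. r * (h1_diff f t \<bullet> h1_diff g t))"
    unfolding set_lebesgue_integral_def
  proof (rule integral_cong_AE)
    show "AE t in lborel. indicat_real {0..1} t *\<^sub>R (h1_diff (r *\<^sub>R f) t \<bullet> h1_diff g t) =
        indicat_real {0..1} t *\<^sub>R (r * (h1_diff f t \<bullet> h1_diff g t))"
      using h1_diff_scaleR[of r f] by eventually_elim (auto simp: indicator_def)
  qed measurable
  have 3: "h1_fun (r *\<^sub>R f) t = r *\<^sub>R h1_fun f t" for t
    by (simp add: h1_fun_scaleR scaleR_conv_of_real)
  show "(r *\<^sub>R f) \<bullet> g = r * (f \<bullet> g)"
    unfolding inner_h1_def 2 3 by (simp add: distrib_left)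
  have nonneg: "0 \<le> (LBINT t:{0..1}. h1_fun f t \<bullet> h1_fun f t)"
    "0 \<le> (LBINT t:{0..1}. h1_diff f t \<bullet> h1_diff f t)"
    unfolding set_lebesgue_integral_def by (auto intro!: integral_nonneg_AE)
  then show "0 \<le> f \<bullet> f" unfolding inner_h1_def by simp
  show "f \<bullet> f = 0 \<longleftrightarrow> f = 0"
  proof
    assume "f \<bullet> f = 0"
    then have "(LBINT t:{0..1}. h1_fun f t \<bullet> h1_fun f t) = 0"
      using nonneg unfolding inner_h1_def by linarith
    moreover have "(LBINT t:{0..1}. h1_fun f t \<bullet> h1_fun f t)
        = integral {0..1} (\<lambda>t. h1_fun f t \<bullet> h1_fun f t)"
      by (rule set_borel_integral_eq_integral(2)[OF h1_fun_set_integrable])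
    ultimately have I: "integral {0..1} (\<lambda>t. h1_fun f t \<bullet> h1_fun f t) = 0" by simp
    have "continuous_on {0..1} (\<lambda>t. h1_fun f t \<bullet> h1_fun f t)"
      by (intro continuous_intros h1_deriv_continuous[OF h1_diff])
    then have z: "h1_fun f t = 0" if "t \<in> {0..1}" for t
      using integral_eq_0_iff[of 0 1 "\<lambda>t. h1_fun f t \<bullet> h1_fun f t"] I that by auto
    have per: "h1_fun f (t + of_nat n) = h1_fun f t" for t n
      by (induction n) (use h1_periodic[of f] in \<open>auto simp: add.assoc[symmetric] add.commute[of 1]\<close>)
    have per': "h1_fun f (t + of_int k) = h1_fun f t" for t k
    proof (cases "k \<ge> 0")
      case True
      then show ?thesis using per[of t "nat k"] by simp
    next
      case False
      then show ?thesis using per[of "t + of_int k" "nat (- k)"] by simp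
    qed
    have "h1_fun f t = 0" for t
    proof -
      have "h1_fun f t = h1_fun f (frac t)"
        using per'[of "frac t" "\<lfloor>t\<rfloor>"] by (simp add: frac_def)
      also have "\<dots> = 0"
        by (rule z) (use frac_ge_0[of t] frac_lt_1[of t] in auto)
      finally show ?thesis .
    qed
    then show "f = 0" by (intro h1_eqI) (simp add: h1_fun_zero)
  next
    assume f: "f = 0"
    have "h1_deriv (h1_fun 0) (\<lambda>t. 0)"
      using h1_deriv_zero by (simp add: h1_fun_zero[abs_def])
    then have AE: "AE t in lborel. t \<in> {0..1} \<longrightarrow> h1_diff f t = 0"
      using h1_deriv_unique[OF h1_diff[of 0]] f by auto
    have "(LBINT t:{0..1}. h1_diff f t \<bullet> h1_diff f t) = 0"
      unfolding set_lebesgue_integral_def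
      by (rule integral_eq_zero_AE) (use AE in eventually_elim, auto simp: indicator_def)
    then show "f \<bullet> f = 0"
      by (simp add: inner_h1_def f h1_fun_zero)
  qed
qed

end


section \<open>Potentials\<close>

text \<open>
  The norm of the finite product \<^typ>\<open>h1 ^ 4\<close> is the Hilbert norm of \<open>X = H\<^sup>1(\<real>/\<int>, \<complex>)\<^sup>4\<close>.
\<close>

type_synonym potential = "h1 ^ 4"

definition pot_mult :: "complex \<Rightarrow> potential \<Rightarrow> potential" where
  "pot_mult c \<psi> = (\<chi> j. h1_mult c (\<psi> $ j))"

text \<open>
  Analyticity of maps between complex Banach spaces: Frechet differentiability at every point
  of an open set, the derivative being complex linear.
\<close>

definition pot_analytic_on :: "(potential \<Rightarrow> complex) \<Rightarrow> potential set \<Rightarrow> bool"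
    (infixl "pot'_analytic'_on" 50) where
  "F pot_analytic_on W \<longleftrightarrow>
     open W \<and>
     (\<forall>\<psi>\<in>W. \<exists>F'. (F has_derivative F') (at \<psi>) \<and> (\<forall>c h. F' (pot_mult c h) = c * F' h))"


section \<open>Fundamental solution and Dirichlet eigenvalues\<close>

text \<open>The spectral parameter is written \<open>\<zeta>\<close>, as \<open>\<lambda>\<close> is not available as a variable name.\<close>

definition \<sigma>\<^sub>3 :: "complex^2^2" where
  "\<sigma>\<^sub>3 = vector [vector [1, 0], vector [0, -1]]"

definition V_mat :: "complex \<Rightarrow> potential \<Rightarrow> real \<Rightarrow> complex^2^2" where
  "V_mat \<zeta> \<psi> t =
     (let p = (\<lambda>j. h1_fun (\<psi> $ j) t) in
      vector [vector [- \<i> * p 1 * p 2, 2 * \<zeta> * p 1 + \<i> * p 3],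
              vector [2 * \<zeta> * p 2 - \<i> * p 4, \<i> * p 1 * p 2]])"

text \<open>\<open>mat c ** A\<close> is the multiple of the matrix \<open>A\<close> by the complex scalar \<open>c\<close>.\<close>

definition fund_sol :: "complex \<Rightarrow> potential \<Rightarrow> real \<Rightarrow> complex^2^2" where
  "fund_sol \<zeta> \<psi> =
     (THE M. M 0 = mat 1 \<and>
        (\<forall>t. (M has_vector_derivative
                ((mat (- 2 * \<i> * \<zeta>\<^sup>2) ** \<sigma>\<^sub>3 + V_mat \<zeta> \<psi> t) ** M t)) (at t)))"

definition chi_D :: "potential \<Rightarrow> complex \<Rightarrow> complex" where
  "chi_D \<psi> \<zeta> =
     (let M = fund_sol \<zeta> \<psi> 1 in (M $ 2 $ 2 + M $ 2 $ 1 - M $ 1 $ 2 - M $ 1 $ 1) / (2 * \<i>))"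

definition dirichlet_eigenvalue :: "potential \<Rightarrow> complex \<Rightarrow> bool" where
  "dirichlet_eigenvalue \<psi> \<zeta> \<longleftrightarrow> chi_D \<psi> \<zeta> = 0"

definition dirichlet_mult :: "potential \<Rightarrow> complex \<Rightarrow> nat" where
  "dirichlet_mult \<psi> \<zeta> = (if dirichlet_eigenvalue \<psi> \<zeta> then nat (zorder (chi_D \<psi>) \<zeta>) else 0)"


section \<open>Discs and labelling\<close>

definition U_dom :: "int \<Rightarrow> complex set" where
  "U_dom m = {\<zeta>. cmod (2 * \<zeta>\<^sup>2 - of_int m * of_real pi) < pi / 4}"

definition B_disc :: "nat \<Rightarrow> complex set" where
  "B_disc N = {\<zeta>. cmod \<zeta> < sqrt ((real N + 1/4) * pi / 2)}"

text \<open>The superscript \<open>i\<close> ranges over \<open>{1, 2}\<close>; \<open>B_disc 0\<close> is the disc of radius \<open>sqrt (pi / 8)\<close>.\<close>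

definition D_disc :: "nat \<Rightarrow> int \<Rightarrow> complex set" where
  "D_disc i n =
     (if n = 0 then B_disc 0
      else if i = 1 then
        (if n > 0 then U_dom n \<inter> {\<zeta>. Re \<zeta> > 0} else U_dom (- n) \<inter> {\<zeta>. Re \<zeta> < 0})
      else
        (if n > 0 then U_dom (- n) \<inter> {\<zeta>. Im \<zeta> > 0} else U_dom n \<inter> {\<zeta>. Im \<zeta> < 0}))"

definition lex_le :: "complex \<Rightarrow> complex \<Rightarrow> bool" (infix "\<preceq>" 50) where
  "z \<preceq> w \<longleftrightarrow> Re z < Re w \<or> Re z = Re w \<and> Im z \<le> Im w"

text \<open>
  The second clause renders ``the remaining eigenvalues'': everything outside the discs with
  \<open>\<bar>n\<bar> > N\<close> lies in \<open>B_disc N\<close>, which is disjoint from those discs.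
\<close>

definition counting :: "potential \<Rightarrow> nat \<Rightarrow> bool" where
  "counting \<psi> N \<longleftrightarrow>
     (\<forall>i\<in>{1, 2}. \<forall>n. \<bar>n\<bar> > int N \<longrightarrow>
        (\<exists>z. {\<zeta>\<in>D_disc i n. dirichlet_eigenvalue \<psi> \<zeta>} = {z} \<and> dirichlet_mult \<psi> z = 1)) \<and>
     {\<zeta>. dirichlet_eigenvalue \<psi> \<zeta>} \<subseteq> B_disc N \<union> (\<Union>i\<in>{1, 2}. \<Union>n\<in>{n. \<bar>n\<bar> > int N}. D_disc i n) \<and>
     finite {\<zeta>\<in>B_disc N. dirichlet_eigenvalue \<psi> \<zeta>} \<and>
     (\<Sum>\<zeta> | \<zeta> \<in> B_disc N \<and> dirichlet_eigenvalue \<psi> \<zeta>. dirichlet_mult \<psi> \<zeta>) = 2 * (2 * N + 1)"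

definition label_bound :: "potential \<Rightarrow> nat" where
  "label_bound \<psi> = (LEAST N. counting \<psi> N)"

definition central_eigenvalues :: "potential \<Rightarrow> nat \<Rightarrow> complex list" where
  "central_eigenvalues \<psi> N =
     (THE xs. sorted_wrt (\<preceq>) xs \<and>
        (\<forall>\<zeta>. count (mset xs) \<zeta> = (if \<zeta> \<in> B_disc N then dirichlet_mult \<psi> \<zeta> else 0)))"

text \<open>The labels \<open>(i, n)\<close> with \<open>\<bar>n\<bar> \<le> N\<close> in the order in which they are assigned.\<close>

definition central_labels :: "nat \<Rightarrow> (nat \<times> int) list" where
  "central_labels N =
     map (Pair 1) [- int N .. - 1] @ map (Pair 2) [- int N .. - 1] @ [(1, 0), (2, 0)] @
     map (Pair 2) [1 .. int N] @ map (Pair 1) [1 .. int N]"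

definition \<mu> :: "nat \<Rightarrow> int \<Rightarrow> potential \<Rightarrow> complex" where
  "\<mu> i n \<psi> =
     (let N = label_bound \<psi> in
      if \<bar>n\<bar> > int N then THE \<zeta>. \<zeta> \<in> D_disc i n \<and> dirichlet_eigenvalue \<psi> \<zeta>
      else the (map_of (zip (central_labels N) (central_eigenvalues \<psi> N)) (i, n)))"

definition eigenvalues_in_discs :: "potential \<Rightarrow> bool" where
  "eigenvalues_in_discs \<psi> \<longleftrightarrow>
     (\<forall>i\<in>{1, 2}. (\<forall>n. \<bar>n\<bar> \<ge> 1 \<longrightarrow> \<mu> i n \<psi> \<in> D_disc i n) \<and> \<mu> i 0 \<psi> \<in> D_disc i 0)"

end

theory Submission
  imports Defs
begin

text \<open>
  Applied to the vector \<open>(1, 1)\<close>, the fundamental matrix gives \<open>chi_D = (v 1 - u 1) / (2 \<i>)\<close> for a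
  single solution \<open>(u, v)\<close>. Pairing with a solution of the adjoint system (variation of constants)
  shows that \<open>chi_D\<close> is jointly Frechet differentiable in the spectral parameter and the potential.
  After one integration by parts the diagonal entries of the system cancel the resonant part of the
  off-diagonal ones, whence \<open>chi_D = sin (2 \<zeta>\<^sup>2) + O(exp \<bar>Im (2 \<zeta>\<^sup>2)\<bar> / \<bar>\<zeta>\<bar>)\<close>, uniformly on
  bounded sets of potentials. Rouche's theorem localises the zeros, and \<open>2 \<mu>\<^sup>2\<close> differs from the
  free value by \<open>O(\<bar>n\<bar> powr (- 1 / 2))\<close>, which is the first claim. Simple zeros depend analytically
  on the potential, and Cauchy's estimate on complex lines turns uniform bounds into uniform
  Lipschitz bounds: for \<open>chi_D - sin\<close> this gives smallness near the zero potential, uniformly in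
  \<open>\<zeta>\<close>, hence the second claim; for \<open>\<mu> i n - \<mu> i n 0\<close> with large \<open>\<bar>n\<bar>\<close> it gives the continuity in
  the third.
\<close>

section \<open>Linear systems of ordinary differential equations\<close>

text \<open>Gronwall's inequality alone gives exponential growth in \<open>coef_bound\<close>,
  useless for large \<open>\<zeta>\<close>, since the off-diagonal entries grow like
  \<open>\<zeta>\<close>. What helps is an exact cancellation: with
  \<open>\<theta> = 2 * \<i> * \<zeta>\<^sup>2\<close>, the leading off-diagonal entries
  \<open>2 * \<zeta> * p 1\<close> and \<open>2 * \<zeta> * p 2\<close> have a product which,
  divided by \<open>2 * \<theta>\<close>, is \<open>- \<i> * p 1 * p 2\<close>, the opposite of the
  diagonal term. The error in twice the squared eigenvalue gains a further factor of order
  |n|^(-1/2) on division by the sum of the perturbed and the free eigenvalue; this produces the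
  weight in the first claim. The labels are the other obstacle. The minimal N varies with the
  potential, and up to it labels follow the lexicographic order, not the discs. On a bounded set one
  N, not necessarily minimal, serves all potentials, and beyond it labels and discs agree. For
  smaller indices the hypothesis of the third claim puts each labelled eigenvalue into its own disc,
  and disjointness of the discs then forces simplicity. The label 0 is exceptional: two labels share
  the central disc, where the free function has a double zero.\<close>

lemma interval_integral_has_vector_derivative:
  fixes f :: "real \<Rightarrow> 'a::euclidean_space"
  assumes f: "continuous_on UNIV f"
  shows "((\<lambda>t. LBINT s=0..t. f s) has_vector_derivative f t) (at t)"
proof -
  define T where "T = \<bar>t\<bar> + 1"
  have "((\<lambda>t. LBINT s=0..t. f s) has_vector_derivative f t) (at t within {-T..T})"
    using interval_integral_FTC2[of "-T" 0 T f t] continuous_on_subset[OF f, of "{-T..T}"]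
    by (simp add: T_def zero_ereal_def[symmetric])
  moreover have "t \<in> interior {-T..T}"
    by (auto simp: T_def)
  ultimately show ?thesis
    using at_within_interior[of t "{-T..T}"] by simp
qed

text \<open>Induction step for the factorial decay of the iterated integrals: one integration raises
  the power by one. The mean value estimate runs forward in time, so negative \<open>t\<close> is
  treated by reflection.\<close>

lemma norm_le_pow_fact:
  fixes f :: "real \<Rightarrow> 'a::real_normed_vector"
  assumes f0: "f 0 = 0"
    and f': "\<And>s. \<bar>s\<bar> \<le> T \<Longrightarrow> (f has_vector_derivative f' s) (at s)"
    and bound: "\<And>s. \<bar>s\<bar> \<le> T \<Longrightarrow> norm (f' s) \<le> B * \<bar>s\<bar> ^ n / fact n"
    and t: "\<bar>t\<bar> \<le> T"
  shows "norm (f t) \<le> B * \<bar>t\<bar> ^ Suc n / fact (Suc n)"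
proof -
  have d: "((\<lambda>s. B * s ^ Suc n / fact (Suc n)) has_vector_derivative B * s ^ n / fact n) (at s)"
    for s
  proof -
    have "((\<lambda>s. B * s ^ Suc n / fact (Suc n)) has_field_derivative
            B * (real (Suc n) * s ^ n) / fact (Suc n)) (at s)"
      using DERIV_cmult[OF DERIV_pow[of "Suc n" s UNIV], of "B / fact (Suc n)"]
        by (simp add: mult_ac)
    also have "B * (real (Suc n) * s ^ n) / fact (Suc n) = B * s ^ n / fact n"
      by (simp add: fact_Suc field_simps del: of_nat_Suc)
    finally show ?thesis by (simp add: has_real_derivative_iff_has_vector_derivative)
  qed
  have pos: "norm (g t) \<le> B * t ^ Suc n / fact (Suc n)"
    if g: "g 0 = 0" "\<And>s. s \<in> {0..t} \<Longrightarrow> (g has_vector_derivative g' s) (at s)"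
      "\<And>s. s \<in> {0..t} \<Longrightarrow> norm (g' s) \<le> B * s ^ n / fact n" "0 \<le> t"
    for g g' :: "real \<Rightarrow> 'a" and t
  proof (cases "t = 0")
    case False
    have "norm (g t - g 0) \<le> B * t ^ Suc n / fact (Suc n) - B * 0 ^ Suc n / fact (Suc n)"
    proof (rule differentiable_bound_general[where f'=g' and \<phi>'="\<lambda>s. B * s ^ n / fact n"])
      show "continuous_on {0..t} g"
        using g(2) by (intro continuous_at_imp_continuous_on ballI) (rule
          has_vector_derivative_continuous)
      show "continuous_on {0..t} (\<lambda>s. B * s ^ Suc n / fact (Suc n))"
        by (intro continuous_intros) auto
    qed (use False g d in auto)
    then show ?thesis using g(1) by simp
  qed (use g(1) in simp)
  show ?thesis
  proof (cases "t \<ge> 0")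
    case True
    have "norm (f t) \<le> B * t ^ Suc n / fact (Suc n)"
    proof (rule pos[where g'=f'])
      fix s assume s: "s \<in> {0..t}"
      then show "(f has_vector_derivative f' s) (at s)" using t by (intro f') auto
      show "norm (f' s) \<le> B * s ^ n / fact n" using bound[of s] s t by auto
    qed (use True f0 in auto)
    with True show ?thesis by simp
  next
    case False
    have "norm (f (- (- t))) \<le> B * (- t) ^ Suc n / fact (Suc n)"
    proof (rule pos[where g'="\<lambda>s. - f' (- s)"])
      fix s assume s: "s \<in> {0..- t}"
      have "((f \<circ> uminus) has_vector_derivative (- 1) *\<^sub>R f' (- s)) (at s)"
        by (rule vector_diff_chain_at) (use s t f'[of "-s"] in \<open>auto intro!: derivative_eq_intros\<close>)
      then show "((\<lambda>s. f (- s)) has_vector_derivative - f' (- s)) (at s)"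
        by (simp add: o_def)
      show "norm (- f' (- s)) \<le> B * s ^ n / fact n"
        using bound[of "- s"] s t by auto
    qed (use False f0 in auto)
    with False show ?thesis by simp
  qed
qed

text \<open>Existence is by the Peano--Baker series.\<close>

lemma linear_ode_exists:
  fixes a b c d :: "real \<Rightarrow> complex" and u0 v0 :: complex
  assumes cont: "continuous_on UNIV a" "continuous_on UNIV b"
    "continuous_on UNIV c" "continuous_on UNIV d"
  obtains u v where "u 0 = u0" "v 0 = v0"
    "\<And>t. (u has_vector_derivative a t * u t + b t * v t) (at t)"
    "\<And>t. (v has_vector_derivative c t * u t + d t * v t) (at t)"
proof -
  define K :: "real \<Rightarrow> complex \<times> complex \<Rightarrow> complex \<times> complex"
    where "K t y = (a t * fst y + b t * snd y, c t * fst y + d t * snd y)" for t y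
  \<comment> \<open>\<open>P n\<close> is the n-fold iterated integral, so the solution is the sum
    of all \<open>P n\<close>, not their limit.\<close>
  define P where "P = rec_nat (\<lambda>t. (u0, v0)) (\<lambda>_ p t. LBINT s=0..t. K s (p s))"
  have P0: "P 0 = (\<lambda>t. (u0, v0))" and PS: "P (Suc n) = (\<lambda>t. LBINT s=0..t. K s (P n s))" for n
    by (simp_all add: P_def)
  have Kcont: "continuous_on UNIV (\<lambda>t. K t (y t))" if "continuous_on UNIV y" for y
    unfolding K_def by (intro continuous_intros that cont)
  have Pcont: "continuous_on UNIV (P n)" for n
  proof (induction n)
    case (Suc n)
    show ?case unfolding PS
      by (intro continuous_at_imp_continuous_on ballI)
        (rule has_vector_derivative_continuous[OF interval_integral_has_vector_derivative[OF
          Kcont[OF Suc]]])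
  qed (simp add: P0)
  have PD: "(P (Suc n) has_vector_derivative K t (P n t)) (at t)" for n t
    unfolding PS by (rule interval_integral_has_vector_derivative[OF Kcont[OF Pcont]])
  have PS0: "P (Suc n) 0 = 0" for n
    unfolding PS by (simp add: zero_ereal_def[symmetric])
  have lin: "bounded_linear (K t)" for t
    unfolding K_def
    by (intro bounded_linear_Pair bounded_linear_add bounded_linear_mult_right
      bounded_linear_compose[OF bounded_linear_mult_right]
       bounded_linear_fst bounded_linear_snd)
  \<comment> \<open>The coefficients are bounded on compact intervals only, hence a local statement.
    It records that the solution is the sum of the same series for every \<open>T\<close>, which
    glues the local solutions together.\<close>
  have ex: "\<exists>Y. Y 0 = (u0, v0) \<and> (\<forall>t\<in>{-T<..<T}. (\<lambda>n. P n t) sums Y t \<and> (Y has_vector_derivative K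
    t (Y t)) (at t))"
    if T: "T > 0" for T :: real
  proof -
    have "compact ((\<lambda>t. norm (a t) + norm (b t) + norm (c t) + norm (d t)) ` {-T..T})"
      by (intro compact_continuous_image continuous_intros continuous_on_subset[OF cont(1)]
        continuous_on_subset[OF cont(2)] continuous_on_subset[OF cont(3)] continuous_on_subset[OF
          cont(4)]) auto
    then have "bounded ((\<lambda>t. norm (a t) + norm (b t) + norm (c t) + norm (d t)) ` {-T..T})"
      by (rule compact_imp_bounded)
    then obtain C where "\<forall>y\<in>(\<lambda>t. norm (a t) + norm (b t) + norm (c t) + norm (d t)) ` {-T..T}.
      norm y \<le> C"
      unfolding bounded_iff by blast
    then have C: "norm (a t) + norm (b t) + norm (c t) + norm (d t) \<le> C" if "t \<in> {-T..T}" for t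
      using that by (force dest: bspec)
    have "0 \<le> norm (a 0) + norm (b 0) + norm (c 0) + norm (d 0)" by simp
    also have "\<dots> \<le> C" using T by (intro C) auto
    finally have C0: "C \<ge> 0" .
    have KC: "norm (K t y) \<le> C * norm y" if "t \<in> {-T..T}" for t y
    proof -
      have f: "norm (fst y) \<le> norm y" "norm (snd y) \<le> norm y"
        by (cases y; simp add: norm_fst_le norm_snd_le)+
      have "norm (K t y) \<le> norm (a t * fst y + b t * snd y) + norm (c t * fst y + d t * snd y)"
        unfolding K_def by (rule norm_Pair_le)
      also have "\<dots> \<le> (norm (a t) * norm (fst y) + norm (b t) * norm (snd y)) + (norm (c t) * norm
        (fst y) + norm (d t) * norm (snd y))"
        by (intro add_mono order.trans[OF norm_triangle_ineq]) (auto simp: norm_mult)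
      also have "\<dots> \<le> (norm (a t) * norm y + norm (b t) * norm y) + (norm (c t) * norm y + norm (d
        t) * norm y)"
        by (intro add_mono mult_left_mono f) auto
      also have "\<dots> \<le> C * norm y"
        using mult_right_mono[OF C[OF that], of "norm y"] by (simp add: algebra_simps)
      finally show ?thesis .
    qed
    define D where "D = norm (u0, v0)"
    have PB: "norm (P n t) \<le> D * C ^ n * \<bar>t\<bar> ^ n / fact n" if "\<bar>t\<bar> \<le> T" for n t
      using that
    proof (induction n arbitrary: t)
      case (Suc n)
      have "norm (P (Suc n) t) \<le> D * C ^ Suc n * \<bar>t\<bar> ^ Suc n / fact (Suc n)"
      proof (rule norm_le_pow_fact[OF PS0 PD _ Suc.prems])
        fix s assume s: "\<bar>s\<bar> \<le> T"
        have "norm (K s (P n s)) \<le> C * norm (P n s)" by (rule KC) (use s in auto)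
        also have "\<dots> \<le> C * (D * C ^ n * \<bar>s\<bar> ^ n / fact n)"
          by (intro mult_left_mono Suc.IH s C0)
        finally show "norm (K s (P n s)) \<le> D * C ^ Suc n * \<bar>s\<bar> ^ n / fact n"
          by (simp add: mult_ac)
      qed
      then show ?case .
    qed (simp add: P0 D_def)
    have PB': "norm (P n t) \<le> D * ((C * T) ^ n /\<^sub>R fact n)" if "\<bar>t\<bar> \<le> T" for n t
    proof -
      have "D * C ^ n * \<bar>t\<bar> ^ n / fact n \<le> D * C ^ n * T ^ n / fact n"
        using that C0 by (intro divide_right_mono mult_left_mono power_mono) (auto simp: D_def)
      then show ?thesis using PB[OF that, of n] by (simp add: power_mult_distrib field_simps)
    qed
    have summ: "summable (\<lambda>n. D * ((C * T) ^ n /\<^sub>R fact n))"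
      by (intro summable_mult summable_exp_generic)
    define Y where "Y t = (\<Sum>n. P n t)" for t
    have Psum: "summable (\<lambda>n. P n t)" if "\<bar>t\<bar> \<le> T" for t
      by (rule summable_comparison_test'[OF summ, of 0]) (use PB' that in auto)
    have ulim: "uniform_limit {-T..T} (\<lambda>n t. \<Sum>i<n. P i t) Y sequentially"
      unfolding Y_def by (rule Weierstrass_m_test[OF _ summ]) (use PB' in auto)
    define G where "G t = K t (Y t)" for t
    \<comment> \<open>Uniform convergence of the differentiated series; the divisor
      \<open>C + 1\<close> keeps the case \<open>C = 0\<close> harmless.\<close>
    have ev: "\<forall>\<^sub>F n in sequentially. \<forall>x\<in>{-T..T}. \<forall>h. norm ((\<Sum>i<n. h *\<^sub>R K x (P i x)) - h *\<^sub>R G x)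
      \<le> e * norm h"
      if e: "e > 0" for e
    proof -
      have "\<forall>\<^sub>F n in sequentially. \<forall>x\<in>{-T..T}. dist (\<Sum>i<n. P i x) (Y x) < e / (C + 1)"
        using ulim e C0 unfolding uniform_limit_iff by (simp add: pos_divide_less_eq)
      then show ?thesis
      proof eventually_elim
        case (elim n)
        show ?case
        proof (intro ballI allI)
          fix x h assume x: "x \<in> {-T..T}"
          have "(\<Sum>i<n. h *\<^sub>R K x (P i x)) - h *\<^sub>R G x = h *\<^sub>R K x ((\<Sum>i<n. P i x) - Y x)"
            unfolding G_def
            by (simp add: bounded_linear.linear[OF lin] linear_sum linear_diff scaleR_sum_right
              scaleR_diff_right)
          also have "norm \<dots> \<le> \<bar>h\<bar> * (C * norm ((\<Sum>i<n. P i x) - Y x))"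
            using KC[OF x] by (simp add: mult_left_mono)
          also have "\<dots> \<le> \<bar>h\<bar> * (C * (e / (C + 1)))"
            using elim x C0 by (intro mult_left_mono) (auto simp: dist_norm less_imp_le)
          also have "\<dots> \<le> \<bar>h\<bar> * e"
            using C0 e by (intro mult_left_mono) (auto simp: field_simps)
          finally show "norm ((\<Sum>i<n. h *\<^sub>R K x (P i x)) - h *\<^sub>R G x) \<le> e * norm h"
            by (simp add: mult.commute)
        qed
      qed
    qed
    \<comment> \<open>The series starts at \<open>P 1\<close>, because only \<open>P (Suc n)\<close>
      is a primitive, namely of \<open>K t (P n t)\<close>. The constant \<open>P 0\<close> is added
      back in \<open>gY\<close>.\<close>
    have ps: "(\<lambda>n. P (Suc n) 0) sums 0" by (simp add: PS0)
    have "\<exists>g. \<forall>x\<in>{-T..T}. (\<lambda>n. P (Suc n) x) sums (g x) \<and> (g has_derivative (\<lambda>h. h *\<^sub>R G x)) (at x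
      within {-T..T})"
      by (rule has_derivative_series[where f="\<lambda>n. P (Suc n)" and f'="\<lambda>n x h. h *\<^sub>R K x (P n x)"
        and x=0, OF _ _ ev _ ps])
        (use T PD in \<open>auto simp: has_vector_derivative_def intro: has_derivative_at_withinI\<close>)
    then obtain g where g: "\<And>x. x \<in> {-T..T} \<Longrightarrow> (\<lambda>n. P (Suc n) x) sums (g x)"
      "\<And>x. x \<in> {-T..T} \<Longrightarrow> (g has_vector_derivative G x) (at x within {-T..T})"
      unfolding has_vector_derivative_def by blast
    have gY: "Y x = (u0, v0) + g x" if "x \<in> {-T..T}" for x
    proof -
      have "suminf (\<lambda>n. P (Suc n) x) = (\<Sum>n. P n x) - P 0 x"
        by (rule suminf_split_head) (use Psum that in auto)
      then show ?thesis using sums_unique[OF g(1)[OF that]] by (simp add: Y_def P0)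
    qed
    have "Y 0 = (u0, v0)"
    proof -
      have "0 \<in> {-T..T}" using T by simp
      from gY[OF this] sums_unique2[OF g(1)[OF this] ps] show ?thesis by simp
    qed
    moreover have "(\<lambda>n. P n x) sums Y x" if "x \<in> {-T<..<T}" for x
    proof -
      have "\<bar>x\<bar> \<le> T" using that by auto
      from summable_sums[OF Psum[OF this]] show ?thesis by (simp only: Y_def)
    qed
    moreover have "(Y has_vector_derivative K x (Y x)) (at x)" if x: "x \<in> {-T<..<T}" for x
    proof -
      have "(g has_vector_derivative G x) (at x)"
        using g(2)[of x] x at_within_interior[of x "{-T..T}"] by simp
      then have "((\<lambda>x. (u0, v0) + g x) has_vector_derivative G x) (at x)"
        by (auto intro!: derivative_eq_intros)
      then have "(Y has_vector_derivative G x) (at x)"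
        by (rule has_vector_derivative_transform_within_open[where S="{-T<..<T}"])
          (use x gY in auto)
      then show ?thesis by (simp add: G_def)
    qed
    ultimately show ?thesis by blast
  qed
  define Y where "Y t = (\<Sum>n. P n t)" for t
  have YD: "(Y has_vector_derivative K t (Y t)) (at t)" and Y0: "Y 0 = (u0, v0)" for t
  proof -
    define T where "T = \<bar>t\<bar> + 1"
    have "T > 0" by (simp add: T_def)
    from ex[OF this] obtain Z where Z: "Z 0 = (u0, v0)"
      "\<And>t. t\<in>{-T<..<T} \<Longrightarrow> (\<lambda>n. P n t) sums Z t"
      "\<And>t. t\<in>{-T<..<T} \<Longrightarrow> (Z has_vector_derivative K t (Z t)) (at t)" by blast
    have ZY: "Z s = Y s" if "s \<in> {-T<..<T}" for s
      using sums_unique[OF Z(2)[OF that]] by (simp add: Y_def)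
    have t: "t \<in> {-T<..<T}" by (auto simp: T_def)
    show "Y 0 = (u0, v0)" using Z(1) ZY[of 0] \<open>T > 0\<close> by simp
    show "(Y has_vector_derivative K t (Y t)) (at t)"
      using has_vector_derivative_transform_within_open[OF Z(3)[OF t] _ t ZY] ZY[OF t] by simp
  qed
  show ?thesis
  proof (rule that)
    show "(fst \<circ> Y) 0 = u0" "(snd \<circ> Y) 0 = v0" using Y0 by simp_all
    fix t
    show "((fst \<circ> Y) has_vector_derivative a t * (fst \<circ> Y) t + b t * (snd \<circ> Y) t) (at t)"
      "((snd \<circ> Y) has_vector_derivative c t * (fst \<circ> Y) t + d t * (snd \<circ> Y) t) (at t)"
      using bounded_linear.has_vector_derivative[OF bounded_linear_fst YD[of t]]
        bounded_linear.has_vector_derivative[OF bounded_linear_snd YD[of t]]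
      by (simp_all add: K_def o_def)
  qed
qed

section \<open>Pointwise bounds in \<open>H\<^sup>1\<close>\<close>

lemma set_integral_Icc_split:
  fixes f :: "real \<Rightarrow> 'a::{banach,second_countable_topology}"
  assumes int: "set_integrable lborel {0..1} f" and st: "0 \<le> s" "s \<le> t" "t \<le> 1"
  shows "(LBINT r:{0..t}. f r) = (LBINT r:{0..s}. f r) + (LBINT r:{s<..t}. f r)"
proof -
  have i0: "set_integrable lborel {0..s} f" "set_integrable lborel {s<..t} f"
    by (rule set_integrable_subset[OF int]; use st in auto)+
  have "(LBINT r:{0..t}. f r) = (LBINT r:{0..s} \<union> {s<..t}. f r)"
    using st by (intro arg_cong[where f="\<lambda>A. set_lebesgue_integral lborel A f"]) auto
  also have "\<dots> = (LBINT r:{0..s}. f r) + (LBINT r:{s<..t}. f r)"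
    by (rule set_integral_Un[OF _ i0]) auto
  finally show ?thesis .
qed

text \<open>Cauchy-Schwarz on the unit interval, by integrating Young's inequality with parameter
  \<open>e\<close>. The optimal choice \<open>e = N\<close> may be zero, so
  \<open>e = N + \<delta>\<close> is used and \<open>\<delta>\<close> is removed at the end.\<close>

lemma L1_le_L2:
  fixes h :: "real \<Rightarrow> complex"
  assumes [measurable]: "h \<in> borel_measurable borel"
    and sq: "set_integrable lborel {0..1} (\<lambda>t. (cmod (h t))\<^sup>2)"
    and N: "(LBINT t:{0..1}. (cmod (h t))\<^sup>2) \<le> N\<^sup>2" "N \<ge> 0"
  shows "set_integrable lborel {0..1} (\<lambda>t. cmod (h t))" "(LBINT t:{0..1}. cmod (h t)) \<le> N"
proof -
  have one: "set_integrable lborel {0..1::real} (\<lambda>t. c)" for c :: real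
    by (simp add: set_integrable_def)
  have "set_integrable lborel {0..1} (\<lambda>t. 1 + (cmod (h t))\<^sup>2)"
    by (rule set_integral_add(1)[OF one sq])
  then show int: "set_integrable lborel {0..1} (\<lambda>t. cmod (h t))"
    unfolding set_integrable_def
  proof (rule Bochner_Integration.integrable_bound)
    show "AE t in lborel. norm (indicat_real {0..1} t *\<^sub>R cmod (h t))
            \<le> norm (indicat_real {0..1} t *\<^sub>R (1 + (cmod (h t))\<^sup>2))"
    proof (rule AE_I2)
      fix t
      have "0 \<le> (cmod (h t) - 1)\<^sup>2 + (cmod (h t))\<^sup>2 + 1" by simp
      then have "cmod (h t) \<le> 1 + (cmod (h t))\<^sup>2" by (simp add: power2_diff)
      then show "norm (indicat_real {0..1} t *\<^sub>R cmod (h t))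
            \<le> norm (indicat_real {0..1} t *\<^sub>R (1 + (cmod (h t))\<^sup>2))"
        by (auto simp: indicator_def)
    qed
  qed measurable
  show "(LBINT t:{0..1}. cmod (h t)) \<le> N"
  proof (rule field_le_epsilon)
    fix \<delta> :: real assume "\<delta> > 0"
    define e where "e = N + \<delta>"
    have e: "e > 0" using \<open>\<delta> > 0\<close> N by (simp add: e_def)
    have "(LBINT t:{0..1}. cmod (h t)) \<le> (LBINT t:{0..1}. e / 2 + (cmod (h t))\<^sup>2 / (2 * e))"
    proof (rule set_integral_mono[OF int])
      show "set_integrable lborel {0..1} (\<lambda>t. e / 2 + (cmod (h t))\<^sup>2 / (2 * e))"
        by (intro set_integral_add(1) one set_integrable_divide sq)
      fix t
      have "0 \<le> (cmod (h t) - e)\<^sup>2" by simp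
      then show "cmod (h t) \<le> e / 2 + (cmod (h t))\<^sup>2 / (2 * e)"
        using e by (simp add: power2_diff field_simps power2_eq_square)
    qed
    also have "\<dots> = (LBINT t:{0..1::real}. e / 2) + (LBINT t:{0..1}. (cmod (h t))\<^sup>2 / (2 * e))"
      using set_integral_add(2)[OF one set_integrable_divide[OF sq, of "2 * e"], of "e / 2"] e
        by simp
    also have "(LBINT t:{0..1}. (cmod (h t))\<^sup>2 / (2 * e)) = (LBINT t:{0..1}. (cmod (h t))\<^sup>2) / (2
      * e)"
      by simp
    also have "(LBINT t:{0..1::real}. e / 2) = e / 2"
      by (simp add: set_lebesgue_integral_def)
    also have "(LBINT t:{0..1}. (cmod (h t))\<^sup>2) / (2 * e) \<le> N\<^sup>2 / (2 * e)"
      using e N by (intro divide_right_mono) auto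
    also have "N\<^sup>2 / (2 * e) \<le> e / 2"
      using e N \<open>\<delta> > 0\<close> by (auto simp: field_simps power2_eq_square e_def)
    also have "e / 2 + e / 2 = N + \<delta>" by (simp add: e_def)
    finally show "(LBINT t:{0..1}. cmod (h t)) \<le> N + \<delta>" by simp
  qed
qed

lemma norm_h1_sq:
  "(norm f)\<^sup>2 = (LBINT t:{0..1}. (cmod (h1_fun f t))\<^sup>2) + (LBINT t:{0..1}. (cmod (h1_diff f t))\<^sup>2)"
  using power2_norm_eq_inner[of f] by (simp add: inner_h1_def power2_norm_eq_inner)

lemma LBINT_sq_nonneg: "0 \<le> (LBINT t:{0..1}. (cmod (g t))\<^sup>2)"
  unfolding set_lebesgue_integral_def by (auto intro!: integral_nonneg_AE)

lemma h1_diff_L1: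
  shows "set_integrable lborel {0..1} (\<lambda>t. cmod (h1_diff f t))"
    and "(LBINT t:{0..1}. cmod (h1_diff f t)) \<le> norm f"
  using L1_le_L2[of "h1_diff f" "norm f"] h1_deriv_square_integrable[OF h1_diff, of f]
    LBINT_sq_nonneg[of "h1_fun f"] norm_h1_sq[of f]
  by simp_all

lemma h1_fun_periodic_of_int: "h1_fun f (t + of_int k) = h1_fun f t"
proof -
  have per: "h1_fun f (t + of_nat n) = h1_fun f t" for t n
    by (induction n) (use h1_periodic[of f] in \<open>auto simp: add.assoc[symmetric] add.commute[of 1]\<close>)
  show ?thesis
    using per[of t "nat k"] per[of "t + of_int k" "nat (- k)"] by (cases "k \<ge> 0") auto
qed

lemma h1_fun_continuous: "continuous_on UNIV (h1_fun f)"
proof (rule continuous_at_imp_continuous_on, rule ballI)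
  have 1: "continuous_on {of_int k..of_int k + 1} (h1_fun f)" for k
  proof -
    have "continuous_on {of_int k..of_int k + 1} (\<lambda>t. h1_fun f (t - of_int k))"
      by (rule continuous_on_compose2[OF h1_deriv_continuous[OF h1_diff]])
        (auto intro!: continuous_intros)
    moreover have "(\<lambda>t. h1_fun f (t - of_int k)) = h1_fun f"
      using h1_fun_periodic_of_int[of f _ "-k"] by (auto simp: fun_eq_iff)
    ultimately show ?thesis by metis
  qed
  fix t :: real
  define k where "k = \<lfloor>t\<rfloor> - 1"
  \<comment> \<open>Three adjacent unit intervals are glued so that \<open>t\<close>, possibly an
    integer, lies in the interior of their union.\<close>
  have eq: "{of_int k..of_int k + 3} = {of_int k..of_int k + 1} \<union>
      ({of_int (k + 1)..of_int (k + 1) + 1} \<union> {of_int (k + 2)..of_int (k + 2) + 1 :: real})"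
    by auto
  have "continuous_on {of_int k..of_int k + 3} (h1_fun f)"
    unfolding eq by (intro continuous_on_closed_Un 1 closed_Un closed_atLeastAtMost)
  moreover have "t \<in> interior {of_int k..of_int k + 3}"
    unfolding interior_atLeastAtMost_real greaterThanLessThan_iff k_def by simp linarith
  ultimately show "isCont (h1_fun f) t"
    by (rule continuous_on_interior)
qed

lemma h1_fun_diff_bound:
  assumes "s \<in> {0..1}" "t \<in> {0..1}"
  shows "cmod (h1_fun f t - h1_fun f s) \<le> norm f"
proof -
  have *: "cmod (h1_fun f t - h1_fun f s) \<le> norm f" if "s \<in> {0..1}" "t \<in> {0..1}" "s \<le> t" for s t
  proof -
    have int: "set_integrable lborel {0..1} (h1_diff f)"
      by (rule h1_deriv_set_integrable[OF h1_diff])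
    then have i0: "set_integrable lborel {s<..t} (h1_diff f)"
      by (rule set_integrable_subset) (use that in auto)
    have "(LBINT r:{0..t}. h1_diff f r) = (LBINT r:{0..s}. h1_diff f r) + (LBINT r:{s<..t}.
      h1_diff f r)"
      by (rule set_integral_Icc_split[OF int]) (use that in auto)
    then have "h1_fun f t - h1_fun f s = (LBINT r:{s<..t}. h1_diff f r)"
      using h1_deriv_integral[OF h1_diff, of t f] h1_deriv_integral[OF h1_diff, of s f] that by simp
    also have "cmod \<dots> \<le> (LBINT r:{s<..t}. cmod (h1_diff f r))"
      by (rule set_integral_norm_bound[OF i0])
    also have "\<dots> \<le> (LBINT r:{0..1}. cmod (h1_diff f r))"
      unfolding set_lebesgue_integral_def
    proof (rule integral_mono)
      show "integrable lborel (\<lambda>r. indicat_real {s<..t} r *\<^sub>R cmod (h1_diff f r))"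
        using set_integrable_subset[OF h1_diff_L1(1)[of f], of "{s<..t}"] that
        unfolding set_integrable_def by (auto simp: subset_iff)
      show "integrable lborel (\<lambda>r. indicat_real {0..1} r *\<^sub>R cmod (h1_diff f r))"
        using h1_diff_L1(1)[of f] by (simp add: set_integrable_def)
    qed (use that in \<open>auto simp: indicator_def\<close>)
    also have "\<dots> \<le> norm f" by (rule h1_diff_L1)
    finally show ?thesis .
  qed
  show ?thesis
    using *[of s t] *[of t s] assms by (cases "s \<le> t") (auto simp: norm_minus_commute)
qed

text \<open>Sobolev embedding: the oscillation is at most \<open>norm f\<close>, so averaging over
  \<open>s\<close> in a period bounds the value at \<open>t\<close> by the mean of the modulus plus
  \<open>norm f\<close>, and the mean is again at most \<open>norm f\<close>.\<close>

lemma h1_sup_bound: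
  assumes t: "t \<in> {0..1}"
  shows "cmod (h1_fun f t) \<le> 2 * norm f"
proof -
  have [measurable]: "h1_fun f \<in> borel_measurable borel"
    by (rule borel_measurable_continuous_onI[OF h1_fun_continuous])
  have sq: "set_integrable lborel {0..1} (\<lambda>t. (cmod (h1_fun f t))\<^sup>2)"
    using h1_fun_set_integrable[of f f] by (simp add: power2_norm_eq_inner)
  have i: "set_integrable lborel {0..1} (\<lambda>t. cmod (h1_fun f t))"
     "(LBINT t:{0..1}. cmod (h1_fun f t)) \<le> norm f"
    using L1_le_L2[of "h1_fun f" "norm f"] sq LBINT_sq_nonneg[of "h1_diff f"] norm_h1_sq[of f]
      by auto
  have one: "set_integrable lborel {0..1::real} (\<lambda>t. c)" for c :: real
    by (simp add: set_integrable_def)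
  have "cmod (h1_fun f t) = (LBINT s:{0..1::real}. cmod (h1_fun f t))"
    by (simp add: set_lebesgue_integral_def)
  also have "\<dots> \<le> (LBINT s:{0..1}. cmod (h1_fun f s) + norm f)"
  proof (rule set_integral_mono[OF one])
    show "set_integrable lborel {0..1} (\<lambda>s. cmod (h1_fun f s) + norm f)"
      by (intro set_integral_add i one)
    fix s :: real assume "s \<in> {0..1}"
    then show "cmod (h1_fun f t) \<le> cmod (h1_fun f s) + norm f"
      using h1_fun_diff_bound[of s t f] t norm_triangle_ineq2[of "h1_fun f t" "h1_fun f s"] by simp
  qed
  also have "\<dots> = (LBINT s:{0..1}. cmod (h1_fun f s)) + (LBINT s:{0..1::real}. norm f)"
    by (intro set_integral_add i one)
  also have "\<dots> \<le> norm f + norm f"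
    using i(2) by (simp add: set_lebesgue_integral_def)
  finally show ?thesis by simp
qed

text \<open>The norm comes from a real inner product, so homogeneity under complex scalars has to be
  checked on the integrals. As \<open>h1_diff\<close> is a chosen representative, it commutes with
  the scalar only almost everywhere.\<close>

lemma norm_h1_mult: "norm (h1_mult c f) = cmod c * norm f"
proof -
  have "h1_deriv (h1_fun (h1_mult c f)) (\<lambda>t. c * h1_diff f t)"
    using h1_deriv_mult[OF h1_diff, of c f] by (simp add: h1_fun_mult[abs_def])
  from h1_deriv_unique[OF h1_diff this]
  have AE: "AE t in lborel. t \<in> {0..1} \<longrightarrow> h1_diff (h1_mult c f) t = c * h1_diff f t" .
  have "(LBINT t:{0..1}. (cmod (h1_diff (h1_mult c f) t))\<^sup>2) = (LBINT t:{0..1}. (cmod c)\<^sup>2 * (cmod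
    (h1_diff f t))\<^sup>2)"
    unfolding set_lebesgue_integral_def
  proof (rule integral_cong_AE)
    show "AE t in lborel. indicat_real {0..1} t *\<^sub>R (cmod (h1_diff (h1_mult c f) t))\<^sup>2
         = indicat_real {0..1} t *\<^sub>R ((cmod c)\<^sup>2 * (cmod (h1_diff f t))\<^sup>2)"
      using AE by eventually_elim (auto simp: indicator_def norm_mult power_mult_distrib)
  qed measurable
  then have "(norm (h1_mult c f))\<^sup>2 = (cmod c * norm f)\<^sup>2"
    unfolding norm_h1_sq power_mult_distrib
    by (simp add: h1_fun_mult norm_mult power_mult_distrib distrib_left)
  then show ?thesis
    by (simp add: power2_eq_iff_nonneg)
qed

lemma norm_pot_mult: "norm (pot_mult c \<psi>) = cmod c * norm \<psi>"
  by (simp add: norm_vec_def pot_mult_def norm_h1_mult L2_set_right_distrib)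

lemma pot_sup_bound: "t \<in> {0..1} \<Longrightarrow> cmod (h1_fun (\<psi> $ j) t) \<le> 2 * norm \<psi>"
  using h1_sup_bound[of t "\<psi> $ j"] Finite_Cartesian_Product.norm_nth_le[of \<psi> j] by linarith

lemma pot_mult_add_left: "pot_mult (c + d) \<psi> = pot_mult c \<psi> + pot_mult d \<psi>"
  by (auto simp: pot_mult_def vec_eq_iff h1_fun_mult h1_fun_add distrib_right intro!: h1_eqI)

lemma pot_mult_of_real: "pot_mult (of_real r) \<psi> = r *\<^sub>R \<psi>"
  by (auto simp: pot_mult_def vec_eq_iff h1_fun_mult h1_fun_scaleR intro!: h1_eqI)

lemma bounded_linear_pot_mult_left: "bounded_linear (\<lambda>c. pot_mult c \<psi>)"
proof (rule bounded_linear_intro)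
  show "pot_mult (r *\<^sub>R x) \<psi> = r *\<^sub>R pot_mult x \<psi>" for r x
    by (auto simp: pot_mult_def vec_eq_iff h1_fun_mult h1_fun_scaleR scaleR_conv_of_real intro!:
      h1_eqI)
  show "norm (pot_mult x \<psi>) \<le> norm x * norm \<psi>" for x by (simp add: norm_pot_mult)
qed (rule pot_mult_add_left)

section \<open>The first-order system\<close>

text \<open>Squared moduli are differentiable also where \<open>u\<close> or \<open>v\<close>
  vanishes. Their sum \<open>f\<close> satisfies f' <= (4 C + 1) f + 2 \<epsilon>^2 by Young's
  inequality, so \<open>f + 2 * \<epsilon>\<^sup>2\<close> times the decaying exponential is
  nonincreasing.\<close>

lemma gronwall_pair:
  fixes u v u' v' :: "real \<Rightarrow> complex"
  assumes u: "\<And>t. t \<in> {0..1} \<Longrightarrow> (u has_vector_derivative u' t) (at t)"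
    and v: "\<And>t. t \<in> {0..1} \<Longrightarrow> (v has_vector_derivative v' t) (at t)"
    and u': "\<And>t. t \<in> {0..1} \<Longrightarrow> cmod (u' t) \<le> C * (cmod (u t) + cmod (v t)) + \<epsilon>"
    and v': "\<And>t. t \<in> {0..1} \<Longrightarrow> cmod (v' t) \<le> C * (cmod (u t) + cmod (v t)) + \<epsilon>"
    and C: "C \<ge> 0" and \<epsilon>: "\<epsilon> \<ge> 0" and t: "t \<in> {0..1}"
  shows "(cmod (u t))\<^sup>2 + (cmod (v t))\<^sup>2
    \<le> ((cmod (u 0))\<^sup>2 + (cmod (v 0))\<^sup>2 + 2 * \<epsilon>\<^sup>2) * exp (4 * C + 1)"
proof -
  define f where "f t = u t \<bullet> u t + v t \<bullet> v t" for t
  define D where "D = 4 * C + 1"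
  define F where "F t = (f t + 2 * \<epsilon>\<^sup>2) * exp (- D * t)" for t
  have "F t \<le> F 0"
  proof (rule DERIV_nonpos_imp_nonincreasing[where f=F and a=0 and b=t])
    show "0 \<le> t" using t by simp
    fix x assume x: "0 \<le> x" "x \<le> t"
    then have x01: "x \<in> {0..1}" using t by auto
    define f' where "f' = 2 * (u x \<bullet> u' x) + 2 * (v x \<bullet> v' x)"
    have ud: "(u has_derivative (\<lambda>h. h *\<^sub>R u' x)) (at x)"
      and vd: "(v has_derivative (\<lambda>h. h *\<^sub>R v' x)) (at x)"
      using u[OF x01] v[OF x01] by (simp_all add: has_vector_derivative_def)
    have "(f has_derivative (\<lambda>h. f' * h)) (at x)"
      unfolding f_def
      by (rule has_derivative_eq_rhs[OF has_derivative_add[OF has_derivative_inner[OF ud ud]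
        has_derivative_inner[OF vd vd]]])
        (auto simp: f'_def inner_commute algebra_simps)
    then have fd: "(f has_field_derivative f') (at x)"
      by (simp add: has_field_derivative_def)
    have Fd: "(F has_field_derivative (f' - D * (f x + 2 * \<epsilon>\<^sup>2)) * exp (- D * x)) (at x)"
      unfolding F_def by (rule derivative_eq_intros fd refl)+ (simp add: algebra_simps)
    have a: "u x \<bullet> u' x \<le> cmod (u x) * (C * (cmod (u x) + cmod (v x)) + \<epsilon>)"
      using order.trans[OF norm_cauchy_schwarz mult_left_mono[OF u'[OF x01] norm_ge_zero]] .
    have b: "v x \<bullet> v' x \<le> cmod (v x) * (C * (cmod (u x) + cmod (v x)) + \<epsilon>)"
      using order.trans[OF norm_cauchy_schwarz mult_left_mono[OF v'[OF x01] norm_ge_zero]] .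
    define p q where "p = cmod (u x)" and "q = cmod (v x)"
    have fpq: "f x = p\<^sup>2 + q\<^sup>2" by (simp add: f_def p_def q_def power2_norm_eq_inner)
    have "f' \<le> 2 * C * (p + q)\<^sup>2 + 2 * (p * \<epsilon>) + 2 * (q * \<epsilon>)"
      using a b unfolding f'_def p_def[symmetric] q_def[symmetric]
      by (simp add: algebra_simps power2_eq_square)
    also have "C * (p + q)\<^sup>2 \<le> C * (2 * (p\<^sup>2 + q\<^sup>2))"
      using C zero_le_power2[of "p - q"] by (intro mult_left_mono) (auto simp: power2_eq_square
        algebra_simps)
    then have "2 * C * (p + q)\<^sup>2 + 2 * (p * \<epsilon>) + 2 * (q * \<epsilon>) \<le> 4 * C * (p\<^sup>2 + q\<^sup>2) + 2 * (p * \<epsilon>) +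
      2 * (q * \<epsilon>)"
      by (simp add: algebra_simps)
    also have "2 * (p * \<epsilon>) + 2 * (q * \<epsilon>) \<le> (p\<^sup>2 + \<epsilon>\<^sup>2) + (q\<^sup>2 + \<epsilon>\<^sup>2)"
      using zero_le_power2[of "p - \<epsilon>"] zero_le_power2[of "q - \<epsilon>"]
      by (simp add: power2_eq_square algebra_simps)
    then have "4 * C * (p\<^sup>2 + q\<^sup>2) + 2 * (p * \<epsilon>) + 2 * (q * \<epsilon>) \<le> D * (f x) + 2 * \<epsilon>\<^sup>2"
      by (simp add: D_def fpq algebra_simps)
    also have "\<dots> \<le> D * (f x + 2 * \<epsilon>\<^sup>2)"
      using C by (simp add: D_def algebra_simps)
    finally have "(f' - D * (f x + 2 * \<epsilon>\<^sup>2)) * exp (- D * x) \<le> 0"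
      by (intro mult_nonpos_nonneg) auto
    with Fd show "\<exists>y. (F has_real_derivative y) (at x) \<and> y \<le> 0" by blast
  qed
  then have "(f t + 2 * \<epsilon>\<^sup>2) * exp (- D * t) \<le> f 0 + 2 * \<epsilon>\<^sup>2"
    by (simp add: F_def)
  then have "f t + 2 * \<epsilon>\<^sup>2 \<le> (f 0 + 2 * \<epsilon>\<^sup>2) * exp (D * t)"
    by (simp add: exp_minus field_simps)
  also have "\<dots> \<le> (f 0 + 2 * \<epsilon>\<^sup>2) * exp D"
    using t C by (intro mult_left_mono) (auto simp: f_def D_def intro!: mult_left_le)
  finally have "f t \<le> (f 0 + 2 * \<epsilon>\<^sup>2) * exp D" by (simp add: add_increasing2 order.trans[rotated])
  then show ?thesis by (simp add: f_def D_def power2_norm_eq_inner)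
qed

text \<open>Entries of the coefficient matrix. It has trace zero, so the second diagonal entry is
  \<open>- coef_a\<close> and three functions suffice.\<close>

definition coef_a :: "complex \<Rightarrow> potential \<Rightarrow> real \<Rightarrow> complex" where
  "coef_a \<zeta> \<psi> t = - 2 * \<i> * \<zeta>\<^sup>2 - \<i> * h1_fun (\<psi> $ 1) t * h1_fun (\<psi> $ 2) t"

definition coef_b :: "complex \<Rightarrow> potential \<Rightarrow> real \<Rightarrow> complex" where
  "coef_b \<zeta> \<psi> t = 2 * \<zeta> * h1_fun (\<psi> $ 1) t + \<i> * h1_fun (\<psi> $ 3) t"

definition coef_c :: "complex \<Rightarrow> potential \<Rightarrow> real \<Rightarrow> complex" where
  "coef_c \<zeta> \<psi> t = 2 * \<zeta> * h1_fun (\<psi> $ 2) t - \<i> * h1_fun (\<psi> $ 4) t"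

lemma continuous_coef [continuous_intros]:
  "continuous_on UNIV (coef_a \<zeta> \<psi>)" "continuous_on UNIV (coef_b \<zeta> \<psi>)" "continuous_on UNIV (coef_c
    \<zeta> \<psi>)"
  unfolding coef_a_def coef_b_def coef_c_def by (intro continuous_intros h1_fun_continuous)+

definition is_sol :: "complex \<Rightarrow> potential \<Rightarrow> (real \<Rightarrow> complex) \<Rightarrow> (real \<Rightarrow> complex) \<Rightarrow> bool" where
  "is_sol \<zeta> \<psi> u v \<longleftrightarrow>
     (\<forall>t. (u has_vector_derivative coef_a \<zeta> \<psi> t * u t + coef_b \<zeta> \<psi> t * v t) (at t) \<and>
          (v has_vector_derivative coef_c \<zeta> \<psi> t * u t - coef_a \<zeta> \<psi> t * v t) (at t))"

lemma is_sol_exists: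
  obtains u v where "is_sol \<zeta> \<psi> u v" "u 0 = u0" "v 0 = v0"
proof -
  have "continuous_on UNIV (\<lambda>t. - coef_a \<zeta> \<psi> t)" by (intro continuous_intros)
  from linear_ode_exists[OF continuous_coef[of \<zeta> \<psi>] this, where ?u0.0=u0 and ?v0.0=v0]
  obtain u v where "u 0 = u0" "v 0 = v0"
    "\<And>t. (u has_vector_derivative coef_a \<zeta> \<psi> t * u t + coef_b \<zeta> \<psi> t * v t) (at t)"
    "\<And>t. (v has_vector_derivative coef_c \<zeta> \<psi> t * u t + (- coef_a \<zeta> \<psi> t) * v t) (at t)"
    by blast
  then show ?thesis by (intro that[of u v]) (auto simp: is_sol_def)
qed

text \<open>The adjoint system, solved by row vectors; pairing it with a solution gives a constant.\<close>

definition is_adj :: "complex \<Rightarrow> potential \<Rightarrow> (real \<Rightarrow> complex) \<Rightarrow> (real \<Rightarrow> complex) \<Rightarrow> bool" where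
  "is_adj \<zeta> \<psi> r w \<longleftrightarrow>
     (\<forall>t. (r has_vector_derivative - (coef_a \<zeta> \<psi> t * r t + coef_c \<zeta> \<psi> t * w t)) (at t) \<and>
          (w has_vector_derivative - (coef_b \<zeta> \<psi> t * r t - coef_a \<zeta> \<psi> t * w t)) (at t))"

text \<open>Substituting \<open>t0 - t\<close> for the time turns data at \<open>t0\<close> into
  initial data. The free choice of \<open>t0\<close> matters: it is 1 for the derivative of
  \<open>chi_D\<close> and arbitrary for uniqueness.\<close>

lemma is_adj_exists:
  obtains r w where "is_adj \<zeta> \<psi> r w" "r t0 = r0" "w t0 = w0"
proof -
  have cont: "continuous_on UNIV (\<lambda>t. f (t0 - t))" if "continuous_on UNIV f"
    for f :: "real \<Rightarrow> complex"
    by (rule continuous_on_compose2[OF that]) (auto intro!: continuous_intros)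
  have neg: "continuous_on UNIV (\<lambda>t. - coef_a \<zeta> \<psi> t)" by (intro continuous_intros)
  from linear_ode_exists[OF cont[OF continuous_coef(1)[of \<zeta> \<psi>]] cont[OF continuous_coef(3)[of \<zeta> \<psi>]]
      cont[OF continuous_coef(2)[of \<zeta> \<psi>]] cont[OF neg], where ?u0.0=r0 and ?v0.0=w0]
  obtain r w where r0: "r 0 = r0" "w 0 = w0"
    and r: "\<And>t. (r has_vector_derivative coef_a \<zeta> \<psi> (t0 - t) * r t + coef_c \<zeta> \<psi> (t0 - t) * w t)
      (at t)"
    and w: "\<And>t. (w has_vector_derivative coef_b \<zeta> \<psi> (t0 - t) * r t + (- coef_a \<zeta> \<psi> (t0 - t)) * w
      t) (at t)"
    by blast
  have rev: "((\<lambda>t. f (t0 - t)) has_vector_derivative - D (t0 - t)) (at t)"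
    if "\<And>t. (f has_vector_derivative D t) (at t)" for f D :: "real \<Rightarrow> complex" and t
  proof -
    have "((f \<circ> (\<lambda>t. t0 - t)) has_vector_derivative (- 1) *\<^sub>R D (t0 - t)) (at t)"
      by (rule vector_diff_chain_at) (auto intro!: derivative_eq_intros that)
    then show ?thesis by (simp add: o_def)
  qed
  have "is_adj \<zeta> \<psi> (\<lambda>t. r (t0 - t)) (\<lambda>t. w (t0 - t))"
    unfolding is_adj_def using rev[OF r] rev[OF w] by simp
  from that[OF this] show ?thesis by (simp add: r0)
qed

text \<open>All coefficient terms cancel, so only the defect of \<open>(u, v)\<close> as a solution
  survives. This is variation of constants in differential form.\<close>

lemma is_adj_pairing:
  assumes adj: "is_adj \<zeta> \<psi> r w" and u: "(u has_vector_derivative u') (at t)"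
    and v: "(v has_vector_derivative v') (at t)"
  shows "((\<lambda>t. r t * u t + w t * v t) has_vector_derivative
     r t * (u' - (coef_a \<zeta> \<psi> t * u t + coef_b \<zeta> \<psi> t * v t)) +
     w t * (v' - (coef_c \<zeta> \<psi> t * u t - coef_a \<zeta> \<psi> t * v t))) (at t)"
  using adj unfolding is_adj_def
  by (auto intro!: derivative_eq_intros u v simp: algebra_simps)

text \<open>The difference of two solutions, paired with an adjoint solution having prescribed
  values at \<open>t\<close>, is constant in time and zero at time 0; hence every linear functional
  of the difference vanishes at \<open>t\<close>.\<close>

lemma is_sol_unique:
  assumes "is_sol \<zeta> \<psi> u v" "is_sol \<zeta> \<psi> u' v'" "u 0 = u' 0" "v 0 = v' 0"
  shows "u = u'" "v = v'"
proof -
  have *: "r0 * (u t - u' t) + w0 * (v t - v' t) = 0" for t r0 w0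
  proof -
    obtain r w where rw: "is_adj \<zeta> \<psi> r w" "r t = r0" "w t = w0"
      by (rule is_adj_exists)
    define G where "G s = r s * (u s - u' s) + w s * (v s - v' s)" for s
    have "(G has_vector_derivative 0) (at s)" for s
    proof -
      have u: "((\<lambda>s. u s - u' s) has_vector_derivative
          (coef_a \<zeta> \<psi> s * (u s - u' s) + coef_b \<zeta> \<psi> s * (v s - v' s))) (at s)"
        and v: "((\<lambda>s. v s - v' s) has_vector_derivative
          (coef_c \<zeta> \<psi> s * (u s - u' s) - coef_a \<zeta> \<psi> s * (v s - v' s))) (at s)"
        using assms unfolding is_sol_def by (auto intro!: derivative_eq_intros simp: algebra_simps)
      from is_adj_pairing[OF rw(1) u v] show ?thesis by (simp add: G_def[abs_def])
    qed
    then obtain c where "\<And>s. G s = c"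
      using has_vector_derivative_zero_constant[of UNIV G] by auto
    then have "G t = G 0" by simp
    then show ?thesis using rw assms by (simp add: G_def)
  qed
  show "u = u'" "v = v'"
    using *[of 1 _ 0] *[of 0 _ 1] by (auto simp: fun_eq_iff)
qed

section \<open>From the fundamental matrix to scalar systems\<close>

lemma has_vector_derivative_vec:
  fixes f :: "real \<Rightarrow> 'a::real_normed_vector ^ 'n"
  assumes "\<And>i. ((\<lambda>t. f t $ i) has_vector_derivative D $ i) F"
  shows "(f has_vector_derivative D) F"
proof -
  have bl: "bounded_linear (axis i :: 'a \<Rightarrow> 'a ^ 'n)" for i
  proof (rule bounded_linear_intro)
    show "norm (axis i x :: 'a ^ 'n) \<le> norm x * 1" for x
    proof -
      have "norm (axis i x :: 'a ^ 'n) \<le> (\<Sum>j\<in>UNIV. norm ((axis i x :: 'a ^ 'n) $ j))"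
        unfolding norm_vec_def by (rule L2_set_le_sum) simp
      also have "\<dots> = (\<Sum>j\<in>UNIV. if j = i then norm x else 0)"
        by (intro sum.cong) (auto simp: axis_def)
      finally show ?thesis by simp
    qed
  qed (auto simp: axis_def vec_eq_iff)
  have ax: "(\<Sum>i\<in>UNIV. axis i (x $ i)) = x" for x :: "'a ^ 'n"
    by (simp add: vec_eq_iff axis_def)
  have "((\<lambda>t. \<Sum>i\<in>UNIV. axis i (f t $ i)) has_vector_derivative (\<Sum>i\<in>UNIV. axis i (D $ i))) F"
    by (intro has_vector_derivative_sum bounded_linear.has_vector_derivative[OF bl] assms)
  then show ?thesis by (simp only: ax)
qed

lemma has_vector_derivative_vec_iff:
  fixes f :: "real \<Rightarrow> 'a::real_normed_vector ^ 'n"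
  shows "(f has_vector_derivative D) F \<longleftrightarrow> (\<forall>i. ((\<lambda>t. f t $ i) has_vector_derivative D $ i) F)"
  using has_vector_derivative_vec[of f D F]
    bounded_linear.has_vector_derivative[OF bounded_linear_vec_nth, of f D F] by blast

lemma fund_sol_ode_iff:
  fixes M :: "real \<Rightarrow> complex^2^2"
  shows "(\<forall>t. (M has_vector_derivative ((mat (- 2 * \<i> * \<zeta>\<^sup>2) ** \<sigma>\<^sub>3 + V_mat \<zeta> \<psi> t) ** M t)) (at
    t)) \<longleftrightarrow>
    (\<forall>j. is_sol \<zeta> \<psi> (\<lambda>t. M t $ 1 $ j) (\<lambda>t. M t $ 2 $ j))"
proof -
  have m: "mat (- 2 * \<i> * \<zeta>\<^sup>2) ** \<sigma>\<^sub>3 + V_mat \<zeta> \<psi> t =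
     vector [vector [coef_a \<zeta> \<psi> t, coef_b \<zeta> \<psi> t], vector [coef_c \<zeta> \<psi> t, - coef_a \<zeta> \<psi> t]]" for t
    by (simp add: vec_eq_iff forall_2 matrix_matrix_mult_def sum_2 mat_def \<sigma>\<^sub>3_def V_mat_def Let_def
      coef_a_def coef_b_def coef_c_def)
  show ?thesis unfolding m has_vector_derivative_vec_iff is_sol_def forall_2
    by (simp add: matrix_matrix_mult_def sum_2) blast
qed

text \<open>The definite description behind \<open>fund_sol\<close> carries information only after
  existence and uniqueness are known; both hold column by column.\<close>

lemma fund_sol_columns:
  "is_sol \<zeta> \<psi> (\<lambda>t. fund_sol \<zeta> \<psi> t $ 1 $ j) (\<lambda>t. fund_sol \<zeta> \<psi> t $ 2 $ j)"
  and fund_sol_0: "fund_sol \<zeta> \<psi> 0 = mat 1"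
proof -
  obtain u1 v1 where 1: "is_sol \<zeta> \<psi> u1 v1" "u1 0 = 1" "v1 0 = 0" by (rule is_sol_exists)
  obtain u2 v2 where 2: "is_sol \<zeta> \<psi> u2 v2" "u2 0 = 0" "v2 0 = 1" by (rule is_sol_exists)
  define M :: "real \<Rightarrow> complex^2^2" where "M t = vector [vector [u1 t, u2 t], vector [v1 t, v2 t]]"
    for t
  let ?P = "\<lambda>M. M 0 = mat 1 \<and> (\<forall>j. is_sol \<zeta> \<psi> (\<lambda>t. M t $ 1 $ j) (\<lambda>t. M t $ 2 $ j))"
  have "?P M"
    using 1 2 by (simp add: M_def forall_2 vec_eq_iff mat_def)
  moreover have "N = M" if N: "?P N" for N
  proof -
    have "(\<lambda>t. N t $ 1 $ j) = (\<lambda>t. M t $ 1 $ j) \<and> (\<lambda>t. N t $ 2 $ j) = (\<lambda>t. M t $ 2 $ j)" for j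
    proof -
      have NM: "is_sol \<zeta> \<psi> (\<lambda>t. N t $ 1 $ j) (\<lambda>t. N t $ 2 $ j)" "is_sol \<zeta> \<psi> (\<lambda>t. M t $ 1 $ j) (\<lambda>t.
        M t $ 2 $ j)"
        and 0: "N 0 $ 1 $ j = M 0 $ 1 $ j" "N 0 $ 2 $ j = M 0 $ 2 $ j"
        using N \<open>?P M\<close> by auto
      from is_sol_unique[OF NM 0] show ?thesis by blast
    qed
    then show ?thesis by (simp add: fun_eq_iff vec_eq_iff forall_2)
  qed
  ultimately have "?P (fund_sol \<zeta> \<psi>)"
    unfolding fund_sol_def fund_sol_ode_iff by (rule theI)
  then show "is_sol \<zeta> \<psi> (\<lambda>t. fund_sol \<zeta> \<psi> t $ 1 $ j) (\<lambda>t. fund_sol \<zeta> \<psi> t $ 2 $ j)"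
    "fund_sol \<zeta> \<psi> 0 = mat 1" by auto
qed

lemma chi_D_eq:
  assumes sol: "is_sol \<zeta> \<psi> u v" "u 0 = 1" "v 0 = 1"
  shows "chi_D \<psi> \<zeta> = (v 1 - u 1) / (2 * \<i>)"
proof -
  let ?M = "fund_sol \<zeta> \<psi>"
  have "is_sol \<zeta> \<psi> (\<lambda>t. ?M t $ 1 $ 1 + ?M t $ 1 $ 2) (\<lambda>t. ?M t $ 2 $ 1 + ?M t $ 2 $ 2)"
    using fund_sol_columns[of \<zeta> \<psi> 1] fund_sol_columns[of \<zeta> \<psi> 2] unfolding is_sol_def
    by (auto intro!: derivative_eq_intros simp: algebra_simps)
  from is_sol_unique[OF sol(1) this] sol fund_sol_0[of \<zeta> \<psi>]
  show ?thesis by (simp add: chi_D_def Let_def mat_def algebra_simps)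
qed

lemma has_vector_derivative_exp_of_real:
  "((\<lambda>t. exp (c * of_real t)) has_vector_derivative c * exp (c * of_real t)) (at t)"
    for c :: complex
proof -
  have "((\<lambda>z. exp (c * z)) has_field_derivative c * exp (c * of_real t)) (at (of_real t))"
    by (auto intro!: derivative_eq_intros)
  then show ?thesis by (rule has_vector_derivative_real_field)
qed

lemma chi_D_0: "chi_D 0 \<zeta> = sin (2 * \<zeta>\<^sup>2)"
proof -
  have "is_sol \<zeta> 0 (\<lambda>t. exp (- 2 * \<i> * \<zeta>\<^sup>2 * of_real t)) (\<lambda>t. exp (2 * \<i> * \<zeta>\<^sup>2 * of_real t))"
    using has_vector_derivative_exp_of_real[of "- 2 * \<i> * \<zeta>\<^sup>2"]
      has_vector_derivative_exp_of_real[of "2 * \<i> * \<zeta>\<^sup>2"]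
    unfolding is_sol_def coef_a_def coef_b_def coef_c_def by (simp add: h1_fun_zero)
  from chi_D_eq[OF this] show ?thesis
    by (simp add: sin_exp_eq mult_ac)
qed

section \<open>Differentiability in the spectral parameter and the potential\<close>

lemma is_sol_continuous:
  assumes "is_sol \<zeta> \<psi> u v"
  shows "continuous_on UNIV u" "continuous_on UNIV v"
  using assms unfolding is_sol_def
  by (auto intro!: continuous_at_imp_continuous_on has_vector_derivative_continuous)

lemma is_adj_continuous:
  assumes "is_adj \<zeta> \<psi> r w"
  shows "continuous_on UNIV r" "continuous_on UNIV w"
  using assms unfolding is_adj_def
  by (auto intro!: continuous_at_imp_continuous_on has_vector_derivative_continuous)

text \<open>With every component of the potential at most \<open>2 * R\<close>, the first two
  summands bound \<open>coef_a\<close>, the last two \<open>coef_b\<close> and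
  \<open>coef_c\<close>; the sum serves for all three.\<close>

definition coef_bound :: "real \<Rightarrow> real \<Rightarrow> real" where
  "coef_bound Z R = 2 * Z\<^sup>2 + 4 * R\<^sup>2 + 4 * Z * R + 2 * R"

lemma coef_bounds:
  assumes "cmod \<zeta> \<le> Z" "norm \<psi> \<le> R" "t \<in> {0..1}"
  shows "cmod (coef_a \<zeta> \<psi> t) \<le> coef_bound Z R" "cmod (coef_b \<zeta> \<psi> t) \<le> coef_bound Z R"
    "cmod (coef_c \<zeta> \<psi> t) \<le> coef_bound Z R" "0 \<le> coef_bound Z R"
proof -
  have p: "cmod (h1_fun (\<psi> $ j) t) \<le> 2 * R" for j
    using pot_sup_bound[OF assms(3), of \<psi> j] assms(2) by linarith
  have Z: "0 \<le> Z" using assms(1) norm_ge_zero[of \<zeta>] by linarith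
  have R: "0 \<le> R" using assms(2) norm_ge_zero[of \<psi>] by linarith
  show "0 \<le> coef_bound Z R" using Z R by (simp add: coef_bound_def)
  have z2: "(cmod \<zeta>)\<^sup>2 \<le> Z\<^sup>2" using assms(1) by (intro power_mono) auto
  have pp: "cmod (h1_fun (\<psi> $ i) t) * cmod (h1_fun (\<psi> $ j) t) \<le> (2 * R) * (2 * R)" for i j
    using p R by (intro mult_mono) auto
  have zp: "cmod \<zeta> * cmod (h1_fun (\<psi> $ i) t) \<le> Z * (2 * R)" for i
    using p assms(1) Z by (intro mult_mono) auto
  have "cmod (coef_a \<zeta> \<psi> t) \<le> 2 * (cmod \<zeta>)\<^sup>2 + cmod (h1_fun (\<psi> $ 1) t) * cmod (h1_fun (\<psi> $ 2) t)"
    unfolding coef_a_def by (rule order.trans[OF norm_triangle_ineq4]) (simp add: norm_mult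
      norm_power)
  then show "cmod (coef_a \<zeta> \<psi> t) \<le> coef_bound Z R"
    using z2 pp[of 1 2] R mult_nonneg_nonneg[OF Z R] unfolding coef_bound_def power2_eq_square
      by linarith
  have "cmod (coef_b \<zeta> \<psi> t) \<le> 2 * (cmod \<zeta> * cmod (h1_fun (\<psi> $ 1) t)) + cmod (h1_fun (\<psi> $ 3) t)"
    unfolding coef_b_def by (rule order.trans[OF norm_triangle_ineq]) (simp add: norm_mult)
  then show "cmod (coef_b \<zeta> \<psi> t) \<le> coef_bound Z R"
    using zp[of 1] p[of 3] zero_le_power2[of Z] zero_le_power2[of R] unfolding coef_bound_def
      by linarith
  have "cmod (coef_c \<zeta> \<psi> t) \<le> 2 * (cmod \<zeta> * cmod (h1_fun (\<psi> $ 2) t)) + cmod (h1_fun (\<psi> $ 4) t)"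
    unfolding coef_c_def by (rule order.trans[OF norm_triangle_ineq4]) (simp add: norm_mult)
  then show "cmod (coef_c \<zeta> \<psi> t) \<le> coef_bound Z R"
    using zp[of 2] p[of 4] zero_le_power2[of Z] zero_le_power2[of R] unfolding coef_bound_def
      by linarith
qed

lemma norm_lincomb_le:
  fixes a b u v :: complex
  assumes "cmod a \<le> A" "cmod b \<le> A"
  shows "cmod (a * u + b * v) \<le> A * (cmod u + cmod v)" "cmod (a * u - b * v) \<le> A * (cmod u + cmod
    v)"
proof -
  have "cmod a * cmod u + cmod b * cmod v \<le> A * (cmod u + cmod v)"
    using mult_right_mono[OF assms(1), of "cmod u"] mult_right_mono[OF assms(2), of "cmod v"]
    by (simp add: distrib_left)
  then show "cmod (a * u + b * v) \<le> A * (cmod u + cmod v)" "cmod (a * u - b * v) \<le> A * (cmod u +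
    cmod v)"
    using norm_triangle_ineq[of "a * u" "b * v"] norm_triangle_ineq4[of "a * u" "b * v"]
    by (auto simp: norm_mult)
qed

text \<open>Gronwall's constant for initial values \<open>(1, 1)\<close> without forcing; the factor
  2 is the initial squared norm.\<close>

definition sol_bound :: "real \<Rightarrow> real \<Rightarrow> real" where
  "sol_bound Z R = sqrt (2 * exp (4 * coef_bound Z R + 1))"

lemma is_sol_bound:
  assumes sol: "is_sol \<zeta> \<psi> u v" "u 0 = 1" "v 0 = 1"
    and b: "cmod \<zeta> \<le> Z" "norm \<psi> \<le> R" "t \<in> {0..1}"
  shows "cmod (u t) \<le> sol_bound Z R" "cmod (v t) \<le> sol_bound Z R"
proof -
  note c = coef_bounds[OF b(1,2)]
  have "(cmod (u t))\<^sup>2 + (cmod (v t))\<^sup>2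
      \<le> ((cmod (u 0))\<^sup>2 + (cmod (v 0))\<^sup>2 + 2 * 0\<^sup>2) * exp (4 * coef_bound Z R + 1)"
  proof (rule gronwall_pair[OF _ _ _ _ _ _ b(3)])
    fix s :: real assume s: "s \<in> {0..1}"
    show "(u has_vector_derivative coef_a \<zeta> \<psi> s * u s + coef_b \<zeta> \<psi> s * v s) (at s)"
      "(v has_vector_derivative coef_c \<zeta> \<psi> s * u s - coef_a \<zeta> \<psi> s * v s) (at s)"
      using sol(1) unfolding is_sol_def by blast+
    show "cmod (coef_a \<zeta> \<psi> s * u s + coef_b \<zeta> \<psi> s * v s) \<le> coef_bound Z R * (cmod (u s) + cmod (v
      s)) + 0"
      "cmod (coef_c \<zeta> \<psi> s * u s - coef_a \<zeta> \<psi> s * v s) \<le> coef_bound Z R * (cmod (u s) + cmod (v s))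
        + 0"
      using norm_lincomb_le c[OF s] by simp_all
  qed (use c[OF b(3)] in simp_all)
  then have *: "(cmod (u t))\<^sup>2 + (cmod (v t))\<^sup>2 \<le> 2 * exp (4 * coef_bound Z R + 1)"
    using sol by simp
  show "cmod (u t) \<le> sol_bound Z R" "cmod (v t) \<le> sol_bound Z R"
    unfolding sol_bound_def
    by (rule real_le_rsqrt, use * zero_le_power2[of "cmod (u t)"] zero_le_power2[of "cmod (v t)"]
      in linarith)+
qed

text \<open>The derivatives of the coefficients in the direction \<open>(z, \<eta>)\<close>.\<close>

definition lin_a :: "complex \<Rightarrow> potential \<Rightarrow> complex \<Rightarrow> potential \<Rightarrow> real \<Rightarrow> complex" where
  "lin_a \<zeta> \<psi> z \<eta> t = - 4 * \<i> * \<zeta> * z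
     - \<i> * (h1_fun (\<eta> $ 1) t * h1_fun (\<psi> $ 2) t + h1_fun (\<psi> $ 1) t * h1_fun (\<eta> $ 2) t)"

definition lin_b :: "complex \<Rightarrow> potential \<Rightarrow> complex \<Rightarrow> potential \<Rightarrow> real \<Rightarrow> complex" where
  "lin_b \<zeta> \<psi> z \<eta> t = 2 * z * h1_fun (\<psi> $ 1) t + 2 * \<zeta> * h1_fun (\<eta> $ 1) t + \<i> * h1_fun (\<eta> $ 3) t"

definition lin_c :: "complex \<Rightarrow> potential \<Rightarrow> complex \<Rightarrow> potential \<Rightarrow> real \<Rightarrow> complex" where
  "lin_c \<zeta> \<psi> z \<eta> t = 2 * z * h1_fun (\<psi> $ 2) t + 2 * \<zeta> * h1_fun (\<eta> $ 2) t - \<i> * h1_fun (\<eta> $ 4) t"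

lemma continuous_lin [continuous_intros]:
  "continuous_on UNIV (lin_a \<zeta> \<psi> z \<eta>)" "continuous_on UNIV (lin_b \<zeta> \<psi> z \<eta>)"
  "continuous_on UNIV (lin_c \<zeta> \<psi> z \<eta>)"
  unfolding lin_a_def lin_b_def lin_c_def by (intro continuous_intros h1_fun_continuous)+

lemma norm_add3_le:
  fixes x y z :: "'a::real_normed_vector"
  shows "norm (x + y + z) \<le> norm x + norm y + norm z" "norm (x + y - z) \<le> norm x + norm y + norm z"
  using norm_triangle_ineq[of x y] norm_triangle_ineq[of "x + y" z] norm_triangle_ineq4[of "x + y"
    z] by linarith+

lemma lin_bounds:
  assumes "cmod \<zeta> \<le> Z" "norm \<psi> \<le> R" "t \<in> {0..1}" "cmod z \<le> \<delta>" "norm \<eta> \<le> \<delta>"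
  shows "cmod (lin_a \<zeta> \<psi> z \<eta> t) \<le> (4 * Z + 8 * R + 2) * \<delta>" "cmod (lin_b \<zeta> \<psi> z \<eta> t) \<le> (4 * Z + 8 *
    R + 2) * \<delta>"
    "cmod (lin_c \<zeta> \<psi> z \<eta> t) \<le> (4 * Z + 8 * R + 2) * \<delta>"
proof -
  have Z: "0 \<le> Z" using assms(1) norm_ge_zero[of \<zeta>] by linarith
  have R: "0 \<le> R" using assms(2) norm_ge_zero[of \<psi>] by linarith
  have \<delta>: "0 \<le> \<delta>" using assms(4) norm_ge_zero[of z] by linarith
  have p: "cmod (h1_fun (\<psi> $ j) t) \<le> 2 * R" for j
    using pot_sup_bound[OF assms(3), of \<psi> j] assms(2) by linarith
  have q: "cmod (h1_fun (\<eta> $ j) t) \<le> 2 * \<delta>" for j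
    using pot_sup_bound[OF assms(3), of \<eta> j] assms(5) by linarith
  have qp: "cmod (h1_fun (\<eta> $ i) t) * cmod (h1_fun (\<psi> $ j) t) \<le> (2 * \<delta>) * (2 * R)" for i j
    using p q \<delta> by (intro mult_mono) auto
  have pq: "cmod (h1_fun (\<psi> $ i) t) * cmod (h1_fun (\<eta> $ j) t) \<le> (2 * R) * (2 * \<delta>)" for i j
    using p q R by (intro mult_mono) auto
  have zz: "cmod \<zeta> * cmod z \<le> Z * \<delta>" using assms Z by (intro mult_mono) auto
  have zq: "cmod \<zeta> * cmod (h1_fun (\<eta> $ i) t) \<le> Z * (2 * \<delta>)" for i using assms Z q
    by (intro mult_mono) auto
  have zp: "cmod z * cmod (h1_fun (\<psi> $ i) t) \<le> \<delta> * (2 * R)" for i using assms \<delta> p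
    by (intro mult_mono) auto
  have pos: "0 \<le> R * \<delta>" using R \<delta> by simp
  have "cmod (lin_a \<zeta> \<psi> z \<eta> t) \<le> 4 * (cmod \<zeta> * cmod z)
      + (cmod (h1_fun (\<eta> $ 1) t) * cmod (h1_fun (\<psi> $ 2) t) + cmod (h1_fun (\<psi> $ 1) t) * cmod
        (h1_fun (\<eta> $ 2) t))"
    unfolding lin_a_def
    by (rule order.trans[OF norm_triangle_ineq4])
      (auto simp: norm_mult intro!: order.trans[OF norm_triangle_ineq])
  also have "\<dots> \<le> (4 * Z + 8 * R + 2) * \<delta>"
    using qp[of 1 2] pq[of 1 2] zz \<delta> by (simp add: algebra_simps)
  finally show "cmod (lin_a \<zeta> \<psi> z \<eta> t) \<le> (4 * Z + 8 * R + 2) * \<delta>" .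
  have "cmod (lin_b \<zeta> \<psi> z \<eta> t) \<le> 2 * (cmod z * cmod (h1_fun (\<psi> $ 1) t)) + 2 * (cmod \<zeta> * cmod
    (h1_fun (\<eta> $ 1) t)) + cmod (h1_fun (\<eta> $ 3) t)"
    unfolding lin_b_def
    using norm_add3_le(1)[of "2 * z * h1_fun (\<psi> $ 1) t" "2 * \<zeta> * h1_fun (\<eta> $ 1) t" "\<i> * h1_fun (\<eta>
      $ 3) t"]
    by (simp add: norm_mult)
  also have "\<dots> \<le> (4 * Z + 8 * R + 2) * \<delta>"
    using zp[of 1] zq[of 1] q[of 3] pos by (simp add: algebra_simps)
  finally show "cmod (lin_b \<zeta> \<psi> z \<eta> t) \<le> (4 * Z + 8 * R + 2) * \<delta>" .
  have "cmod (lin_c \<zeta> \<psi> z \<eta> t) \<le> 2 * (cmod z * cmod (h1_fun (\<psi> $ 2) t)) + 2 * (cmod \<zeta> * cmod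
    (h1_fun (\<eta> $ 2) t)) + cmod (h1_fun (\<eta> $ 4) t)"
    unfolding lin_c_def
    using norm_add3_le(2)[of "2 * z * h1_fun (\<psi> $ 2) t" "2 * \<zeta> * h1_fun (\<eta> $ 2) t" "\<i> * h1_fun (\<eta>
      $ 4) t"]
    by (simp add: norm_mult)
  also have "\<dots> \<le> (4 * Z + 8 * R + 2) * \<delta>"
    using zp[of 2] zq[of 2] q[of 4] pos by (simp add: algebra_simps)
  finally show "cmod (lin_c \<zeta> \<psi> z \<eta> t) \<le> (4 * Z + 8 * R + 2) * \<delta>" .
qed

text \<open>The coefficients are polynomials of degree two in the spectral parameter and the
  potential, so what remains after the linear part is purely quadratic. The constant is 2 + 4 for
  \<open>coef_a\<close>; 4 would do for the others.\<close>

lemma coef_expand: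
  assumes "t \<in> {0..1}" "cmod z \<le> \<delta>" "norm \<eta> \<le> \<delta>"
  shows "cmod (coef_a (\<zeta> + z) (\<psi> + \<eta>) t - coef_a \<zeta> \<psi> t - lin_a \<zeta> \<psi> z \<eta> t) \<le> 6 * \<delta>\<^sup>2"
    "cmod (coef_b (\<zeta> + z) (\<psi> + \<eta>) t - coef_b \<zeta> \<psi> t - lin_b \<zeta> \<psi> z \<eta> t) \<le> 6 * \<delta>\<^sup>2"
    "cmod (coef_c (\<zeta> + z) (\<psi> + \<eta>) t - coef_c \<zeta> \<psi> t - lin_c \<zeta> \<psi> z \<eta> t) \<le> 6 * \<delta>\<^sup>2"
proof -
  have \<delta>: "0 \<le> \<delta>" using assms(2) norm_ge_zero[of z] by linarith
  have q: "cmod (h1_fun (\<eta> $ j) t) \<le> 2 * \<delta>" for j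
    using pot_sup_bound[OF assms(1), of \<eta> j] assms(3) by linarith
  have zz: "(cmod z)\<^sup>2 \<le> \<delta>\<^sup>2" using assms by (intro power_mono) auto
  have qq: "cmod (h1_fun (\<eta> $ 1) t) * cmod (h1_fun (\<eta> $ 2) t) \<le> (2 * \<delta>) * (2 * \<delta>)"
    using q \<delta> by (intro mult_mono) auto
  have zq: "cmod z * cmod (h1_fun (\<eta> $ i) t) \<le> \<delta> * (2 * \<delta>)" for i using assms q \<delta>
    by (intro mult_mono) auto
  have "coef_a (\<zeta> + z) (\<psi> + \<eta>) t - coef_a \<zeta> \<psi> t - lin_a \<zeta> \<psi> z \<eta> t
      = - 2 * \<i> * z\<^sup>2 - \<i> * (h1_fun (\<eta> $ 1) t * h1_fun (\<eta> $ 2) t)"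
    by (simp add: coef_a_def lin_a_def h1_fun_add algebra_simps power2_eq_square)
  also have "cmod \<dots> \<le> 2 * (cmod z)\<^sup>2 + cmod (h1_fun (\<eta> $ 1) t) * cmod (h1_fun (\<eta> $ 2) t)"
    by (rule order.trans[OF norm_triangle_ineq4]) (simp add: norm_mult norm_power)
  also have "\<dots> \<le> 6 * \<delta>\<^sup>2" using zz qq by (simp add: power2_eq_square)
  finally show "cmod (coef_a (\<zeta> + z) (\<psi> + \<eta>) t - coef_a \<zeta> \<psi> t - lin_a \<zeta> \<psi> z \<eta> t) \<le> 6 * \<delta>\<^sup>2" .
  have "coef_b (\<zeta> + z) (\<psi> + \<eta>) t - coef_b \<zeta> \<psi> t - lin_b \<zeta> \<psi> z \<eta> t = 2 * (z * h1_fun (\<eta> $ 1) t)"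
    "coef_c (\<zeta> + z) (\<psi> + \<eta>) t - coef_c \<zeta> \<psi> t - lin_c \<zeta> \<psi> z \<eta> t = 2 * (z * h1_fun (\<eta> $ 2) t)"
    by (simp_all add: coef_b_def lin_b_def coef_c_def lin_c_def h1_fun_add algebra_simps)
  moreover have "cmod (2 * (z * h1_fun (\<eta> $ i) t)) \<le> 6 * \<delta>\<^sup>2" for i
  proof -
    have "cmod (2 * (z * h1_fun (\<eta> $ i) t)) = 2 * (cmod z * cmod (h1_fun (\<eta> $ i) t))"
      by (simp add: norm_mult)
    also have "\<dots> \<le> 2 * (\<delta> * (2 * \<delta>))" using zq[of i] by simp
    also have "\<dots> \<le> 6 * \<delta>\<^sup>2" by (simp add: power2_eq_square)
    finally show ?thesis .
  qed
  ultimately show "cmod (coef_b (\<zeta> + z) (\<psi> + \<eta>) t - coef_b \<zeta> \<psi> t - lin_b \<zeta> \<psi> z \<eta> t) \<le> 6 * \<delta>\<^sup>2"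
    "cmod (coef_c (\<zeta> + z) (\<psi> + \<eta>) t - coef_c \<zeta> \<psi> t - lin_c \<zeta> \<psi> z \<eta> t) \<le> 6 * \<delta>\<^sup>2"
    by simp_all
qed

lemma has_derivative_quadratic:
  fixes F :: "'a::real_normed_vector \<Rightarrow> 'b::real_normed_vector"
  assumes L: "bounded_linear L"
    and bound: "\<And>h. norm h \<le> 1 \<Longrightarrow> norm (F (x + h) - F x - L h) \<le> C * (norm h)\<^sup>2"
  shows "(F has_derivative L) (at x)"
  unfolding has_derivative_at
proof (intro conjI L)
  have C: "(\<lambda>h::'a. C * norm h) \<midarrow>0\<rightarrow> 0"
    by (intro tendsto_mult_right_zero tendsto_norm_zero tendsto_ident_at)
  show "(\<lambda>h. norm (F (x + h) - F x - L h) / norm h) \<midarrow>0\<rightarrow> 0"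
  proof (rule Lim_null_comparison[OF _ C])
    have "\<forall>\<^sub>F h in at 0. h \<in> ball (0::'a) 1 - {0}"
      by (rule eventually_at_in_open) auto
    then show "\<forall>\<^sub>F h in at 0. norm (norm (F (x + h) - F x - L h) / norm h) \<le> C * norm h"
    proof eventually_elim
      case (elim h)
      then have "norm (F (x + h) - F x - L h) \<le> C * (norm h)\<^sup>2" by (intro bound) auto
      then show ?case using elim by (simp add: divide_le_eq power2_eq_square)
    qed
  qed
qed

text \<open>The derivative is the integral over the period of the adjoint solution paired with the
  linearised coefficients applied to the unperturbed solution. It is linear in
  \<open>(z, \<eta>)\<close> over the complex numbers because \<open>lin_a\<close>,
  \<open>lin_b\<close> and \<open>lin_c\<close> are.\<close>

lemma chi_D_frechet:
  "\<exists>L. ((\<lambda>x. chi_D (snd x) (fst x)) has_derivative L) (at (\<zeta>, \<psi>)) \<and>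
     (\<forall>c z \<eta>. L (c * z, pot_mult c \<eta>) = c * L (z, \<eta>))"
proof -
  obtain u v where uv: "is_sol \<zeta> \<psi> u v" "u 0 = 1" "v 0 = 1" by (rule is_sol_exists)
  \<comment> \<open>These end values make the pairing at time 1 equal to the linear functional that
    defines \<open>chi_D\<close>.\<close>
  obtain r w where rw: "is_adj \<zeta> \<psi> r w" "r 1 = - (1 / (2 * \<i>))" "w 1 = 1 / (2 * \<i>)"
    by (rule is_adj_exists)
  note cont = is_sol_continuous[OF uv(1)] is_adj_continuous[OF rw(1)]
  \<comment> \<open>The margin 1 lets the same bounds hold for all perturbations of norm at most
    1.\<close>
  define Z R where "Z = cmod \<zeta> + 1" and "R = norm \<psi> + 1"
  have ZR: "cmod \<zeta> \<le> Z" "norm \<psi> \<le> R" and Z0: "Z \<ge> 0" and R0: "R \<ge> 0" by (auto simp: Z_def R_def)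
  have "bounded ((\<lambda>t. (r t, w t)) ` {0..1})"
    by (intro compact_imp_bounded compact_continuous_image continuous_intros
      continuous_on_subset[OF cont(3)] continuous_on_subset[OF cont(4)]) auto
  then obtain Q where "\<forall>x\<in>(\<lambda>t. (r t, w t)) ` {0..1}. norm x \<le> Q" unfolding bounded_iff by blast
  then have Q: "norm (r t, w t) \<le> Q" if "t \<in> {0..1}" for t using that by blast
  have rQ: "cmod (r t) \<le> Q" and wQ: "cmod (w t) \<le> Q" if "t \<in> {0..1}" for t
    using norm_fst_le[of "r t" "w t"] norm_snd_le[of "w t" "r t"] Q[OF that] by linarith+
  have Q0: "Q \<ge> 0" by (rule order.trans[OF norm_ge_zero rQ[of 0]]) simp
  define M where "M = sol_bound Z R"
  have M: "cmod (u t) \<le> M" "cmod (v t) \<le> M" if "t \<in> {0..1}" for t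
    unfolding M_def using is_sol_bound[OF uv ZR that] by auto
  have M0: "M \<ge> 0" by (rule order.trans[OF norm_ge_zero M(1)[of 0]]) simp
  define K where "K = 4 * Z + 8 * R + 2"
  have K0: "K \<ge> 0" using Z0 R0 by (simp add: K_def)
  define g where "g z \<eta> t = r t * (lin_a \<zeta> \<psi> z \<eta> t * u t + lin_b \<zeta> \<psi> z \<eta> t * v t)
    + w t * (lin_c \<zeta> \<psi> z \<eta> t * u t - lin_a \<zeta> \<psi> z \<eta> t * v t)" for z \<eta> t
  have gint: "g z \<eta> integrable_on {0..1}" for z \<eta>
    unfolding g_def
    by (intro integrable_continuous_real continuous_intros continuous_on_subset[OF cont(1)]
      continuous_on_subset[OF cont(2)]
      continuous_on_subset[OF cont(3)] continuous_on_subset[OF cont(4)] continuous_on_subset[OF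
        continuous_lin(1)]
      continuous_on_subset[OF continuous_lin(2)] continuous_on_subset[OF continuous_lin(3)]) auto
  define L where "L x = integral {0..1} (g (fst x) (snd x))" for x
  have nonneg: "norm x \<ge> 0" for x :: "complex \<times> potential" by simp
  have comps: "cmod (fst x) \<le> norm x" "norm (snd x) \<le> norm x" for x :: "complex \<times> potential"
    by (cases x; simp add: norm_fst_le norm_snd_le)+
  have gcomb: "cmod (r t * (a * x1 + b * x2) + w t * (c * x1 - d * x2)) \<le> 4 * Q * A * X"
    if "t \<in> {0..1}" "cmod a \<le> A" "cmod b \<le> A" "cmod c \<le> A" "cmod d \<le> A" "cmod x1 \<le> X" "cmod x2 \<le> X"
    for t a b c d x1 x2 A X
  proof -
    have A: "A \<ge> 0" using that(2) norm_ge_zero[of a] by linarith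
    have X: "cmod x1 + cmod x2 \<le> 2 * X" using that by simp
    have "cmod (a * x1 + b * x2) \<le> A * (2 * X)" "cmod (c * x1 - d * x2) \<le> A * (2 * X)"
      using norm_lincomb_le[of a A b x1 x2] norm_lincomb_le[of c A d x1 x2] that mult_left_mono[OF
        X A] by auto
    then have "cmod (r t * (a * x1 + b * x2) + w t * (c * x1 - d * x2)) \<le> Q * (A * (2 * X)) + Q *
      (A * (2 * X))"
      unfolding norm_mult using rQ[OF that(1)] wQ[OF that(1)] Q0
      by (intro order.trans[OF norm_triangle_ineq] add_mono) (auto simp: norm_mult intro!:
        mult_mono)
    then show ?thesis by (simp add: algebra_simps)
  qed
  have BL: "bounded_linear L"
  proof (rule bounded_linear_intro)
    fix x y :: "complex \<times> potential"
    have "g (fst (x + y)) (snd (x + y)) = (\<lambda>t. g (fst x) (snd x) t + g (fst y) (snd y) t)"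
      by (simp add: g_def lin_a_def lin_b_def lin_c_def h1_fun_add algebra_simps fun_eq_iff)
    then show "L (x + y) = L x + L y"
      unfolding L_def using integral_add[OF gint gint] by simp
  next
    fix s :: real and x :: "complex \<times> potential"
    have "g (fst (s *\<^sub>R x)) (snd (s *\<^sub>R x)) = (\<lambda>t. s *\<^sub>R g (fst x) (snd x) t)"
      by (simp add: g_def lin_a_def lin_b_def lin_c_def h1_fun_scaleR scaleR_conv_of_real
        algebra_simps fun_eq_iff)
    then show "L (s *\<^sub>R x) = s *\<^sub>R L x"
      unfolding L_def by simp
  next
    fix x :: "complex \<times> potential"
    have "norm (L x) \<le> (4 * Q * (K * norm x) * M) * measure lborel {0..1::real}"
      unfolding L_def
    proof (rule has_integral_bound_real[OF _ finite.emptyI integrable_integral[OF gint]])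
      show "0 \<le> 4 * Q * (K * norm x) * M" using Q0 K0 M0 by simp
      fix t :: real assume "t \<in> {0..1} - {}"
      then have t: "t \<in> {0..1}" by simp
      show "norm (g (fst x) (snd x) t) \<le> 4 * Q * (K * norm x) * M"
        unfolding g_def K_def
        by (intro gcomb[OF t] lin_bounds[OF ZR t comps] M[OF t])
    qed
    then show "norm (L x) \<le> norm x * (4 * Q * K * M)" by (simp add: mult_ac)
  qed
  define B where "B = coef_bound Z R"
  have B0: "B \<ge> 0" using coef_bounds(4)[OF ZR, of 0] by (simp add: B_def)
  \<comment> \<open>Lipschitz constant of the solution: the difference of two solutions starts at
    zero and is forced by a term of size at most \<open>(K + 6) * \<delta> * (2 * M)\<close>, so
    Gronwall's bound becomes \<open>E * \<delta>\<close>.\<close>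
  define E where "E = sqrt (2 * exp (4 * B + 1)) * ((K + 6) * (2 * M))"
  have E0: "E \<ge> 0" using K0 M0 by (simp add: E_def)
  have bound: "cmod (chi_D (\<psi> + \<eta>) (\<zeta> + z) - chi_D \<psi> \<zeta> - L (z, \<eta>)) \<le> (4 * Q * 6 * M + 4 * Q * K *
    E) * \<delta>\<^sup>2"
    if \<delta>: "\<delta> = norm (z, \<eta>)" "\<delta> \<le> 1" for z \<eta> \<delta>
  proof -
    have z\<delta>: "cmod z \<le> \<delta>" "norm \<eta> \<le> \<delta>" using comps[of "(z, \<eta>)"] by (simp_all add: \<delta>)
    have \<delta>0: "\<delta> \<ge> 0" by (simp add: \<delta>)
    have ZR': "cmod (\<zeta> + z) \<le> Z" "norm (\<psi> + \<eta>) \<le> R"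
      using norm_triangle_ineq[of \<zeta> z] norm_triangle_ineq[of \<psi> \<eta>] z\<delta> \<delta>(2)
        by (auto simp: Z_def R_def)
    obtain u' v' where uv': "is_sol (\<zeta> + z) (\<psi> + \<eta>) u' v'" "u' 0 = 1" "v' 0 = 1"
      by (rule is_sol_exists)
    have M': "cmod (u' t) \<le> M" "cmod (v' t) \<le> M" if "t \<in> {0..1}" for t
      unfolding M_def using is_sol_bound[OF uv' ZR' that] by auto
    define \<Delta>a \<Delta>b \<Delta>c where "\<Delta>a t = coef_a (\<zeta> + z) (\<psi> + \<eta>) t - coef_a \<zeta> \<psi> t"
      and "\<Delta>b t = coef_b (\<zeta> + z) (\<psi> + \<eta>) t - coef_b \<zeta> \<psi> t"
      and "\<Delta>c t = coef_c (\<zeta> + z) (\<psi> + \<eta>) t - coef_c \<zeta> \<psi> t" for t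
    have \<Delta>: "cmod (\<Delta>a t) \<le> (K + 6) * \<delta>" "cmod (\<Delta>b t) \<le> (K + 6) * \<delta>" "cmod (\<Delta>c t) \<le> (K + 6) * \<delta>"
      if t: "t \<in> {0..1}" for t
    proof -
      have d2: "6 * \<delta>\<^sup>2 \<le> 6 * \<delta>" using \<delta>0 \<delta>(2) by (simp add: power2_eq_square mult_left_le)
      have *: "cmod x \<le> (K + 6) * \<delta>" if "cmod (x - l) \<le> 6 * \<delta>\<^sup>2" "cmod l \<le> (4 * Z + 8 * R + 2) *
        \<delta>" for x l
        using norm_triangle_ineq[of "x - l" l] that d2 unfolding K_def by (simp add: algebra_simps)
      show "cmod (\<Delta>a t) \<le> (K + 6) * \<delta>" "cmod (\<Delta>b t) \<le> (K + 6) * \<delta>" "cmod (\<Delta>c t) \<le> (K + 6) * \<delta>"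
        unfolding \<Delta>a_def \<Delta>b_def \<Delta>c_def
        by (rule *[OF coef_expand(1)[OF t z\<delta>] lin_bounds(1)[OF ZR t z\<delta>]]
            *[OF coef_expand(2)[OF t z\<delta>] lin_bounds(2)[OF ZR t z\<delta>]]
            *[OF coef_expand(3)[OF t z\<delta>] lin_bounds(3)[OF ZR t z\<delta>]])+
    qed
    define d1 d2 where "d1 t = u' t - u t" and "d2 t = v' t - v t" for t
    have d1: "(d1 has_vector_derivative (coef_a \<zeta> \<psi> t * d1 t + coef_b \<zeta> \<psi> t * d2 t) + (\<Delta>a t * u' t
      + \<Delta>b t * v' t)) (at t)"
      and d2: "(d2 has_vector_derivative (coef_c \<zeta> \<psi> t * d1 t - coef_a \<zeta> \<psi> t * d2 t) + (\<Delta>c t * u'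
        t - \<Delta>a t * v' t)) (at t)" for t
      using uv(1) uv'(1) unfolding is_sol_def d1_def[abs_def] d2_def[abs_def] \<Delta>a_def \<Delta>b_def \<Delta>c_def
      by (auto intro!: derivative_eq_intros simp: algebra_simps)
    define \<epsilon> where "\<epsilon> = (K + 6) * \<delta> * (2 * M)"
    have \<epsilon>0: "\<epsilon> \<ge> 0" using K0 \<delta>0 M0 by (simp add: \<epsilon>_def)
    have dE: "cmod (d1 t) \<le> E * \<delta>" "cmod (d2 t) \<le> E * \<delta>" if t: "t \<in> {0..1}" for t
    proof -
      have "(cmod (d1 t))\<^sup>2 + (cmod (d2 t))\<^sup>2 \<le> ((cmod (d1 0))\<^sup>2 + (cmod (d2 0))\<^sup>2 + 2 * \<epsilon>\<^sup>2) *
        exp (4 * B + 1)"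
      proof (rule gronwall_pair[OF d1 d2 _ _ B0 \<epsilon>0 t])
        fix s :: real assume s: "s \<in> {0..1}"
        have MM: "(K + 6) * \<delta> * (cmod (u' s) + cmod (v' s)) \<le> \<epsilon>"
          unfolding \<epsilon>_def using M'[OF s] K0 \<delta>0 by (intro mult_left_mono) auto
        note cc = coef_bounds[OF ZR s, folded B_def]
        show "cmod ((coef_a \<zeta> \<psi> s * d1 s + coef_b \<zeta> \<psi> s * d2 s) + (\<Delta>a s * u' s + \<Delta>b s * v' s)) \<le> B
          * (cmod (d1 s) + cmod (d2 s)) + \<epsilon>"
          using norm_lincomb_le(1)[OF cc(1,2), of "d1 s" "d2 s"] norm_lincomb_le(1)[OF \<Delta>(1,2)[OF
            s], of "u' s" "v' s"] MM
          by (intro norm_triangle_mono) linarith+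
        show "cmod ((coef_c \<zeta> \<psi> s * d1 s - coef_a \<zeta> \<psi> s * d2 s) + (\<Delta>c s * u' s - \<Delta>a s * v' s)) \<le> B
          * (cmod (d1 s) + cmod (d2 s)) + \<epsilon>"
          using norm_lincomb_le(2)[OF cc(3,1), of "d1 s" "d2 s"] norm_lincomb_le(2)[OF \<Delta>(3,1)[OF
            s], of "u' s" "v' s"] MM
          by (intro norm_triangle_mono) linarith+
      qed
      then have *: "(cmod (d1 t))\<^sup>2 + (cmod (d2 t))\<^sup>2 \<le> (E * \<delta>)\<^sup>2"
        by (simp add: d1_def d2_def uv uv' E_def \<epsilon>_def power_mult_distrib mult_ac)
      have ED: "0 \<le> E * \<delta>" using E0 \<delta>0 by simp
      show "cmod (d1 t) \<le> E * \<delta>" "cmod (d2 t) \<le> E * \<delta>"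
        using * zero_le_power2[of "cmod (d1 t)"] zero_le_power2[of "cmod (d2 t)"]
        by (intro power2_le_imp_le[OF _ ED]; linarith)+
    qed
    \<comment> \<open>The difference of the solutions paired with the adjoint solution vanishes at 0
      and equals the increment of \<open>chi_D\<close> at 1.\<close>
    define G where "G t = r t * d1 t + w t * d2 t" for t
    define G' where "G' t = r t * (\<Delta>a t * u' t + \<Delta>b t * v' t) + w t * (\<Delta>c t * u' t - \<Delta>a t * v' t)"
      for t
    have Gd: "(G has_vector_derivative G' t) (at t)" for t
      using is_adj_pairing[OF rw(1) d1 d2, of t] by (simp add: G_def[abs_def] G'_def)
    have "(G' has_integral (G 1 - G 0)) {0..1}"
      by (rule fundamental_theorem_of_calculus) (use Gd in \<open>auto intro:
        has_vector_derivative_at_within\<close>)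
    moreover have "G 1 - G 0 = chi_D (\<psi> + \<eta>) (\<zeta> + z) - chi_D \<psi> \<zeta>"
      unfolding chi_D_eq[OF uv] chi_D_eq[OF uv']
      by (simp add: G_def rw d1_def d2_def uv uv' field_simps)
    ultimately have "((\<lambda>t. G' t - g z \<eta> t) has_integral (chi_D (\<psi> + \<eta>) (\<zeta> + z) - chi_D \<psi> \<zeta> - L (z,
      \<eta>))) {0..1}"
      unfolding L_def by (intro has_integral_diff) (auto intro: integrable_integral gint)
    then have "cmod (chi_D (\<psi> + \<eta>) (\<zeta> + z) - chi_D \<psi> \<zeta> - L (z, \<eta>)) \<le> ((4 * Q * 6 * M + 4 * Q * K *
      E) * \<delta>\<^sup>2) * measure lborel {0..1::real}"
    proof (rule has_integral_bound_real[OF _ finite.emptyI, rotated])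
      show "0 \<le> (4 * Q * 6 * M + 4 * Q * K * E) * \<delta>\<^sup>2" using Q0 M0 K0 E0 by simp
      fix t :: real assume "t \<in> {0..1} - {}"
      then have t: "t \<in> {0..1}" by simp
      \<comment> \<open>The first group is the quadratic remainder of the coefficients times the
        perturbed solution, the second the linear part times the difference of the solutions; both
        are of second order in \<open>\<delta>\<close>.\<close>
      have "G' t - g z \<eta> t =
         (r t * ((\<Delta>a t - lin_a \<zeta> \<psi> z \<eta> t) * u' t + (\<Delta>b t - lin_b \<zeta> \<psi> z \<eta> t) * v' t) +
          w t * ((\<Delta>c t - lin_c \<zeta> \<psi> z \<eta> t) * u' t - (\<Delta>a t - lin_a \<zeta> \<psi> z \<eta> t) * v' t)) +
         (r t * (lin_a \<zeta> \<psi> z \<eta> t * d1 t + lin_b \<zeta> \<psi> z \<eta> t * d2 t) +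
          w t * (lin_c \<zeta> \<psi> z \<eta> t * d1 t - lin_a \<zeta> \<psi> z \<eta> t * d2 t))"
        by (simp add: G'_def g_def d1_def d2_def algebra_simps)
      also have "cmod \<dots> \<le> 4 * Q * (6 * \<delta>\<^sup>2) * M + 4 * Q * (K * \<delta>) * (E * \<delta>)"
        unfolding \<Delta>a_def \<Delta>b_def \<Delta>c_def K_def
        by (rule norm_triangle_mono; intro gcomb[OF t] coef_expand[OF t z\<delta>] lin_bounds[OF ZR t z\<delta>]
          M'[OF t] dE[OF t])
      also have "\<dots> = (4 * Q * 6 * M + 4 * Q * K * E) * \<delta>\<^sup>2"
        by (simp add: algebra_simps power2_eq_square)
      finally show "norm (G' t - g z \<eta> t) \<le> (4 * Q * 6 * M + 4 * Q * K * E) * \<delta>\<^sup>2" .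
    qed
    then show ?thesis by simp
  qed
  have der: "((\<lambda>x. chi_D (snd x) (fst x)) has_derivative L) (at (\<zeta>, \<psi>))"
    by (rule has_derivative_quadratic[OF BL, where C="4 * Q * 6 * M + 4 * Q * K * E"])
      (use bound in auto)
  have hom: "L (c * z, pot_mult c \<eta>) = c * L (z, \<eta>)" for c z \<eta>
  proof -
    have "g (c * z) (pot_mult c \<eta>) = (\<lambda>t. c * g z \<eta> t)"
      by (simp add: g_def lin_a_def lin_b_def lin_c_def pot_mult_def h1_fun_mult algebra_simps
        fun_eq_iff)
    then show ?thesis by (simp add: L_def)
  qed
  from der hom show ?thesis by blast
qed

section \<open>Asymptotics of the characteristic function\<close>

lemma set_integrable_mult_continuous:
  fixes g F :: "real \<Rightarrow> complex"
  assumes int: "set_integrable lborel {0..1} g" and F: "continuous_on {0..1} F"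
  shows "set_integrable lborel {0..1} (\<lambda>s. g s * F s)"
proof -
  have "bounded (F ` {0..1})"
    by (intro compact_imp_bounded compact_continuous_image F compact_Icc)
  then obtain B where B: "\<And>s. s \<in> {0..1} \<Longrightarrow> cmod (F s) \<le> B" unfolding bounded_iff by blast
  have [measurable]: "(\<lambda>s. indicat_real {0..1} s *\<^sub>R F s) \<in> borel_measurable lborel"
    using borel_measurable_continuous_on_indicator[OF _ F] by simp
  have i: "integrable lborel (\<lambda>s. indicat_real {0..1} s *\<^sub>R g s)"
    using int by (simp add: set_integrable_def)
  have "integrable lborel (\<lambda>s. (indicat_real {0..1} s *\<^sub>R g s) * (indicat_real {0..1} s *\<^sub>R F s))"
  proof (rule Bochner_Integration.integrable_bound)
    show "integrable lborel (\<lambda>s. B * norm (indicat_real {0..1} s *\<^sub>R g s))"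
      using i by (intro integrable_mult_right integrable_norm)
    show "(\<lambda>s. (indicat_real {0..1} s *\<^sub>R g s) * (indicat_real {0..1} s *\<^sub>R F s)) \<in>
      borel_measurable lborel"
      using i by measurable
    show "AE s in lborel. norm ((indicat_real {0..1} s *\<^sub>R g s) * (indicat_real {0..1} s *\<^sub>R F s))
        \<le> norm (B * norm (indicat_real {0..1} s *\<^sub>R g s))"
      by (intro AE_I2) (auto simp: indicator_def norm_mult mult.commute[of "cmod (g _)"]
        intro!: order.trans[OF mult_right_mono[OF B] abs_ge_self])
  qed
  also have "(\<lambda>s. (indicat_real {0..1} s *\<^sub>R g s) * (indicat_real {0..1} s *\<^sub>R F s))
      = (\<lambda>s. indicat_real {0..1} s *\<^sub>R (g s * F s))"
    by (auto simp: indicator_def fun_eq_iff)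
  finally show ?thesis by (simp add: set_integrable_def)
qed

text \<open>Integration by parts for an absolutely continuous \<open>b\<close>, whose derivative \<open>g\<close> exists only
  almost everywhere.\<close>

lemma has_vector_derivative_ac_mult:
  fixes b g F F' :: "real \<Rightarrow> complex"
  assumes g: "set_integrable lborel {0..1} g"
    and b: "\<And>t. t \<in> {0..1} \<Longrightarrow> b t = b 0 + (LBINT s:{0..t}. g s)"
    and F: "\<And>t. t \<in> {0..1} \<Longrightarrow> (F has_vector_derivative F' t) (at t)"
    and F'cont: "continuous_on {0..1} F'"
    and t: "t \<in> {0..1}"
  shows "((\<lambda>t. b t * F t - (LBINT s:{0..t}. g s * F s)) has_vector_derivative b t * F' t) (at t
    within {0..1})"
proof -
  have Fcont: "continuous_on {0..1} F"
    by (intro continuous_at_imp_continuous_on ballI has_vector_derivative_continuous[OF F])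
  have gF: "set_integrable lborel {0..1} (\<lambda>s. g s * F s)"
    by (rule set_integrable_mult_continuous[OF g Fcont])
  have gn: "set_integrable lborel {0..1} (\<lambda>s. cmod (g s))"
    using set_integrable_norm[OF g] .
  have "bounded (F' ` {0..1})"
    by (intro compact_imp_bounded compact_continuous_image F'cont compact_Icc)
  then obtain L where L: "\<And>s. s \<in> {0..1} \<Longrightarrow> cmod (F' s) \<le> L" unfolding bounded_iff by blast
  have Lip: "cmod (F y - F r) \<le> L * \<bar>y - r\<bar>" if "y \<in> {0..1}" "r \<in> {0..1}" for y r
  proof -
    have "cmod (F y - F r) \<le> L * norm (y - r)"
    proof (rule differentiable_bound[of "{0..1}" F "\<lambda>x h. h *\<^sub>R F' x"])
      show "(F has_derivative (\<lambda>h. h *\<^sub>R F' x)) (at x within {0..1})" if "x \<in> {0..1}" for x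
        using F[OF that] unfolding has_vector_derivative_def by (rule has_derivative_at_withinI)
      show "onorm (\<lambda>h. h *\<^sub>R F' x) \<le> L" if "x \<in> {0..1}" for x
        using L[OF that] order.trans[OF norm_ge_zero L[OF that]]
        by (intro onorm_bound) (simp_all add: mult.commute[of "\<bar>_\<bar>" "cmod (F' x)"] mult_right_mono)
    qed (use that in auto)
    then show ?thesis by simp
  qed
  have L0: "L \<ge> 0" by (rule order.trans[OF norm_ge_zero L[of 0]]) simp
  define N where "N y = (LBINT s:{0..y}. cmod (g s))" for y
  have Ncont: "continuous_on {0..1} N"
  proof -
    have "continuous_on {0..1} (\<lambda>y. integral {0..y} (\<lambda>s. cmod (g s)))"
      by (intro indefinite_integral_continuous_1 set_borel_integral_eq_integral(1)[OF gn])
    moreover have "integral {0..y} (\<lambda>s. cmod (g s)) = N y" if "y \<in> {0..1}" for y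
    proof -
      have "set_integrable lborel {0..y} (\<lambda>s. cmod (g s))"
        by (rule set_integrable_subset[OF gn]) (use that in auto)
      then show ?thesis unfolding N_def by (rule set_borel_integral_eq_integral(2)[symmetric])
    qed
    ultimately show ?thesis
      using continuous_on_cong[of "{0..1}" "{0..1}" "\<lambda>y. integral {0..y} (\<lambda>s. cmod (g s))" N]
        by simp
  qed
  define H where "H t = b t * F t - (LBINT s:{0..t}. g s * F s)" for t
  \<comment> \<open>The left side is the integral of \<open>g s * (F z - F s)\<close>. The Lipschitz
    bound on \<open>F\<close> gives the length of the interval, and the integral of the modulus of
    \<open>g\<close> supplies a second factor that tends to zero with that length.\<close>
  have key: "cmod ((b y - b x) * F z - (LBINT s:{x<..y}. g s * F s)) \<le> L * (y - x) * (N y - N x)"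
    if xy: "0 \<le> x" "x \<le> y" "y \<le> 1" "z \<in> {x..y}" for x y z
  proof -
    have sub: "set_integrable lborel {x<..y} h" if "set_integrable lborel {0..1} h"
      for h :: "real \<Rightarrow> 'b::{banach,second_countable_topology}"
      by (rule set_integrable_subset[OF that]) (use xy in auto)
    have "b y - b x = (LBINT s:{x<..y}. g s)"
      using b[of y] b[of x] set_integral_Icc_split[OF g xy(1-3)] xy by simp
    then have "(b y - b x) * F z - (LBINT s:{x<..y}. g s * F s)
        = (LBINT s:{x<..y}. g s * F z) - (LBINT s:{x<..y}. g s * F s)"
      by simp
    also have "\<dots> = (LBINT s:{x<..y}. g s * F z - g s * F s)"
      by (intro set_integral_diff(2)[symmetric] sub gF set_integrable_mult_left g)
    also have "cmod \<dots> \<le> (LBINT s:{x<..y}. cmod (g s * F z - g s * F s))"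
      by (intro set_integral_norm_bound set_integral_diff(1) sub gF set_integrable_mult_left g)
    also have "\<dots> \<le> (LBINT s:{x<..y}. L * (y - x) * cmod (g s))"
    proof (rule set_integral_mono)
      show "set_integrable lborel {x<..y} (\<lambda>s. cmod (g s * F z - g s * F s))"
        by (intro set_integrable_norm set_integral_diff(1) sub gF set_integrable_mult_left g)
      show "set_integrable lborel {x<..y} (\<lambda>s. L * (y - x) * cmod (g s))"
        by (intro set_integrable_mult_right sub gn)
      fix s assume s: "s \<in> {x<..y}"
      have "cmod (g s * F z - g s * F s) = cmod (g s) * cmod (F z - F s)"
        by (simp add: norm_mult[symmetric] right_diff_distrib)
      also have "\<dots> \<le> cmod (g s) * (L * (y - x))"
        using s xy L0 by (intro mult_left_mono order.trans[OF Lip]) auto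
      finally show "cmod (g s * F z - g s * F s) \<le> L * (y - x) * cmod (g s)"
        by (simp add: mult_ac)
    qed
    also have "\<dots> = L * (y - x) * (N y - N x)"
      using set_integral_Icc_split[OF gn xy(1-3)] by (simp add: N_def)
    finally show ?thesis .
  qed
  have key2: "cmod ((H y - b t * F y) - (H t - b t * F t)) \<le> L * \<bar>N y - N t\<bar> * \<bar>y - t\<bar>" if y: "y \<in>
    {0..1}" for y
  proof (cases "t \<le> y")
    case True
    then have "(H y - b t * F y) - (H t - b t * F t) = (b y - b t) * F y - (LBINT s:{t<..y}. g s *
      F s)"
      unfolding H_def using set_integral_Icc_split[OF gF, of t y] t y by (simp add: algebra_simps)
    then have "cmod ((H y - b t * F y) - (H t - b t * F t)) \<le> L * (y - t) * (N y - N t)"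
      using key[of t y y] True t y by simp
    also have "\<dots> \<le> L * (y - t) * \<bar>N y - N t\<bar>"
      using True L0 by (intro mult_left_mono) auto
    finally show ?thesis using True by (simp add: mult_ac)
  next
    case False
    then have "(H y - b t * F y) - (H t - b t * F t) = - ((b t - b y) * F y - (LBINT s:{y<..t}. g
      s * F s))"
      unfolding H_def using set_integral_Icc_split[OF gF, of y t] t y by (simp add: algebra_simps)
    then have "cmod ((H y - b t * F y) - (H t - b t * F t)) \<le> L * (t - y) * (N t - N y)"
      using key[of y t y] False t y by (simp only: norm_minus_cancel) auto
    also have "\<dots> \<le> L * (t - y) * \<bar>N y - N t\<bar>"
      using False L0 by (intro mult_left_mono) auto
    finally show ?thesis using False by (simp add: mult_ac)
  qed
  \<comment> \<open>Freezing \<open>b\<close> at its value at \<open>t\<close> leaves a function of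
    zero derivative there by \<open>key2\<close>, as \<open>N\<close> is continuous; the derivative
    of \<open>H\<close> at \<open>t\<close> is then that of \<open>b t * F y\<close> in
    \<open>y\<close>.\<close>
  have "((\<lambda>y. H y - b t * F y) has_vector_derivative 0) (at t within {0..1})"
    unfolding has_vector_derivative_def has_derivative_within
  proof (intro conjI)
    have "((\<lambda>y. L * \<bar>N y - N t\<bar>) \<longlongrightarrow> L * \<bar>N t - N t\<bar>) (at t within {0..1})"
      using Ncont t unfolding continuous_on_def by (intro tendsto_intros) auto
    then have lim: "((\<lambda>y. L * \<bar>N y - N t\<bar>) \<longlongrightarrow> 0) (at t within {0..1})" by simp
    show "((\<lambda>y. (1 / norm (y - t)) *\<^sub>R ((H y - b t * F y) - ((H t - b t * F t) + (y - t) *\<^sub>R 0)))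
      \<longlongrightarrow> 0) (at t within {0..1})"
    proof (rule Lim_null_comparison[OF _ lim])
      show "\<forall>\<^sub>F y in at t within {0..1}. norm ((1 / norm (y - t)) *\<^sub>R ((H y - b t * F y) - ((H t -
        b t * F t) + (y - t) *\<^sub>R 0)))
          \<le> L * \<bar>N y - N t\<bar>"
        unfolding eventually_at_filter using key2
      proof (intro always_eventually allI impI)
        fix y assume y: "y \<noteq> t" "y \<in> {0..1}"
        have "cmod ((H y - b t * F y) - (H t - b t * F t)) / \<bar>y - t\<bar> \<le> L * \<bar>N y - N t\<bar>"
          using key2[OF y(2)] y(1) by (simp add: divide_le_eq)
        then show "norm ((1 / norm (y - t)) *\<^sub>R ((H y - b t * F y) - ((H t - b t * F t) + (y - t)
          *\<^sub>R 0))) \<le> L * \<bar>N y - N t\<bar>"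
          by simp
      qed
    qed
  qed simp
  from has_vector_derivative_add[OF this has_vector_derivative_mult_right[OF
    has_vector_derivative_at_within[OF F[OF t], of "{0..1}"], of "b t"]]
  show ?thesis by (simp add: H_def)
qed

lemma vector_derivative_bound:
  fixes f f' :: "real \<Rightarrow> 'a::real_normed_vector"
  assumes t: "t \<in> {0..1}"
    and f: "\<And>s. s \<in> {0..1} \<Longrightarrow> (f has_vector_derivative f' s) (at s within {0..1})"
    and bound: "\<And>s. s \<in> {0..t} \<Longrightarrow> norm (f' s) \<le> B"
  shows "norm (f t - f 0) \<le> B"
proof -
  have B0: "0 \<le> B" by (rule order.trans[OF norm_ge_zero bound[of 0]]) (use t in simp)
  have "norm (f t - f 0) \<le> B * norm (t - 0)"
  proof (rule differentiable_bound[of "{0..t}" f "\<lambda>x h. h *\<^sub>R f' x"])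
    fix x assume x: "x \<in> {0..t}"
    have "(f has_derivative (\<lambda>h. h *\<^sub>R f' x)) (at x within {0..1})"
      using f[of x] x t unfolding has_vector_derivative_def by auto
    then show "(f has_derivative (\<lambda>h. h *\<^sub>R f' x)) (at x within {0..t})"
      by (rule has_derivative_subset) (use t in auto)
    show "onorm (\<lambda>h. h *\<^sub>R f' x) \<le> B"
      using bound[OF x] B0
      by (intro onorm_bound) (simp_all add: mult.commute[of "\<bar>_\<bar>" "norm (f' x)"] mult_right_mono)
  qed (use t in auto)
  also have "\<dots> \<le> B" using t B0 by (simp add: mult_left_le)
  finally show ?thesis .
qed

text \<open>
  One integration by parts turns the term \<open>b v\<close> into terms with the small factor \<open>1 / (2 \<theta>)\<close>;
  the resonant remainder \<open>b c / (2 \<theta>)\<close> is compensated by \<open>\<i> \<alpha>\<close>.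
\<close>

lemma oscillation_bound:
  fixes u v b c \<alpha> g :: "real \<Rightarrow> complex" and \<theta> :: complex
  assumes \<theta>: "\<theta> \<noteq> 0" "\<bar>Re \<theta>\<bar> \<le> \<kappa>"
    and u: "\<And>t. t \<in> {0..1} \<Longrightarrow> (u has_vector_derivative - \<theta> * u t - \<i> * \<alpha> t * u t + b t * v t) (at t)"
    and v: "\<And>t. t \<in> {0..1} \<Longrightarrow> (v has_vector_derivative \<theta> * v t + \<i> * \<alpha> t * v t + c t * u t) (at t)"
    and cont: "continuous_on {0..1} \<alpha>" "continuous_on {0..1} c"
    and g: "set_integrable lborel {0..1} g" "(LBINT s:{0..1}. cmod (g s)) \<le> G"
    and b: "\<And>t. t \<in> {0..1} \<Longrightarrow> b t = b 0 + (LBINT s:{0..t}. g s)"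
      "\<And>t. t \<in> {0..1} \<Longrightarrow> cmod (b t) \<le> B"
    and \<epsilon>: "\<And>t. t \<in> {0..1} \<Longrightarrow> cmod (\<i> * \<alpha> t + b t * c t / (2 * \<theta>)) + cmod (\<i> * \<alpha> t * b t / (2 * \<theta>))
      \<le> \<epsilon>"
    and S: "\<And>t. t \<in> {0..1} \<Longrightarrow> cmod (u t) \<le> S * exp (\<kappa> * t)" "\<And>t. t \<in> {0..1} \<Longrightarrow> cmod (v t) \<le> S * exp
      (\<kappa> * t)"
    and t: "t \<in> {0..1}"
  shows "cmod (u t - exp (- \<theta> * of_real t) * u 0) \<le> S * exp (\<kappa> * t) * (\<epsilon> + (2 * B + G) / (2 * cmod
    \<theta>))"
proof -
  define e where "e t = exp (\<theta> * of_real t)" for t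
  have ed: "(e has_vector_derivative \<theta> * e t) (at t)" for t
    unfolding e_def by (rule has_vector_derivative_exp_of_real)
  have ucont: "continuous_on {0..1} u" and vcont: "continuous_on {0..1} v"
    by (intro continuous_at_imp_continuous_on ballI, erule has_vector_derivative_continuous[OF u]
      has_vector_derivative_continuous[OF v])+
  have econt: "continuous_on {0..1} e"
    unfolding e_def by (intro continuous_intros)
  \<comment> \<open>Differentiating \<open>e t * v t\<close> produces
    \<open>2 * \<theta> * e t * v t\<close>. Hence \<open>e t * b t * v t\<close>, the term to be
    controlled, is \<open>b t * F' t / (2 * \<theta>)\<close> up to terms that carry the factor
    \<open>1 / (2 * \<theta>)\<close>.\<close>
  define F F' where "F t = e t * v t" and "F' t = e t * (2 * \<theta> * v t + \<i> * \<alpha> t * v t + c t * u t)"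
    for t
  have Fd: "(F has_vector_derivative F' t) (at t)" if "t \<in> {0..1}" for t
    using has_vector_derivative_mult[OF ed[of t] v[OF that]] unfolding F_def[abs_def] F'_def
    by (simp add: algebra_simps)
  have F'cont: "continuous_on {0..1} F'"
    unfolding F'_def by (intro continuous_intros econt vcont ucont cont)
  have Fcont: "continuous_on {0..1} F"
    unfolding F_def by (intro continuous_intros econt vcont)
  define I where "I t = (LBINT s:{0..t}. g s * F s)" for t
  \<comment> \<open>\<open>b t * F t - I t\<close> is a primitive of \<open>b t * F' t\<close>.
    Subtracting it over \<open>2 * \<theta>\<close> leaves in \<open>\<Phi>'\<close> only the terms
    measured by \<open>\<epsilon>\<close>.\<close>
  define \<Phi> where "\<Phi> t = e t * u t - (b t * F t - I t) / (2 * \<theta>)" for t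
  define \<Phi>' where "\<Phi>' t = - e t * ((\<i> * \<alpha> t + b t * c t / (2 * \<theta>)) * u t + (\<i> * \<alpha> t * b t / (2 *
    \<theta>)) * v t)" for t
  have \<Phi>d: "(\<Phi> has_vector_derivative \<Phi>' s) (at s within {0..1})" if s: "s \<in> {0..1}" for s
  proof -
    have 1: "((\<lambda>t. e t * u t) has_vector_derivative e s * (- \<i> * \<alpha> s * u s + b s * v s)) (at s
      within {0..1})"
      using has_vector_derivative_at_within[OF has_vector_derivative_mult[OF ed[of s] u[OF s]], of
        "{0..1}"]
      by (simp add: algebra_simps)
    have "((\<lambda>t. b t * F t - I t) has_vector_derivative b s * F' s) (at s within {0..1})"
      unfolding I_def by (rule has_vector_derivative_ac_mult[OF g(1) b(1) Fd F'cont s])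
    from has_vector_derivative_mult_right[OF this, of "1 / (2 * \<theta>)"]
    have 2: "((\<lambda>t. (b t * F t - I t) / (2 * \<theta>)) has_vector_derivative b s * F' s / (2 * \<theta>)) (at s
      within {0..1})"
      by simp
    have "e s * (- \<i> * \<alpha> s * u s + b s * v s) - b s * F' s / (2 * \<theta>) = \<Phi>' s"
      using \<theta>(1) by (simp add: \<Phi>'_def F'_def field_simps)
    with has_vector_derivative_diff[OF 1 2] show ?thesis by (simp add: \<Phi>_def[abs_def])
  qed
  \<comment> \<open>One bound for all times up to \<open>t\<close>: since
    \<open>Re \<theta> + \<kappa>\<close> is nonnegative, the exponential weight is largest at
    \<open>t\<close>.\<close>
  define W where "W = S * exp ((Re \<theta> + \<kappa>) * t)"
  have ne: "cmod (e s) = exp (Re \<theta> * s)" for s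
    by (simp add: e_def)
  have S0: "S \<ge> 0"
    using order.trans[OF norm_ge_zero S(1)[of 0]] by simp
  have W0: "W \<ge> 0" using S0 by (simp add: W_def)
  have eS: "cmod (e s * w) \<le> W" if "s \<in> {0..t}" "cmod w \<le> S * exp (\<kappa> * s)" for s w
  proof -
    have "cmod (e s * w) \<le> exp (Re \<theta> * s) * (S * exp (\<kappa> * s))"
      using that by (simp add: norm_mult ne mult_left_mono)
    also have "\<dots> = S * exp ((Re \<theta> + \<kappa>) * s)"
      by (simp add: exp_add[symmetric] algebra_simps)
    also have "\<dots> \<le> W"
      unfolding W_def using S0 that(1) \<theta>(2) by (intro mult_left_mono) (auto intro!: mult_left_mono)
    finally show ?thesis .
  qed
  have sub: "s \<in> {0..1}" if "s \<in> {0..t}" for s using that t by auto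
  have "cmod (\<Phi> t - \<Phi> 0) \<le> W * \<epsilon>"
  proof (rule vector_derivative_bound[OF t \<Phi>d])
    fix s assume s: "s \<in> {0..t}"
    have "\<Phi>' s = - ((\<i> * \<alpha> s + b s * c s / (2 * \<theta>)) * (e s * u s) + (\<i> * \<alpha> s * b s / (2 * \<theta>)) * (e
      s * v s))"
      by (simp add: \<Phi>'_def algebra_simps)
    also have "cmod \<dots> \<le> cmod (\<i> * \<alpha> s + b s * c s / (2 * \<theta>)) * W + cmod (\<i> * \<alpha> s * b s / (2 * \<theta>))
      * W"
      unfolding norm_minus_cancel
      by (intro norm_triangle_mono order.trans[OF norm_mult_ineq] mult_left_mono eS[OF s] S[OF
        sub[OF s]] norm_ge_zero)
    also have "\<dots> \<le> \<epsilon> * W"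
      using mult_right_mono[OF \<epsilon>[OF sub[OF s]] W0] by (simp add: distrib_right)
    finally show "cmod (\<Phi>' s) \<le> W * \<epsilon>" by (simp add: mult.commute)
  qed
  moreover have F: "cmod (F s) \<le> W" if "s \<in> {0..t}" for s
    unfolding F_def by (rule eS[OF that S(2)[OF sub[OF that]]])
  have B0: "B \<ge> 0" by (rule order.trans[OF norm_ge_zero b(2)[of 0]]) simp
  have bF: "cmod (b s * F s) \<le> B * W" if "s \<in> {0..t}" for s
    unfolding norm_mult using b(2)[OF sub[OF that]] F[OF that] B0 by (intro mult_mono) auto
  have I: "cmod (I t) \<le> G * W"
  proof -
    have gF: "set_integrable lborel {0..1} (\<lambda>s. g s * F s)"
      by (rule set_integrable_mult_continuous[OF g(1) Fcont])
    have gn: "set_integrable lborel {0..1} (\<lambda>s. cmod (g s))"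
      by (rule set_integrable_norm[OF g(1)])
    have "cmod (I t) \<le> (LBINT s:{0..t}. cmod (g s * F s))"
      unfolding I_def by (intro set_integral_norm_bound set_integrable_subset[OF gF])
        (use t in auto)
    also have "\<dots> \<le> (LBINT s:{0..1}. W * cmod (g s))"
      unfolding set_lebesgue_integral_def
    proof (rule integral_mono)
      show "integrable lborel (\<lambda>s. indicat_real {0..t} s *\<^sub>R cmod (g s * F s))"
        using set_integrable_subset[OF set_integrable_norm[OF gF], of "{0..t}"] t
        unfolding set_integrable_def by (auto simp: subset_iff)
      show "integrable lborel (\<lambda>s. indicat_real {0..1} s *\<^sub>R (W * cmod (g s)))"
        using set_integrable_mult_right[of W, OF gn] unfolding set_integrable_def by simp
      fix s
      show "indicat_real {0..t} s *\<^sub>R cmod (g s * F s) \<le> indicat_real {0..1} s *\<^sub>R (W * cmod (g s))"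
        using F[of s] W0 t by (auto simp: indicator_def norm_mult mult.commute[of W] intro!:
          mult_left_mono)
    qed
    also have "\<dots> = W * (LBINT s:{0..1}. cmod (g s))" by simp
    also have "\<dots> \<le> W * G" using g(2) W0 by (rule mult_left_mono)
    finally show ?thesis by (simp add: mult.commute)
  qed
  have I0: "I 0 = 0"
    unfolding I_def set_lebesgue_integral_def
    by (rule integral_eq_zero_AE, use AE_lborel_singleton[of "0::real"] in eventually_elim)
      (auto simp: indicator_def)
  have t0: "t \<in> {0..t}" "0 \<in> {0..t}" using t by auto
  have "e t * u t - u 0 = (\<Phi> t - \<Phi> 0) + (b t * F t - b 0 * F 0 - I t) / (2 * \<theta>)"
    using \<theta>(1) by (simp add: \<Phi>_def I0 e_def field_simps)
  moreover have "cmod ((b t * F t - b 0 * F 0 - I t) / (2 * \<theta>)) \<le> ((2 * B + G) / (2 * cmod \<theta>)) * W"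
  proof -
    have "cmod (b t * F t - b 0 * F 0 - I t) \<le> (B * W + B * W) + G * W"
      using norm_triangle_ineq4[of "b t * F t - b 0 * F 0" "I t"] norm_triangle_ineq4[of "b t * F
        t" "b 0 * F 0"]
        bF[OF t0(1)] bF[OF t0(2)] I by linarith
    then show ?thesis
      using \<theta>(1) by (simp add: norm_divide norm_mult divide_right_mono algebra_simps)
  qed
  ultimately have "cmod (e t * u t - u 0) \<le> W * \<epsilon> + ((2 * B + G) / (2 * cmod \<theta>)) * W"
    using norm_triangle_mono by metis
  then have "exp (- Re \<theta> * t) * cmod (e t * u t - u 0) \<le> exp (- Re \<theta> * t) * (W * (\<epsilon> + (2 * B + G)
    / (2 * cmod \<theta>)))"
    by (intro mult_left_mono) (simp_all add: algebra_simps)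
  also have "exp (- Re \<theta> * t) * (W * (\<epsilon> + (2 * B + G) / (2 * cmod \<theta>))) = S * exp (\<kappa> * t) * (\<epsilon> + (2
    * B + G) / (2 * cmod \<theta>))"
  proof -
    have "exp (- Re \<theta> * t) * exp ((Re \<theta> + \<kappa>) * t) = exp (\<kappa> * t)"
      by (simp add: exp_add[symmetric] algebra_simps)
    then show ?thesis by (simp add: W_def mult_ac)
  qed
  also have "exp (- Re \<theta> * t) * cmod (e t * u t - u 0) = cmod (u t - exp (- \<theta> * of_real t) * u 0)"
  proof -
    have "exp (- \<theta> * of_real t) * (e t * u t - u 0) = u t - exp (- \<theta> * of_real t) * u 0"
      by (simp add: e_def right_diff_distrib mult.assoc[symmetric] exp_add[symmetric])
    moreover have "cmod (exp (- \<theta> * of_real t)) = exp (- Re \<theta> * t)" by simp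
    ultimately show ?thesis by (metis norm_mult)
  qed
  finally show ?thesis .
qed

text \<open>The best constant in a bound by a multiple of \<open>exp (\<kappa> * t)\<close> is
  attained at some time \<open>s\<close>. An estimate of \<open>u\<close> at that \<open>s\<close>
  therefore estimates the constant itself, which allows a bootstrap.\<close>

lemma sup_exp_weighted:
  fixes u :: "real \<Rightarrow> complex"
  assumes "continuous_on {0..1} u"
  obtains s where "s \<in> {0..1}" "\<And>t. t \<in> {0..1} \<Longrightarrow> cmod (u t) \<le> exp (- \<kappa> * s) * cmod (u s) * exp (\<kappa>
    * t)"
proof -
  have "continuous_on {0..1} (\<lambda>t. exp (- \<kappa> * t) * cmod (u t))"
    by (intro continuous_intros assms)
  from continuous_attains_sup[OF compact_Icc _ this] obtain s where s: "s \<in> {0..1}"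
    "\<And>t. t \<in> {0..1} \<Longrightarrow> exp (- \<kappa> * t) * cmod (u t) \<le> exp (- \<kappa> * s) * cmod (u s)"
    by auto
  have "cmod (u t) \<le> exp (- \<kappa> * s) * cmod (u s) * exp (\<kappa> * t)" if "t \<in> {0..1}" for t
    using mult_right_mono[OF s(2)[OF that], of "exp (\<kappa> * t)"]
    by (simp add: exp_minus field_simps)
  with s(1) show ?thesis using that by blast
qed

text \<open>Bootstrap: if \<open>S\<close> is the weighted maximum of both components, the
  oscillation estimate bounds their distance to the free exponentials by \<open>S * (P / z)\<close>
  times the weight. So S <= 1 + S P / z, and \<open>z \<ge> 2 * P\<close> yields S <= 2.\<close>

lemma chi_D_asymp_large:
  assumes \<zeta>: "cmod \<zeta> \<ge> 1" "cmod \<zeta> \<ge> 2 * (4 * R + 5 * R\<^sup>2 + 6 * R ^ 3)" and R: "norm \<psi> \<le> R"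
  shows "cmod (chi_D \<psi> \<zeta> - sin (2 * \<zeta>\<^sup>2))
    \<le> 2 * (4 * R + 5 * R\<^sup>2 + 6 * R ^ 3) / cmod \<zeta> * exp \<bar>Im (2 * \<zeta>\<^sup>2)\<bar>"
proof -
  \<comment> \<open>Three errors, each to be divided by the modulus of \<open>\<zeta>\<close>:
    \<open>4 * R\<close> for the boundary terms and the derivative of the off-diagonal entry (15/4
    R, rounded up), \<open>5 * R\<^sup>2\<close> for what the cancellation leaves,
    \<open>6 * R ^ 3\<close> for the diagonal term times the off-diagonal one.\<close>
  define P where "P = 4 * R + 5 * R\<^sup>2 + 6 * R ^ 3"
  define z where "z = cmod \<zeta>"
  have z: "z \<ge> 1" "z \<ge> 2 * P" using \<zeta> by (simp_all add: z_def P_def)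
  have R0: "R \<ge> 0" by (rule order.trans[OF norm_ge_zero R])
  define \<theta> where "\<theta> = 2 * \<i> * \<zeta>\<^sup>2"
  define \<kappa> where "\<kappa> = \<bar>Im (2 * \<zeta>\<^sup>2)\<bar>"
  have \<zeta>0: "\<zeta> \<noteq> 0" using \<zeta>(1) by auto
  have \<theta>: "\<theta> \<noteq> 0" "\<bar>Re \<theta>\<bar> \<le> \<kappa>" using \<zeta>0 by (simp_all add: \<theta>_def \<kappa>_def)
  have n\<theta>: "cmod \<theta> = 2 * z\<^sup>2" by (simp add: \<theta>_def norm_mult norm_power z_def)
  have n2\<theta>: "cmod (2 * \<theta>) = 4 * z\<^sup>2" by (simp add: norm_mult n\<theta>)
  obtain u v where uv: "is_sol \<zeta> \<psi> u v" "u 0 = 1" "v 0 = 1" by (rule is_sol_exists)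
  define p where "p j t = h1_fun (\<psi> $ j) t" for j t
  have pR: "cmod (p j t) \<le> 2 * R" if "t \<in> {0..1}" for j t
    using pot_sup_bound[OF that, of \<psi> j] R by (simp add: p_def)
  have ppR: "cmod (p i t * p j t) \<le> 4 * R\<^sup>2" if "t \<in> {0..1}" for i j t
    using mult_mono[OF pR[OF that, of i] pR[OF that, of j]] R0
      by (simp add: norm_mult power2_eq_square)
  have pcont: "continuous_on {0..1} (p j)" for j
    unfolding p_def by (rule continuous_on_subset[OF h1_fun_continuous]) simp
  define \<alpha> where "\<alpha> t = p 1 t * p 2 t" for t
  define b c where "b = coef_b \<zeta> \<psi>" and "c = coef_c \<zeta> \<psi>"
  have b: "b t = 2 * \<zeta> * p 1 t + \<i> * p 3 t" and c: "c t = 2 * \<zeta> * p 2 t - \<i> * p 4 t" for t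
    by (simp_all add: b_def c_def coef_b_def coef_c_def p_def)
  have a: "coef_a \<zeta> \<psi> t = - \<theta> - \<i> * \<alpha> t" for t by (simp add: coef_a_def \<theta>_def \<alpha>_def p_def)
  have ud: "(u has_vector_derivative - \<theta> * u t - \<i> * \<alpha> t * u t + b t * v t) (at t)"
    and vd: "(v has_vector_derivative \<theta> * v t + \<i> * \<alpha> t * v t + c t * u t) (at t)" for t
  proof -
    have "(u has_vector_derivative coef_a \<zeta> \<psi> t * u t + coef_b \<zeta> \<psi> t * v t) (at t)"
      and "(v has_vector_derivative coef_c \<zeta> \<psi> t * u t - coef_a \<zeta> \<psi> t * v t) (at t)"
      using uv(1) unfolding is_sol_def by blast+
    then show "(u has_vector_derivative - \<theta> * u t - \<i> * \<alpha> t * u t + b t * v t) (at t)"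
      "(v has_vector_derivative \<theta> * v t + \<i> * \<alpha> t * v t + c t * u t) (at t)"
      unfolding a b_def c_def by (simp_all add: algebra_simps)
  qed
  have cont: "continuous_on {0..1} \<alpha>" "continuous_on {0..1} b" "continuous_on {0..1} c"
    unfolding \<alpha>_def b_def c_def
    by (intro continuous_intros pcont continuous_on_subset[OF continuous_coef(2)]
      continuous_on_subset[OF continuous_coef(3)]; simp)+
  define gb where "gb t = 2 * \<zeta> * h1_diff (\<psi> $ 1) t + \<i> * h1_diff (\<psi> $ 3) t" for t
  define gc where "gc t = 2 * \<zeta> * h1_diff (\<psi> $ 2) t + (- \<i>) * h1_diff (\<psi> $ 4) t" for t
  have lin: "set_integrable lborel {0..1} (\<lambda>t. x * h1_diff (\<psi> $ i) t + y * h1_diff (\<psi> $ j) t)"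
      "(LBINT t:{0..1}. cmod (x * h1_diff (\<psi> $ i) t + y * h1_diff (\<psi> $ j) t)) \<le> (cmod x + cmod y)
        * R"
      "t \<in> {0..1} \<Longrightarrow> x * p i t + y * p j t = (x * p i 0 + y * p j 0) + (LBINT s:{0..t}. x * h1_diff
        (\<psi> $ i) s + y * h1_diff (\<psi> $ j) s)"
    for x y i j t
  proof -
    have d: "h1_deriv (\<lambda>t. x * h1_fun (\<psi> $ i) t + y * h1_fun (\<psi> $ j) t) (\<lambda>t. x * h1_diff (\<psi> $ i) t
      + y * h1_diff (\<psi> $ j) t)"
      by (intro h1_deriv_add h1_deriv_mult h1_diff)
    show int: "set_integrable lborel {0..1} (\<lambda>t. x * h1_diff (\<psi> $ i) t + y * h1_diff (\<psi> $ j) t)"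
      by (rule h1_deriv_set_integrable[OF d])
    show "x * p i t + y * p j t = (x * p i 0 + y * p j 0) + (LBINT s:{0..t}. x * h1_diff (\<psi> $ i) s
      + y * h1_diff (\<psi> $ j) s)"
      if "t \<in> {0..1}" using h1_deriv_integral[OF d that] by (simp add: p_def)
    have "(LBINT t:{0..1}. cmod (x * h1_diff (\<psi> $ i) t + y * h1_diff (\<psi> $ j) t))
        \<le> (LBINT t:{0..1}. cmod x * cmod (h1_diff (\<psi> $ i) t) + cmod y * cmod (h1_diff (\<psi> $ j) t))"
      by (intro set_integral_mono set_integrable_norm[OF int] set_integral_add(1)
        set_integrable_mult_right h1_diff_L1(1))
        (auto intro!: order.trans[OF norm_triangle_ineq] simp: norm_mult)
    also have "\<dots> = cmod x * (LBINT t:{0..1}. cmod (h1_diff (\<psi> $ i) t)) + cmod y * (LBINT t:{0..1}.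
      cmod (h1_diff (\<psi> $ j) t))"
      by (subst set_integral_add(2)) (auto intro!: set_integrable_mult_right h1_diff_L1(1))
    also have "\<dots> \<le> cmod x * R + cmod y * R"
      by (intro add_mono mult_left_mono order.trans[OF h1_diff_L1(2)] order.trans[OF
        Finite_Cartesian_Product.norm_nth_le] R) auto
    finally show "(LBINT t:{0..1}. cmod (x * h1_diff (\<psi> $ i) t + y * h1_diff (\<psi> $ j) t)) \<le> (cmod x
      + cmod y) * R"
      by (simp add: distrib_right)
  qed
  have gb: "set_integrable lborel {0..1} gb" "(LBINT t:{0..1}. cmod (gb t)) \<le> 3 * R * z"
    and gc: "set_integrable lborel {0..1} gc" "(LBINT t:{0..1}. cmod (gc t)) \<le> 3 * R * z"
  proof -
    have *: "(cmod (2 * \<zeta>) + 1) * R \<le> 3 * R * z"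
      using mult_right_mono[OF z(1) R0] by (simp add: norm_mult z_def algebra_simps)
    show "set_integrable lborel {0..1} gb" "set_integrable lborel {0..1} gc"
      unfolding gb_def gc_def by (rule lin)+
    show "(LBINT t:{0..1}. cmod (gb t)) \<le> 3 * R * z" "(LBINT t:{0..1}. cmod (gc t)) \<le> 3 * R * z"
      using lin(2)[of "2 * \<zeta>" 1 "\<i>" 3] lin(2)[of "2 * \<zeta>" 2 "- \<i>" 4] * unfolding gb_def gc_def
        by simp_all
  qed
  have gb3: "b t = b 0 + (LBINT s:{0..t}. gb s)" and gc3: "c t = c 0 + (LBINT s:{0..t}. gc s)"
    if "t \<in> {0..1}" for t
    using lin(3)[OF that, of "2 * \<zeta>" 1 "\<i>" 3] lin(3)[OF that, of "2 * \<zeta>" 2 "- \<i>" 4]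
    unfolding b c gb_def gc_def by simp_all
  have bB: "cmod (b t) \<le> 6 * R * z" and cB: "cmod (c t) \<le> 6 * R * z" if t: "t \<in> {0..1}" for t
  proof -
    have 1: "2 * (cmod \<zeta> * cmod (p j t)) \<le> 4 * R * z" for j
      using mult_left_mono[OF pR[OF t, of j], of z] z(1) by (simp add: z_def mult_ac)
    have 2: "cmod (p j t) \<le> 2 * R * z" for j
      using pR[OF t, of j] mult_left_mono[OF z(1), of "2 * R"] R0 by simp
    show "cmod (b t) \<le> 6 * R * z" "cmod (c t) \<le> 6 * R * z"
      unfolding b c
      using norm_triangle_ineq[of "2 * \<zeta> * p 1 t" "\<i> * p 3 t"] norm_triangle_ineq4[of "2 * \<zeta> * p 2
        t" "\<i> * p 4 t"]
        1[of 1] 1[of 2] 2[of 3] 2[of 4] by (simp_all add: norm_mult)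
  qed
  define \<epsilon> where "\<epsilon> = (5 * R\<^sup>2 + 6 * R ^ 3) / z"
  \<comment> \<open>The product of the leading parts of \<open>b\<close> and \<open>c\<close>
    cancels \<open>\<i> * \<alpha> t\<close> here. The two mixed products are of order 1/z, the
    product of the lower parts of order 1/z^2.\<close>
  have res: "cmod (\<i> * \<alpha> t + b t * c t / (2 * \<theta>)) \<le> 5 * R\<^sup>2 / z" if t: "t \<in> {0..1}" for t
  proof -
    have "\<i> * \<alpha> t + b t * c t / (2 * \<theta>) = (p 3 t * p 2 t - p 1 t * p 4 t) / (2 * \<zeta>) + p 3 t * p 4
      t / (2 * \<theta>)"
      using \<zeta>0 by (simp add: \<alpha>_def b c \<theta>_def field_simps power2_eq_square)
    also have "cmod \<dots> \<le> (4 * R\<^sup>2 + 4 * R\<^sup>2) / (2 * z) + 4 * R\<^sup>2 / (4 * z\<^sup>2)"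
    proof (rule norm_triangle_mono)
      show "cmod ((p 3 t * p 2 t - p 1 t * p 4 t) / (2 * \<zeta>)) \<le> (4 * R\<^sup>2 + 4 * R\<^sup>2) / (2 * z)"
        using norm_triangle_ineq4[of "p 3 t * p 2 t" "p 1 t * p 4 t"] ppR[OF t, of 3 2] ppR[OF t,
          of 1 4] z(1)
        unfolding norm_divide by (intro frac_le) (auto simp: norm_mult z_def)
      show "cmod (p 3 t * p 4 t / (2 * \<theta>)) \<le> 4 * R\<^sup>2 / (4 * z\<^sup>2)"
        using ppR[OF t, of 3 4] z(1) unfolding norm_divide
          by (intro frac_le) (auto simp: norm_mult n\<theta>)
    qed
    also have "4 * R\<^sup>2 / (4 * z\<^sup>2) \<le> R\<^sup>2 / z"
      using z(1) mult_left_mono[OF z(1) zero_le_power2[of R]]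
        by (simp add: power2_eq_square field_simps)
    then have "(4 * R\<^sup>2 + 4 * R\<^sup>2) / (2 * z) + 4 * R\<^sup>2 / (4 * z\<^sup>2) \<le> 5 * R\<^sup>2 / z"
      using z(1) by (simp add: field_simps)
    finally show ?thesis .
  qed
  have \<alpha>x: "cmod (\<i> * \<alpha> t * x / (2 * \<theta>)) \<le> 6 * R ^ 3 / z" if t: "t \<in> {0..1}"
    and x: "cmod x \<le> 6 * R * z" for t x
  proof -
    have "cmod (\<i> * \<alpha> t * x / (2 * \<theta>)) \<le> (4 * R\<^sup>2) * (6 * R * z) / (4 * z\<^sup>2)"
    proof -
      have "cmod (\<i> * \<alpha> t * x) \<le> (4 * R\<^sup>2) * (6 * R * z)"
        unfolding norm_mult[of _ x] using ppR[OF t, of 1 2] x z(1) R0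
        by (intro mult_mono) (simp_all add: \<alpha>_def norm_mult)
      then show ?thesis
        unfolding norm_divide n2\<theta> by (rule divide_right_mono) simp
    qed
    also have "\<dots> = 6 * R ^ 3 / z"
      using z(1) by (simp add: power2_eq_square power3_eq_cube field_simps)
    finally show ?thesis .
  qed
  have res': "cmod (\<i> * (- \<alpha> t) + c t * b t / (2 * (- \<theta>))) = cmod (\<i> * \<alpha> t + b t * c t / (2 * \<theta>))"
    for t
  proof -
    have "\<i> * (- \<alpha> t) + c t * b t / (2 * (- \<theta>)) = - (\<i> * \<alpha> t + b t * c t / (2 * \<theta>))"
      using \<theta>(1) by (simp add: field_simps)
    then show ?thesis by (metis norm_minus_cancel)
  qed
  have \<alpha>c: "cmod (\<i> * (- \<alpha> t) * c t / (2 * (- \<theta>))) = cmod (\<i> * \<alpha> t * c t / (2 * \<theta>))" for t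
    by (simp add: norm_mult norm_divide)
  have \<epsilon>eq: "5 * R\<^sup>2 / z + 6 * R ^ 3 / z = \<epsilon>" by (simp add: \<epsilon>_def add_divide_distrib)
  have \<epsilon>1: "cmod (\<i> * \<alpha> t + b t * c t / (2 * \<theta>)) + cmod (\<i> * \<alpha> t * b t / (2 * \<theta>)) \<le> \<epsilon>"
    and \<epsilon>2: "cmod (\<i> * (- \<alpha> t) + c t * b t / (2 * (- \<theta>))) + cmod (\<i> * (- \<alpha> t) * c t / (2 * (- \<theta>)))
      \<le> \<epsilon>"
    if "t \<in> {0..1}" for t
    using add_mono[OF res[OF that] \<alpha>x[OF that bB[OF that]]] add_mono[OF res[OF that] \<alpha>x[OF that
      cB[OF that]]]
    unfolding \<epsilon>eq res' \<alpha>c by blast+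
  have small: "\<epsilon> + (2 * (6 * R * z) + 3 * R * z) / (2 * cmod \<theta>) \<le> P / z"
  proof -
    have "(2 * (6 * R * z) + 3 * R * z) / (2 * cmod \<theta>) = (15 / 4) * R / z"
      using z(1) by (simp add: n\<theta> power2_eq_square field_simps)
    also have "\<dots> \<le> 4 * R / z" using z(1) R0 by (intro divide_right_mono) auto
    finally show ?thesis by (simp add: \<epsilon>_def P_def add_divide_distrib)
  qed
  obtain s1 where s1: "s1 \<in> {0..1}" "\<And>t. t \<in> {0..1} \<Longrightarrow> cmod (u t) \<le> exp (- \<kappa> * s1) * cmod (u s1) *
    exp (\<kappa> * t)"
    using sup_exp_weighted[OF continuous_on_subset[OF is_sol_continuous(1)[OF uv(1)]]] by blast
  obtain s2 where s2: "s2 \<in> {0..1}" "\<And>t. t \<in> {0..1} \<Longrightarrow> cmod (v t) \<le> exp (- \<kappa> * s2) * cmod (v s2) *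
    exp (\<kappa> * t)"
    using sup_exp_weighted[OF continuous_on_subset[OF is_sol_continuous(2)[OF uv(1)]]] by blast
  define S where "S = max (exp (- \<kappa> * s1) * cmod (u s1)) (exp (- \<kappa> * s2) * cmod (v s2))"
  have Su: "cmod (u t) \<le> S * exp (\<kappa> * t)" and Sv: "cmod (v t) \<le> S * exp (\<kappa> * t)" if "t \<in> {0..1}"
    for t
    using s1(2)[OF that] s2(2)[OF that]
    by (auto simp: S_def elim!: order.trans intro!: mult_right_mono)
  have S0: "S \<ge> 0" by (simp add: S_def le_max_iff_disj)
  have Q: "S * exp (\<kappa> * t) * (\<epsilon> + (2 * (6 * R * z) + 3 * R * z) / (2 * cmod \<theta>)) \<le> S * exp (\<kappa> * t)
    * (P / z)" for t
    using S0 by (intro mult_left_mono small) auto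
  have du: "cmod (u t - exp (- \<theta> * of_real t)) \<le> S * exp (\<kappa> * t) * (P / z)" if "t \<in> {0..1}" for t
    using oscillation_bound[OF \<theta> ud vd cont(1,3) gb(1,2) gb3 bB \<epsilon>1 Su Sv that] Q[of t] uv by simp
  have dv: "cmod (v t - exp (\<theta> * of_real t)) \<le> S * exp (\<kappa> * t) * (P / z)" if "t \<in> {0..1}" for t
  proof -
    \<comment> \<open>The equations for \<open>(v, u)\<close> have the same form with
      \<open>\<theta>\<close> and \<open>\<alpha>\<close> negated and \<open>b\<close>,
      \<open>c\<close> exchanged, so the estimate for \<open>u\<close> applies again.\<close>
    have 1: "- \<theta> \<noteq> 0" "\<bar>Re (- \<theta>)\<bar> \<le> \<kappa>" using \<theta> by auto
    have 2: "(v has_vector_derivative - (- \<theta>) * v t - \<i> * (- \<alpha> t) * v t + c t * u t) (at t)"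
      "(u has_vector_derivative (- \<theta>) * u t + \<i> * (- \<alpha> t) * u t + b t * v t) (at t)" for t
      using ud vd by simp_all
    have 3: "continuous_on {0..1} (\<lambda>t. - \<alpha> t)" by (intro continuous_intros cont)
    show ?thesis
      using oscillation_bound[OF 1 2 3 cont(2) gc(1,2) gc3 cB \<epsilon>2 Sv Su that] Q[of t] uv by simp
  qed
  \<comment> \<open>\<open>S\<close> is attained by \<open>u\<close> at \<open>s1\<close> or by
    \<open>v\<close> at \<open>s2\<close>; at that time the free exponential has modulus at most the
    weight, which contributes the 1.\<close>
  have S2: "S \<le> 2"
  proof -
    have *: "exp (- \<kappa> * s) * cmod w \<le> 1 + S * (P / z)"
      if "cmod (w - exp (\<tau> * of_real s)) \<le> S * exp (\<kappa> * s) * (P / z)" "s \<in> {0..1}" "\<bar>Re \<tau>\<bar> \<le> \<kappa>"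
        for s w \<tau>
    proof -
      have "Re \<tau> * s \<le> \<kappa> * s" using that by (intro mult_right_mono) auto
      then have "cmod (exp (\<tau> * of_real s)) \<le> exp (\<kappa> * s)" by simp
      then have "cmod w \<le> S * exp (\<kappa> * s) * (P / z) + exp (\<kappa> * s)"
        using norm_triangle_mono[OF that(1)] by fastforce
      then have "cmod w \<le> exp (\<kappa> * s) * (1 + S * (P / z))" by (simp add: algebra_simps)
      from mult_left_mono[OF this, of "exp (- \<kappa> * s)"] show ?thesis
        by (simp add: mult.assoc[symmetric] exp_add[symmetric])
    qed
    have "S \<le> 1 + S * (P / z)"
      using *[OF du[OF s1(1)] s1(1)] *[OF dv[OF s2(1)] s2(1)] \<theta>(2) unfolding S_def[symmetric]
      by (subst (1) S_def) auto
    also have "S * (P / z) \<le> S * (1 / 2)"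
      using z by (intro mult_left_mono S0) (auto simp: field_simps)
    finally show ?thesis by simp
  qed
  have P0: "0 \<le> P / z" using z(1) R0 by (simp add: P_def)
  have S2P: "S * exp \<kappa> * (P / z) \<le> 2 * exp \<kappa> * (P / z)"
    using S2 P0 by (intro mult_right_mono) auto
  have "chi_D \<psi> \<zeta> - sin (2 * \<zeta>\<^sup>2) = ((v 1 - exp \<theta>) - (u 1 - exp (- \<theta>))) / (2 * \<i>)"
    unfolding chi_D_eq[OF uv] sin_exp_eq
    by (simp add: \<theta>_def diff_divide_distrib mult_ac)
  also have "cmod \<dots> \<le> (2 * exp \<kappa> * (P / z) + 2 * exp \<kappa> * (P / z)) / 2"
  proof -
    have "cmod (u 1 - exp (- \<theta>)) \<le> 2 * exp \<kappa> * (P / z)" "cmod (v 1 - exp \<theta>) \<le> 2 * exp \<kappa> * (P / z)"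
      using order.trans[OF _ S2P] du[of 1] dv[of 1] by simp_all
    then have "cmod ((v 1 - exp \<theta>) - (u 1 - exp (- \<theta>))) \<le> 2 * exp \<kappa> * (P / z) + 2 * exp \<kappa> * (P / z)"
      using norm_triangle_ineq4[of "v 1 - exp \<theta>" "u 1 - exp (- \<theta>)"] by linarith
    then show ?thesis unfolding norm_divide by (simp add: norm_mult)
  qed
  finally show ?thesis
    unfolding P_def[symmetric] \<kappa>_def[symmetric] z_def[symmetric] by (simp add: mult_ac)
qed

lemma chi_D_bounded:
  assumes "cmod \<zeta> \<le> Z" "norm \<psi> \<le> R"
  shows "cmod (chi_D \<psi> \<zeta>) \<le> sol_bound Z R"
proof -
  obtain u v where uv: "is_sol \<zeta> \<psi> u v" "u 0 = 1" "v 0 = 1" by (rule is_sol_exists)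
  show ?thesis
    using is_sol_bound[OF uv assms, of 1] norm_triangle_ineq4[of "v 1" "u 1"]
    by (simp add: chi_D_eq[OF uv] norm_divide norm_mult)
qed

text \<open>Below the threshold \<open>\<Lambda>\<close> the Gronwall bound suffices, both for
  \<open>chi_D \<psi>\<close> and for the sine, which is \<open>chi_D 0\<close>. The larger of the
  two constants then works for every \<open>\<zeta>\<close>.\<close>

lemma chi_D_asymp:
  obtains C where "C \<ge> 0" "\<And>\<zeta> \<psi>. norm \<psi> \<le> R \<Longrightarrow>
    cmod (chi_D \<psi> \<zeta> - sin (2 * \<zeta>\<^sup>2)) \<le> C / (1 + cmod \<zeta>) * exp \<bar>Im (2 * \<zeta>\<^sup>2)\<bar>"
proof -
  define P where "P = 4 * R + 5 * R\<^sup>2 + 6 * R ^ 3"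
  define \<Lambda> where "\<Lambda> = max 1 (2 * P)"
  define C where "C = max (4 * P) (2 * sol_bound \<Lambda> R * (1 + \<Lambda>))"
  have \<Lambda>: "\<Lambda> \<ge> 1" by (simp add: \<Lambda>_def)
  have sb0: "sol_bound \<Lambda> R \<ge> 0" by (simp add: sol_bound_def)
  have C: "C \<ge> 0" using sb0 \<Lambda> by (simp add: C_def le_max_iff_disj)
  have "cmod (chi_D \<psi> \<zeta> - sin (2 * \<zeta>\<^sup>2)) \<le> C / (1 + cmod \<zeta>) * exp \<bar>Im (2 * \<zeta>\<^sup>2)\<bar>"
    if \<psi>: "norm \<psi> \<le> R" for \<zeta> \<psi>
  proof (cases "cmod \<zeta> \<ge> \<Lambda>")
    case True
    then have z: "cmod \<zeta> \<ge> 1" "cmod \<zeta> \<ge> 2 * P" by (auto simp: \<Lambda>_def)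
    have R0: "R \<ge> 0" by (rule order.trans[OF norm_ge_zero \<psi>])
    have P0: "P \<ge> 0" using R0 by (simp add: P_def)
    have "0 < cmod \<zeta>" "0 < 1 + cmod \<zeta>" using z(1) by linarith+
    then have "2 * P / cmod \<zeta> \<le> 4 * P / (1 + cmod \<zeta>)"
      using mult_left_mono[OF z(1) P0] by (simp add: field_simps)
    also have "\<dots> \<le> C / (1 + cmod \<zeta>)"
      by (intro divide_right_mono) (auto simp: C_def add_nonneg_nonneg)
    finally have "2 * P / cmod \<zeta> * exp \<bar>Im (2 * \<zeta>\<^sup>2)\<bar> \<le> C / (1 + cmod \<zeta>) * exp \<bar>Im (2 * \<zeta>\<^sup>2)\<bar>"
      by (rule mult_right_mono) simp
    with chi_D_asymp_large[OF z(1) z(2)[unfolded P_def] \<psi>] show ?thesis by (simp add: P_def)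
  next
    case False
    then have z: "cmod \<zeta> \<le> \<Lambda>" by simp
    have "norm (0::potential) \<le> R" using order.trans[OF norm_ge_zero \<psi>] by simp
    from chi_D_bounded[OF z this] chi_D_bounded[OF z \<psi>] have "cmod (chi_D \<psi> \<zeta> - sin (2 * \<zeta>\<^sup>2)) \<le> 2
      * sol_bound \<Lambda> R"
      using norm_triangle_ineq4[of "chi_D \<psi> \<zeta>" "sin (2 * \<zeta>\<^sup>2)"] by (simp add: chi_D_0)
    also have "\<dots> \<le> 2 * sol_bound \<Lambda> R * ((1 + \<Lambda>) / (1 + cmod \<zeta>))"
    proof -
      have "1 \<le> (1 + \<Lambda>) / (1 + cmod \<zeta>)" using z by (simp add: le_divide_eq add_pos_nonneg)
      from mult_left_mono[OF this, of "2 * sol_bound \<Lambda> R"] sb0 show ?thesis by simp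
    qed
    also have "\<dots> \<le> C / (1 + cmod \<zeta>)"
      by (simp add: C_def divide_right_mono add_nonneg_nonneg)
    also have "\<dots> \<le> C / (1 + cmod \<zeta>) * exp \<bar>Im (2 * \<zeta>\<^sup>2)\<bar>"
      using mult_left_mono[of 1 "exp \<bar>Im (2 * \<zeta>\<^sup>2)\<bar>" "C / (1 + cmod \<zeta>)"] C
        by (simp add: add_nonneg_nonneg)
    finally show ?thesis .
  qed
  with C that show ?thesis by blast
qed

section \<open>Analytic dependence of simple zeros\<close>

lemma pot_mult_0: "pot_mult c 0 = 0"
  using norm_pot_mult[of c 0] by simp

lemma chi_D_has_field_derivative: "\<exists>D. (chi_D \<psi> has_field_derivative D) (at \<zeta>)"
proof -
  obtain L where L: "((\<lambda>x. chi_D (snd x) (fst x)) has_derivative L) (at (\<zeta>, \<psi>))"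
    "\<And>c z \<eta>. L (c * z, pot_mult c \<eta>) = c * L (z, \<eta>)"
    using chi_D_frechet[of \<zeta> \<psi>] by blast
  have "((\<lambda>\<zeta>. (\<zeta>, \<psi>)) has_derivative (\<lambda>z. (z, 0))) (at \<zeta>)"
    by (auto intro!: derivative_eq_intros)
  from has_derivative_compose[OF this, of "\<lambda>x. chi_D (snd x) (fst x)" L] L(1)
  have "(chi_D \<psi> has_derivative (\<lambda>z. L (z, 0))) (at \<zeta>)" by simp
  define D where "D = L (1, 0)"
  have "L (z, 0) = z * D" for z
    using L(2)[of z 1 0] by (simp add: pot_mult_0 D_def)
  then have "(\<lambda>z. L (z, 0)) = (*) D" by (simp add: fun_eq_iff mult.commute)
  with \<open>(chi_D \<psi> has_derivative (\<lambda>z. L (z, 0))) (at \<zeta>)\<close>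
  show ?thesis by (auto simp: has_field_derivative_def)
qed

lemma chi_D_holomorphic: "chi_D \<psi> holomorphic_on A"
  unfolding holomorphic_on_def field_differentiable_def
  using chi_D_has_field_derivative[of \<psi>] has_field_derivative_at_within by blast

lemma chi_D_pot_analytic: "(\<lambda>\<psi>. chi_D \<psi> \<zeta>) pot_analytic_on UNIV"
  unfolding pot_analytic_on_def
proof (intro conjI ballI)
  fix \<psi> :: potential
  obtain L where L: "((\<lambda>x. chi_D (snd x) (fst x)) has_derivative L) (at (\<zeta>, \<psi>))"
    "\<And>c z \<eta>. L (c * z, pot_mult c \<eta>) = c * L (z, \<eta>)"
    using chi_D_frechet[of \<zeta> \<psi>] by blast
  have "((\<lambda>\<psi>. (\<zeta>, \<psi>)) has_derivative (\<lambda>\<eta>. (0, \<eta>))) (at \<psi>)"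
    by (auto intro!: derivative_eq_intros)
  from has_derivative_compose[OF this, of "\<lambda>x. chi_D (snd x) (fst x)" L] L(1)
  have "((\<lambda>\<psi>. chi_D \<psi> \<zeta>) has_derivative (\<lambda>\<eta>. L (0, \<eta>))) (at \<psi>)" by simp
  moreover have "L (0, pot_mult c h) = c * L (0, h)" for c h
    using L(2)[of c 0 h] by simp
  ultimately show "\<exists>F'. ((\<lambda>\<psi>. chi_D \<psi> \<zeta>) has_derivative F') (at \<psi>) \<and> (\<forall>c h. F' (pot_mult c h) = c
    * F' h)"
    by blast
qed simp

lemma pot_analytic_on_diff_const:
  assumes "F pot_analytic_on W"
  shows "(\<lambda>\<psi>. F \<psi> - a) pot_analytic_on W"
  unfolding pot_analytic_on_def
proof (intro conjI ballI)
  show "open W" using assms by (simp add: pot_analytic_on_def)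
  fix \<psi> assume "\<psi> \<in> W"
  then obtain F' where F': "(F has_derivative F') (at \<psi>)" "\<forall>c h. F' (pot_mult c h) = c * F' h"
    using assms unfolding pot_analytic_on_def by blast
  have "((\<lambda>\<psi>. F \<psi> - a) has_derivative F') (at \<psi>)"
    using has_derivative_diff[OF F'(1) has_derivative_const[of a]] by simp
  with F'(2) show "\<exists>F'. ((\<lambda>\<psi>. F \<psi> - a) has_derivative F') (at \<psi>) \<and> (\<forall>c h. F' (pot_mult c h) = c *
    F' h)"
    by blast
qed

lemma pot_analytic_on_line:
  assumes F: "F pot_analytic_on W" and W: "\<phi> + pot_mult c h \<in> W"
  shows "\<exists>D. ((\<lambda>c. F (\<phi> + pot_mult c h)) has_field_derivative D) (at c)"
proof -
  obtain F' where F': "(F has_derivative F') (at (\<phi> + pot_mult c h))" "\<And>c h. F' (pot_mult c h) = c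
    * F' h"
    using F W unfolding pot_analytic_on_def by blast
  have "((\<lambda>c. \<phi> + pot_mult c h) has_derivative (\<lambda>c. pot_mult c h)) (at c)"
    by (auto intro!: derivative_eq_intros bounded_linear_imp_has_derivative
      bounded_linear_pot_mult_left)
  from has_derivative_compose[OF this, of F F'] F'(1)
  have "((\<lambda>c. F (\<phi> + pot_mult c h)) has_derivative (\<lambda>c. F' h * c)) (at c)"
    by (simp add: F'(2) mult.commute)
  then show ?thesis unfolding has_field_derivative_def by blast
qed

text \<open>Cauchy's estimate on complex lines turns a bound into a Lipschitz bound on a smaller ball.\<close>

lemma pot_analytic_lipschitz:
  assumes F: "F pot_analytic_on W" and W: "ball 0 (2 * R) \<subseteq> W"
    and C: "\<And>\<psi>. norm \<psi> < 2 * R \<Longrightarrow> cmod (F \<psi>) \<le> C"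
    and \<psi>: "norm \<psi> < R" and \<phi>: "norm \<phi> < R"
  shows "cmod (F \<psi> - F \<phi>) \<le> 2 * C / R * norm (\<psi> - \<phi>)"
proof (cases "\<psi> = \<phi>")
  case False
  define h where "h = \<psi> - \<phi>"
  have h: "norm h > 0" using False by (simp add: h_def)
  have R: "R > 0" using \<psi> norm_ge_zero[of \<psi>] by linarith
  \<comment> \<open>Points of the segment from \<open>\<phi>\<close> to \<open>\<psi>\<close> have
    norm below \<open>R\<close> by convexity, and a complex step of modulus \<open>r\<close> along
    \<open>h\<close> moves them by at most \<open>R / 2\<close>. Cauchy's bound \<open>C / r\<close>
    on the derivative is the Lipschitz constant times \<open>norm h\<close>.\<close>
  define r where "r = R / (2 * norm h)"
  have r: "r > 0" using h R by (simp add: r_def)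
  define g where "g c = F (\<phi> + pot_mult c h)" for c
  have seg: "norm (\<phi> + pot_mult (of_real s) h) < R" if "0 \<le> s" "s \<le> 1" for s
  proof -
    have "\<phi> + pot_mult (of_real s) h = (1 - s) *\<^sub>R \<phi> + s *\<^sub>R \<psi>"
      by (simp add: pot_mult_of_real h_def algebra_simps)
    moreover have "(1 - s) *\<^sub>R \<phi> + s *\<^sub>R \<psi> \<in> ball 0 R"
      using convexD[OF convex_ball[of 0 R], of \<phi> \<psi> "1 - s" s] \<psi> \<phi> that by simp
    ultimately show ?thesis by simp
  qed
  have near: "norm (\<phi> + pot_mult c h) < 2 * R" if "0 \<le> s" "s \<le> 1" "cmod (c - of_real s) \<le> r" for s c
  proof -
    have "\<phi> + pot_mult c h = (\<phi> + pot_mult (of_real s) h) + pot_mult (c - of_real s) h"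
      using pot_mult_add_left[of "of_real s" "c - of_real s" h] by simp
    then have "norm (\<phi> + pot_mult c h) \<le> norm (\<phi> + pot_mult (of_real s) h) + cmod (c - of_real s)
      * norm h"
      by (metis norm_triangle_ineq norm_pot_mult)
    also have "cmod (c - of_real s) * norm h \<le> r * norm h"
      using that h by (intro mult_right_mono) auto
    also have "\<dots> = R / 2" using h by (simp add: r_def)
    finally show ?thesis using seg[OF that(1,2)] R by simp
  qed
  have gd: "\<exists>D. (g has_field_derivative D) (at c)" if "0 \<le> s" "s \<le> 1" "cmod (c - of_real s) \<le> r"
    for s c
    unfolding g_def by (rule pot_analytic_on_line[OF F]) (use near[OF that] W in auto)
  have "cmod (g 1 - g 0) \<le> 2 * C / R * norm h * cmod (1 - 0)"
  proof (rule field_differentiable_bound[of "closed_segment 0 1" g "deriv g"])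
    fix z :: complex assume z: "z \<in> closed_segment 0 1"
    then obtain s where s: "0 \<le> s" "s \<le> 1" "z = of_real s"
      by (auto simp: closed_segment_def scaleR_conv_of_real)
    have gf: "g field_differentiable (at c)" if "cmod (c - of_real s) \<le> r" for c
      using gd[OF s(1,2) that] by (simp add: field_differentiable_def)
    show "(g has_field_derivative deriv g z) (at z within closed_segment 0 1)"
      by (rule has_field_derivative_at_within[OF field_differentiable_derivI[OF gf]])
        (use r s in simp)
    have hol: "g holomorphic_on cball z r"
      unfolding holomorphic_on_def
    proof
      fix c assume "c \<in> cball z r"
      then have "cmod (c - of_real s) \<le> r" using s(3) by (simp add: dist_norm norm_minus_commute)
      from field_differentiable_at_within[OF gf[OF this]]
      show "g field_differentiable (at c within cball z r)" .
    qed
    have "cmod ((deriv ^^ 1) g z) \<le> fact 1 * C / r ^ 1"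
    proof (rule Cauchy_inequality)
      show "g holomorphic_on ball z r" by (rule holomorphic_on_subset[OF hol]) auto
      show "continuous_on (cball z r) g" by (rule holomorphic_on_imp_continuous_on[OF hol])
      show "cmod (g c) \<le> C" if "cmod (z - c) = r" for c
        unfolding g_def using that s by (intro C near[OF s(1,2)]) (simp add: norm_minus_commute)
    qed (rule r)
    then show "cmod (deriv g z) \<le> 2 * C / R * norm h"
      by (simp add: r_def field_simps)
  qed (use ends_in_segment[of 0 "1::complex"] in \<open>simp_all add: convex_closed_segment\<close>)
  moreover have "g 1 = F \<psi>" "g 0 = F \<phi>"
    using pot_mult_of_real[of 1 h] pot_mult_of_real[of 0 h] by (simp_all add: g_def h_def)
  ultimately show ?thesis by (simp add: h_def)
qed simp

lemma chi_D_lipschitz: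
  assumes "cmod \<zeta> \<le> Z" "norm \<psi> < R" "norm \<phi> < R"
  shows "cmod (chi_D \<psi> \<zeta> - chi_D \<phi> \<zeta>) \<le> 2 * sol_bound Z (2 * R) / R * norm (\<psi> - \<phi>)"
  by (rule pot_analytic_lipschitz[OF chi_D_pot_analytic])
    (use assms chi_D_bounded[OF assms(1)] in auto)

lemma chi_D_asymp_near_0:
  obtains C where "C \<ge> 0" "\<And>\<zeta> \<psi>. norm \<psi> < 1 \<Longrightarrow>
    cmod (chi_D \<psi> \<zeta> - sin (2 * \<zeta>\<^sup>2)) \<le> C * norm \<psi> * exp \<bar>Im (2 * \<zeta>\<^sup>2)\<bar>"
proof -
  obtain C where C: "C \<ge> 0" "\<And>\<zeta> \<psi>. norm \<psi> \<le> 2 \<Longrightarrow>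
    cmod (chi_D \<psi> \<zeta> - sin (2 * \<zeta>\<^sup>2)) \<le> C / (1 + cmod \<zeta>) * exp \<bar>Im (2 * \<zeta>\<^sup>2)\<bar>"
    by (rule chi_D_asymp[of 2]) blast
  have "cmod (chi_D \<psi> \<zeta> - sin (2 * \<zeta>\<^sup>2)) \<le> (2 * C) * norm \<psi> * exp \<bar>Im (2 * \<zeta>\<^sup>2)\<bar>"
    if \<psi>: "norm \<psi> < 1" for \<zeta> \<psi>
  proof -
    \<comment> \<open>The function vanishes at the zero potential, so its Lipschitz bound there is a
      bound by \<open>norm \<psi>\<close>. The decay in \<open>\<zeta>\<close> is given up, the
      exponential weight kept.\<close>
    have "cmod ((chi_D \<psi> \<zeta> - sin (2 * \<zeta>\<^sup>2)) - (chi_D 0 \<zeta> - sin (2 * \<zeta>\<^sup>2)))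
        \<le> 2 * (C * exp \<bar>Im (2 * \<zeta>\<^sup>2)\<bar>) / 1 * norm (\<psi> - 0)"
    proof (rule pot_analytic_lipschitz[OF pot_analytic_on_diff_const[OF chi_D_pot_analytic]])
      fix \<phi> :: potential assume "norm \<phi> < 2 * 1"
      then have "cmod (chi_D \<phi> \<zeta> - sin (2 * \<zeta>\<^sup>2)) \<le> C / (1 + cmod \<zeta>) * exp \<bar>Im (2 * \<zeta>\<^sup>2)\<bar>"
        by (intro C) auto
      also have "C / (1 + cmod \<zeta>) \<le> C"
        using C(1) mult_left_mono[of 1 "1 + cmod \<zeta>" C]
          by (subst pos_divide_le_eq) (auto simp: add_pos_nonneg)
      then have "C / (1 + cmod \<zeta>) * exp \<bar>Im (2 * \<zeta>\<^sup>2)\<bar> \<le> C * exp \<bar>Im (2 * \<zeta>\<^sup>2)\<bar>"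
        by (rule mult_right_mono) simp
      finally show "cmod (chi_D \<phi> \<zeta> - sin (2 * \<zeta>\<^sup>2)) \<le> C * exp \<bar>Im (2 * \<zeta>\<^sup>2)\<bar>" .
    qed (use \<psi> in auto)
    then show ?thesis by (simp add: chi_D_0 mult_ac)
  qed
  with that[of "2 * C"] C(1) show ?thesis by simp
qed

text \<open>On a small circle about the zero for \<open>\<psi>0\<close> the function stays away from
  0. For nearby \<open>\<psi>\<close> its modulus at the centre is then smaller than on the circle,
  which forces a zero inside; uniqueness in \<open>D\<close> identifies it with
  \<open>m \<psi>\<close>.\<close>

lemma unique_zero_continuous:
  assumes W: "open W" "\<psi>0 \<in> W" and D: "open D"
    and m: "\<And>\<psi>. \<psi> \<in> W \<Longrightarrow> m \<psi> \<in> D \<and> chi_D \<psi> (m \<psi>) = 0"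
    and uniq: "\<And>\<psi> z. \<psi> \<in> W \<Longrightarrow> z \<in> D \<Longrightarrow> chi_D \<psi> z = 0 \<Longrightarrow> z = m \<psi>"
    and \<epsilon>: "\<epsilon> > 0"
  shows "\<exists>d>0. \<forall>\<psi>. norm (\<psi> - \<psi>0) < d \<longrightarrow> \<psi> \<in> W \<and> cmod (m \<psi> - m \<psi>0) < \<epsilon>"
proof -
  obtain r1 where r1: "r1 > 0" "cball (m \<psi>0) r1 \<subseteq> D"
    using D m[OF W(2)] open_contains_cball_eq by blast
  define r where "r = min r1 (\<epsilon> / 2)"
  have r: "r > 0" "r < \<epsilon>" "cball (m \<psi>0) r \<subseteq> D" using r1 \<epsilon> by (auto simp: r_def)
  have nz: "chi_D \<psi>0 z \<noteq> 0" if "z \<in> sphere (m \<psi>0) r" for z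
    using uniq[OF W(2), of z] r(1,3) that by (auto simp: subset_iff)
  have "continuous_on (sphere (m \<psi>0) r) (\<lambda>z. cmod (chi_D \<psi>0 z))"
    by (intro continuous_intros holomorphic_on_imp_continuous_on chi_D_holomorphic)
  from continuous_attains_inf[OF compact_sphere _ this] r(1)
  obtain z0 where z0: "z0 \<in> sphere (m \<psi>0) r" "\<And>z. z \<in> sphere (m \<psi>0) r \<Longrightarrow> cmod (chi_D \<psi>0 z0) \<le> cmod
    (chi_D \<psi>0 z)"
    by auto
  \<comment> \<open>Half the minimum on the circle: a perturbation below \<open>\<delta>\<close>
    leaves more than \<open>\<delta>\<close> on the circle and less than \<open>\<delta>\<close> at
    the centre.\<close>
  define \<delta> where "\<delta> = cmod (chi_D \<psi>0 z0) / 2"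
  have \<delta>: "\<delta> > 0" using nz[OF z0(1)] by (simp add: \<delta>_def)
  define R where "R = norm \<psi>0 + 1"
  define K where "K = 2 * sol_bound (cmod (m \<psi>0) + r) (2 * R) / R"
  have R: "R > 0" by (simp add: R_def add_nonneg_pos)
  have K: "K \<ge> 0" using R by (simp add: K_def sol_bound_def)
  obtain d1 where d1: "d1 > 0" "ball \<psi>0 d1 \<subseteq> W" using W open_contains_ball by blast
  define d where "d = min d1 (min 1 (\<delta> / (K + 1)))"
  have d: "d > 0" using d1 \<delta> K by (simp add: d_def)
  have "\<psi> \<in> W \<and> cmod (m \<psi> - m \<psi>0) < \<epsilon>" if \<psi>: "norm (\<psi> - \<psi>0) < d" for \<psi>
  proof -
    have \<psi>W: "\<psi> \<in> W" using \<psi> d1 by (auto simp: d_def dist_norm norm_minus_commute subset_iff)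
    have R\<psi>: "norm \<psi> < R" using norm_triangle_ineq[of "\<psi> - \<psi>0" \<psi>0] \<psi> by (simp add: R_def d_def)
    have close: "cmod (chi_D \<psi> z - chi_D \<psi>0 z) < \<delta>" if "z \<in> cball (m \<psi>0) r" for z
    proof -
      have "cmod z \<le> cmod (m \<psi>0) + r"
        using that norm_triangle_ineq[of "m \<psi>0" "z - m \<psi>0"]
          by (auto simp: dist_norm norm_minus_commute)
      from chi_D_lipschitz[OF this R\<psi>, of \<psi>0] have "cmod (chi_D \<psi> z - chi_D \<psi>0 z) \<le> K * norm (\<psi> -
        \<psi>0)"
        by (simp add: K_def R_def)
      also have "\<dots> \<le> (K + 1) * norm (\<psi> - \<psi>0)" by (simp add: mult_right_mono)
      also have "\<dots> < (K + 1) * (\<delta> / (K + 1))" using \<psi> K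
        by (intro mult_strict_left_mono) (auto simp: d_def)
      also have "\<dots> = \<delta>" using K by simp
      finally show ?thesis .
    qed
    obtain z where z: "z \<in> ball (m \<psi>0) r" "chi_D \<psi> z = 0"
    proof (rule holomorphic_contract_to_zero[of "m \<psi>0" r "chi_D \<psi>"])
      fix z assume z: "cmod (m \<psi>0 - z) = r"
      have "cmod (chi_D \<psi> (m \<psi>0)) < \<delta>" using close[of "m \<psi>0"] m[OF W(2)] r by simp
      moreover have "2 * \<delta> \<le> cmod (chi_D \<psi>0 z)" using z0(2)[of z] z by (simp add: \<delta>_def dist_norm)
      moreover have "cmod (chi_D \<psi> z - chi_D \<psi>0 z) < \<delta>" using close[of z] z by (simp add: dist_norm)
      ultimately show "cmod (chi_D \<psi> (m \<psi>0)) < cmod (chi_D \<psi> z)"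
        using norm_triangle_ineq2[of "chi_D \<psi>0 z" "chi_D \<psi> z"] by (simp add: norm_minus_commute)
    qed (use r in \<open>simp_all add: holomorphic_on_imp_continuous_on chi_D_holomorphic\<close>)
    have "z = m \<psi>" using uniq[OF \<psi>W _ z(2)] z(1) r(3) by (auto simp: subset_iff)
    then show ?thesis using z(1) r(2) \<psi>W by (auto simp: dist_norm norm_minus_commute)
  qed
  with d show ?thesis by blast
qed

text \<open>Absorption step: half of \<open>z\<close> moves to the left. It is used with
  \<open>z\<close> and \<open>n\<close> the moduli of the increments of the zero and of the
  potential, \<open>x\<close> the error of the linear approximation and \<open>y\<close> the linear
  part.\<close>

lemma absorb_half_sum:
  fixes x y z n K :: real
  assumes "x \<le> 1 / 2 * (z + n)" "z \<le> x + y" "y \<le> n * K"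
  shows "z + n \<le> (2 * K + 2) * n"
proof -
  have "(2 * K + 2) * n = 2 * (n * K) + 2 * n" by (simp add: algebra_simps)
  moreover have "z + n \<le> 2 * (n * K) + 2 * n" using assms by simp
  ultimately show ?thesis by simp
qed

text \<open>Implicit differentiation. The derivative of \<open>m\<close> must be \<open>M\<close>,
  the solution of \<open>L (z, \<eta>) = 0\<close> for \<open>z\<close>, which needs
  \<open>A \<noteq> 0\<close>. Continuity of \<open>m\<close> is known beforehand, so
  differentiability of \<open>chi_D\<close> at the single point \<open>(m0, \<psi>0)\<close> is
  enough.\<close>

lemma simple_zero_pot_analytic:
  assumes W: "open W" and D: "open D"
    and m: "\<And>\<psi>. \<psi> \<in> W \<Longrightarrow> m \<psi> \<in> D \<and> chi_D \<psi> (m \<psi>) = 0"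
    and uniq: "\<And>\<psi> z. \<psi> \<in> W \<Longrightarrow> z \<in> D \<Longrightarrow> chi_D \<psi> z = 0 \<Longrightarrow> z = m \<psi>"
    and simple: "\<And>\<psi>. \<psi> \<in> W \<Longrightarrow> deriv (chi_D \<psi>) (m \<psi>) \<noteq> 0"
  shows "m pot_analytic_on W"
  unfolding pot_analytic_on_def
proof (intro conjI ballI W)
  fix \<psi>0 assume \<psi>0: "\<psi>0 \<in> W"
  define m0 where "m0 = m \<psi>0"
  obtain L where L: "((\<lambda>x. chi_D (snd x) (fst x)) has_derivative L) (at (m0, \<psi>0))"
    "\<And>c z \<eta>. L (c * z, pot_mult c \<eta>) = c * L (z, \<eta>)"
    using chi_D_frechet[of m0 \<psi>0] by blast
  have BL: "bounded_linear L" using L(1) by (rule has_derivative_bounded_linear)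
  define A where "A = L (1, 0)"
  have LA: "L (z, 0) = z * A" for z
    using L(2)[of z 1 0] by (simp add: pot_mult_0 A_def)
  have "((\<lambda>\<zeta>. (\<zeta>, \<psi>0)) has_derivative (\<lambda>z. (z, 0))) (at m0)"
    by (auto intro!: derivative_eq_intros)
  from has_derivative_compose[OF this, of "\<lambda>x. chi_D (snd x) (fst x)" L] L(1)
  have "(chi_D \<psi>0 has_derivative (\<lambda>z. A * z)) (at m0)" by (simp add: LA mult.commute)
  then have "(chi_D \<psi>0 has_field_derivative A) (at m0)" by (simp add: has_field_derivative_def)
  then have A0: "A \<noteq> 0" using simple[OF \<psi>0] DERIV_imp_deriv by (auto simp: m0_def)
  define M where "M \<eta> = - (L (0, \<eta>) / A)" for \<eta>
  have Ldecomp: "L (z, \<eta>) = A * (z - M \<eta>)" for z \<eta>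
    using bounded_linear.linear[OF BL] linear_add[of L "(z, 0)" "(0, \<eta>)"] A0
    by (simp add: LA M_def field_simps)
  have BM: "bounded_linear M"
  proof -
    have "bounded_linear (\<lambda>\<eta>. L (0, \<eta>))"
      by (rule bounded_linear_compose[OF BL]) (intro bounded_linear_Pair bounded_linear_zero
        bounded_linear_ident)
    then have "bounded_linear (\<lambda>\<eta>. (- 1 / A) * L (0, \<eta>))"
      by (rule bounded_linear_compose[OF bounded_linear_mult_right])
    then show ?thesis by (simp add: M_def[abs_def])
  qed
  obtain K where K: "K > 0" "\<And>\<eta>. cmod (M \<eta>) \<le> norm \<eta> * K"
    using bounded_linear.pos_bounded[OF BM] by blast
  have "(m has_derivative M) (at \<psi>0)"
    unfolding has_derivative_at_alt
  proof (intro conjI BM allI impI)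
    fix e :: real assume e: "e > 0"
    \<comment> \<open>The bound 1/2 permits absorbing the increment of the zero; the other bound
      makes the resulting error at most \<open>e\<close>.\<close>
    define e' where "e' = min (1 / 2) (e / (2 * K + 2))"
    have K2: "2 * K + 2 > 0" using K(1) by simp
    have "e' \<le> e / (2 * K + 2)" by (simp add: e'_def)
    then have "e' * (2 * K + 2) \<le> e" using K2 by (simp add: pos_le_divide_eq)
    moreover have "e' \<le> 1 / 2" unfolding e'_def by (rule min.cobounded1)
    moreover have "e' > 0" using e K2 unfolding e'_def by simp
    ultimately have e': "e' > 0" "e' \<le> 1 / 2" "e' * (2 * K + 2) \<le> e" by blast+
    have "cmod A * e' > 0" using A0 e' by simp
    from conjunct2[OF L(1)[unfolded has_derivative_at_alt], rule_format, OF this]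
    obtain d1 where d1: "d1 > 0" "\<And>y. norm (y - (m0, \<psi>0)) < d1 \<Longrightarrow>
        cmod (chi_D (snd y) (fst y) - chi_D (snd (m0, \<psi>0)) (fst (m0, \<psi>0)) - L (y - (m0, \<psi>0)))
          \<le> (cmod A * e') * norm (y - (m0, \<psi>0))"
      by blast
    have "\<exists>d>0. \<forall>\<psi>. norm (\<psi> - \<psi>0) < d \<longrightarrow> \<psi> \<in> W \<and> cmod (m \<psi> - m \<psi>0) < d1 / 2"
      by (rule unique_zero_continuous[OF W \<psi>0 D m uniq]) (use d1(1) in simp_all)
    then obtain d2 where d2: "d2 > 0" "\<And>\<psi>. norm (\<psi> - \<psi>0) < d2 \<Longrightarrow> \<psi> \<in> W \<and> cmod (m \<psi> - m \<psi>0) < d1 / 2"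
      by blast
    have "cmod (m \<psi> - m \<psi>0 - M (\<psi> - \<psi>0)) \<le> e * norm (\<psi> - \<psi>0)" if \<psi>: "norm (\<psi> - \<psi>0) < min d2 (d1 /
      2)" for \<psi>
    proof -
      define z \<eta> where "z = m \<psi> - m0" and "\<eta> = \<psi> - \<psi>0"
      have \<psi>W: "\<psi> \<in> W" and zs: "cmod z < d1 / 2" using d2(2)[of \<psi>] \<psi> by (auto simp: z_def m0_def)
      have nz\<eta>: "norm (z, \<eta>) \<le> cmod z + norm \<eta>" by (rule norm_Pair_le)
      also have "\<dots> < d1" using zs \<psi> by (simp add: \<eta>_def)
      finally have "norm ((m \<psi>, \<psi>) - (m0, \<psi>0)) < d1" by (simp add: z_def \<eta>_def)
      from d1(2)[OF this] have "cmod (L (z, \<eta>)) \<le> (cmod A * e') * norm (z, \<eta>)"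
        using m[OF \<psi>W] m[OF \<psi>0] by (simp add: z_def \<eta>_def m0_def)
      also have "\<dots> \<le> (cmod A * e') * (cmod z + norm \<eta>)"
        using e' nz\<eta> by (intro mult_left_mono) auto
      finally have "cmod A * cmod (z - M \<eta>) \<le> cmod A * (e' * (cmod z + norm \<eta>))"
        unfolding Ldecomp by (simp add: norm_mult mult.assoc)
      then have *: "cmod (z - M \<eta>) \<le> e' * (cmod z + norm \<eta>)" using A0 by simp
      have "e' * (cmod z + norm \<eta>) \<le> 1 / 2 * (cmod z + norm \<eta>)" using e'
        by (intro mult_right_mono) auto
      with * have "cmod (z - M \<eta>) \<le> 1 / 2 * (cmod z + norm \<eta>)" by (rule order.trans)
      moreover have "cmod z \<le> cmod (z - M \<eta>) + cmod (M \<eta>)"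
        using norm_triangle_ineq[of "z - M \<eta>" "M \<eta>"] by simp
      ultimately have "cmod z + norm \<eta> \<le> (2 * K + 2) * norm \<eta>" using K(2)[of \<eta>]
        by (rule absorb_half_sum)
      then have "e' * (cmod z + norm \<eta>) \<le> e' * ((2 * K + 2) * norm \<eta>)" using e'
        by (intro mult_left_mono) auto
      also have "\<dots> \<le> e * norm \<eta>" using mult_right_mono[OF e'(3), of "norm \<eta>"]
        by (simp add: mult.assoc)
      finally have "cmod (z - M \<eta>) \<le> e * norm \<eta>" using * by linarith
      then show ?thesis by (simp only: z_def \<eta>_def m0_def)
    qed
    then show "\<exists>d>0. \<forall>y. norm (y - \<psi>0) < d \<longrightarrow> cmod (m y - m \<psi>0 - M (y - \<psi>0)) \<le> e * norm (y - \<psi>0)"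
      using d1(1) d2(1) by (intro exI[of _ "min d2 (d1 / 2)"] conjI allI impI) simp_all
  qed
  moreover have "M (pot_mult c h) = c * M h" for c h
    using L(2)[of c 0 h] by (simp add: M_def)
  ultimately show "\<exists>F'. (m has_derivative F') (at \<psi>0) \<and> (\<forall>c h. F' (pot_mult c h) = c * F' h)"
    by blast
qed

section \<open>Counting zeros\<close>

text \<open>Strict domination on the circle keeps both functions nonzero there. Winding numbers are
  1 inside and 0 outside, so Rouche's theorem becomes an equality of sums of orders over the open
  ball.\<close>

lemma rouche_ball:
  fixes f h :: "complex \<Rightarrow> complex"
  assumes S: "open S" "connected S" "cball c r \<subseteq> S" and r: "r > 0"
    and hol: "f holomorphic_on S" "h holomorphic_on S"
    and less: "\<And>z. cmod (z - c) = r \<Longrightarrow> cmod (h z - f z) < cmod (f z)"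
  shows "finite {z \<in> ball c r. f z = 0}" "finite {z \<in> ball c r. h z = 0}"
    "(\<Sum>z | z \<in> ball c r \<and> h z = 0. zorder h z) = (\<Sum>z | z \<in> ball c r \<and> f z = 0. zorder f z)"
    "\<And>z. z \<in> ball c r \<Longrightarrow> h z = 0 \<Longrightarrow> zorder h z > 0"
proof -
  obtain e where e: "e > 0" "{x. infdist x (cball c r) \<le> e} \<subseteq> S" and
    ce: "compact (cball c (r + e))"
    using compact_in_open_separated[of "cball c r" S] S r by auto
  \<comment> \<open>\<open>S\<close> may contain infinitely many zeros, whereas Rouche's theorem is
    applied on a set with finitely many. A slightly larger ball with closure in \<open>S\<close>
    serves; \<open>y\<close> is the radial projection of \<open>x\<close> to the circle.\<close>
  have sub: "cball c (r + e) \<subseteq> S"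
  proof
    fix x assume "x \<in> cball c (r + e)"
    then have "dist x c \<le> r + e" by (simp add: dist_commute)
    have "infdist x (cball c r) \<le> e"
    proof (cases "dist c x \<le> r")
      case True
      then show ?thesis using e(1) by (simp add: infdist_zero)
    next
      case False
      define y where "y = c + (r / dist c x) *\<^sub>R (x - c)"
      have "dist c x > 0" using False r by linarith
      have "y \<in> cball c r" using r \<open>dist c x > 0\<close> by (simp add: y_def dist_norm norm_minus_commute)
      moreover have "dist x y = dist c x - r"
      proof -
        have "x - y = (1 - r / dist c x) *\<^sub>R (x - c)" by (simp add: y_def algebra_simps)
        then have "dist x y = \<bar>1 - r / dist c x\<bar> * dist c x"
          by (simp add: dist_norm norm_minus_commute)
        also have "\<dots> = dist c x - r" using False r \<open>dist c x > 0\<close> by (simp add: field_simps)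
        finally show ?thesis .
      qed
      ultimately show ?thesis
        using infdist_le[of y "cball c r" x] \<open>dist x c \<le> r + e\<close> by (simp add: dist_commute)
    qed
    then show "x \<in> S" using e(2) by auto
  qed
  define s where "s = ball c (r + e)"
  have s: "open s" "connected s" "s \<subseteq> S" "cball c r \<subseteq> s"
    using sub e(1) by (auto simp: s_def convex_connected)
  \<comment> \<open>A point of the circle, where neither function vanishes; it excludes identically
    vanishing functions.\<close>
  define p where "p = c + of_real r"
  have p: "cmod (p - c) = r" "p \<in> cball c r" using r by (auto simp: p_def dist_norm)
  have p0: "f p \<noteq> 0" "h p \<noteq> 0" using less[OF p(1)] by auto
  have fin: "finite {z \<in> cball c (r + e). k z = 0}" if "k holomorphic_on S" "k p \<noteq> 0" for k
  proof (cases "k constant_on S")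
    case True
    then have "\<And>z. z \<in> S \<Longrightarrow> k z \<noteq> 0" using that p(2) S(3) unfolding constant_on_def
      by (metis subsetD)
    then have "{z \<in> cball c (r + e). k z = 0} = {}" using sub by blast
    then show ?thesis by (simp only: finite.emptyI)
  next
    case False
    show ?thesis by (rule holomorphic_compact_finite_zeros[OF that(1) S(1,2) ce sub False])
  qed
  have fins: "finite {z \<in> s. k z = 0}" if "k holomorphic_on S" "k p \<noteq> 0" for k
    by (rule finite_subset[OF _ fin[OF that]]) (auto simp: s_def)
  have finb: "finite {z \<in> ball c r. k z = 0}" if "k holomorphic_on S" "k p \<noteq> 0" for k
    by (rule finite_subset[OF _ fins[OF that]]) (use s in auto)
  show "finite {z \<in> ball c r. f z = 0}" "finite {z \<in> ball c r. h z = 0}"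
    by (rule finb[OF hol(1) p0(1)] finb[OF hol(2) p0(2)])+
  have wind: "(\<Sum>z | z \<in> s \<and> k z = 0. winding_number (circlepath c r) z * of_int (zorder k z)) =
      of_int (\<Sum>z | z \<in> ball c r \<and> k z = 0. zorder k z)"
    if k: "k holomorphic_on S" "k p \<noteq> 0" "\<And>z. cmod (z - c) = r \<Longrightarrow> k z \<noteq> 0" for k
  proof -
    have "(\<Sum>z | z \<in> s \<and> k z = 0. winding_number (circlepath c r) z * of_int (zorder k z)) =
       (\<Sum>z | z \<in> ball c r \<and> k z = 0. winding_number (circlepath c r) z * of_int (zorder k z))"
    proof (rule sum.mono_neutral_right)
      show "finite {z. z \<in> s \<and> k z = 0}" using fins[OF k(1,2)] by simp
      show "{z. z \<in> ball c r \<and> k z = 0} \<subseteq> {z. z \<in> s \<and> k z = 0}" using s(4) by auto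
      show "\<forall>z\<in>{z. z \<in> s \<and> k z = 0} - {z. z \<in> ball c r \<and> k z = 0}.
          winding_number (circlepath c r) z * of_int (zorder k z) = 0"
      proof
        fix z assume "z \<in> {z. z \<in> s \<and> k z = 0} - {z. z \<in> ball c r \<and> k z = 0}"
        then have "z \<notin> ball c r" "k z = 0" by auto
        then have "z \<notin> cball c r" using k(3)[of z] by (auto simp: dist_norm norm_minus_commute)
        then have "winding_number (circlepath c r) z = 0"
          using r by (intro winding_number_zero_outside[of _ "cball c r"]) (auto simp:
            path_image_circlepath)
        then show "winding_number (circlepath c r) z * of_int (zorder k z) = 0" by simp
      qed
    qed
    also have "\<dots> = (\<Sum>z | z \<in> ball c r \<and> k z = 0. of_int (zorder k z))"
      by (intro sum.cong refl) (auto simp: winding_number_circlepath dist_norm norm_minus_commute)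
    finally show ?thesis by simp
  qed
  have "(\<Sum>z\<in>{z \<in> s. f z + (h z - f z) = 0}. winding_number (circlepath c r) z * of_int (zorder
    (\<lambda>z. f z + (h z - f z)) z))
     = (\<Sum>z\<in>{z \<in> s. f z = 0}. winding_number (circlepath c r) z * of_int (zorder f z))"
  proof (rule Rouche_theorem[OF s(1,2)])
    show "finite {z \<in> s. f z + (h z - f z) = 0}" using fins[OF hol(2) p0(2)] by simp
    show "finite {z \<in> s. f z = 0}" by (rule fins[OF hol(1) p0(1)])
    show "f holomorphic_on s" "(\<lambda>z. h z - f z) holomorphic_on s"
      using hol s(3) by (auto intro!: holomorphic_on_diff intro: holomorphic_on_subset)
    show "path_image (circlepath c r) \<subseteq> s" using s(4) r by (auto simp: path_image_circlepath)
    show "\<forall>z\<in>path_image (circlepath c r). cmod (h z - f z) < cmod (f z)"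
      using less r by (auto simp: path_image_circlepath dist_norm norm_minus_commute)
    show "\<forall>z. z \<notin> s \<longrightarrow> winding_number (circlepath c r) z = 0"
      using r s(4) by (intro allI impI winding_number_zero_outside[of _ "cball c r"]) (auto simp:
        path_image_circlepath)
  qed auto
  then have "(of_int (\<Sum>z | z \<in> ball c r \<and> h z = 0. zorder h z) :: complex) = of_int (\<Sum>z | z \<in> ball
    c r \<and> f z = 0. zorder f z)"
    using wind[OF hol(2) p0(2)] wind[OF hol(1) p0(1)] less by force
  then show "(\<Sum>z | z \<in> ball c r \<and> h z = 0. zorder h z) = (\<Sum>z | z \<in> ball c r \<and> f z = 0. zorder f z)"
    by (simp only: of_int_eq_iff)
  show "zorder h z > 0" if "z \<in> ball c r" "h z = 0" for z
  proof -
    have "z \<in> S" "p \<in> S" using that(1) p(2) S(3) by auto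
    then show ?thesis using zorder_exist_zero[OF hol(2) S(1,2), of z] that(2) p0(2) by auto
  qed
qed

lemma zorder_eq_1_iff_deriv:
  assumes f: "f holomorphic_on S" "open S" "connected S" "z \<in> S" "f z = 0"
    and nc: "\<exists>w\<in>S. f w \<noteq> 0"
  shows "zorder f z = 1 \<longleftrightarrow> deriv f z \<noteq> 0"
proof
  assume "deriv f z \<noteq> 0"
  then show "zorder f z = 1"
    using zorder_zero_eqI[OF f(1,2,4), of 1] f(5) by simp
next
  assume 1: "zorder f z = 1"
  from zorder_exist_zero[OF f(1-4) nc] obtain r where r: "r > 0" "zor_poly f z holomorphic_on
    cball z r"
    "\<And>w. w \<in> cball z r \<Longrightarrow> f w = zor_poly f z w * (w - z) ^ nat (zorder f z) \<and> zor_poly f z w \<noteq> 0"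
    by blast
  define g where "g = zor_poly f z"
  have g: "g holomorphic_on ball z r" "\<And>w. w \<in> ball z r \<Longrightarrow> f w = g w * (w - z)" "g z \<noteq> 0"
    using r(2) r(3) r(1) 1 by (auto simp: g_def intro: holomorphic_on_subset)
  have "(g has_field_derivative deriv g z) (at z)"
    using g(1) r(1) by (intro holomorphic_derivI) auto
  then have "((\<lambda>w. g w * (w - z)) has_field_derivative g z) (at z)"
    by (auto intro!: derivative_eq_intros)
  then have "(f has_field_derivative g z) (at z)"
    by (rule has_field_derivative_transform_within_open[of _ _ _ "ball z r"])
      (use g(2) r(1) in auto)
  from DERIV_imp_deriv[OF this] show "deriv f z \<noteq> 0" using g(3) by simp
qed

section \<open>Distances to the multiples of pi and lower bounds for the sine\<close>

lemma pi_multiples_separated: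
  fixes m k :: int
  assumes "m \<noteq> k"
  shows "pi \<le> cmod (z - of_int m * of_real pi) + cmod (z - of_int k * of_real pi)"
proof -
  have "1 \<le> \<bar>m - k\<bar>" using assms by linarith
  then have "1 \<le> \<bar>real_of_int (m - k)\<bar>" by linarith
  then have "pi \<le> \<bar>real_of_int (m - k)\<bar> * pi" by simp
  also have "\<dots> = cmod (of_real (real_of_int (m - k) * pi))"
    by (simp only: norm_of_real abs_mult) simp
  also have "complex_of_real (real_of_int (m - k) * pi) = (z - of_int k * of_real pi) - (z -
    of_int m * of_real pi)"
    by (simp add: algebra_simps)
  also have "cmod \<dots> \<le> cmod (z - of_int k * of_real pi) + cmod (z - of_int m * of_real pi)"
    by (rule norm_triangle_ineq4)
  finally show ?thesis by simp
qed

text \<open>The familiar sum of the squares of sinh (Im z) and sin (Re z), with sinh written at the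
  absolute value so that it is visibly nonnegative.\<close>

lemma norm_sin_squared': "(cmod (sin z))\<^sup>2 = ((exp \<bar>Im z\<bar> - exp (- \<bar>Im z\<bar>)) / 2)\<^sup>2 + (sin (Re z))\<^sup>2"
proof -
  have e: "exp (2 * y) + inverse (exp (2 * y)) = (exp \<bar>y\<bar> - exp (- \<bar>y\<bar>))\<^sup>2 + 2" for y :: real
  proof -
    have "exp (2 * y) + inverse (exp (2 * y)) = exp (2 * \<bar>y\<bar>) + exp (2 * (- \<bar>y\<bar>))"
      by (cases "y \<ge> 0") (simp_all add: exp_minus)
    also have "\<dots> = (exp \<bar>y\<bar>)\<^sup>2 + (exp (- \<bar>y\<bar>))\<^sup>2" by (simp only: exp_double)
    also have "\<dots> = (exp \<bar>y\<bar> - exp (- \<bar>y\<bar>))\<^sup>2 + 2 * (exp \<bar>y\<bar> * exp (- \<bar>y\<bar>))"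
      by (simp add: power2_diff)
    also have "exp \<bar>y\<bar> * exp (- \<bar>y\<bar>) = 1" by (simp flip: exp_add)
    finally show ?thesis by simp
  qed
  show ?thesis
    unfolding norm_sin_squared e cos_double_sin by (simp add: power_divide field_simps)
qed

text \<open>The real and imaginary parts are compared separately: \<open>\<bar>sin x\<bar>\<close>
  is at least half of \<open>\<bar>x\<bar>\<close> by Taylor's formula, as
  \<open>\<bar>x\<bar> \<le> 1\<close>, and sinh dominates in the imaginary direction.\<close>

lemma norm_sin_ge_half:
  assumes "cmod z \<le> pi / 4"
  shows "cmod z / 2 \<le> cmod (sin z)"
proof -
  define x y where "x = Re z" and "y = Im z"
  have x: "\<bar>x\<bar> \<le> 1" using abs_Re_le_cmod[of z] assms pi_less_4 by (simp add: x_def)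
  have "cmod (sin (of_real x) - (\<Sum>k\<le>2. complex_of_real (sin_coeff k) * of_real x ^ k)) \<le> exp \<bar>Im
    (of_real x)\<bar> * cmod (of_real x) ^ Suc 2 / fact 2"
    by (rule Taylor_sin)
  moreover have "(\<Sum>k\<le>2. complex_of_real (sin_coeff k) * of_real x ^ k) = of_real x"
    by (simp add: sin_coeff_def numeral_2_eq_2)
  ultimately have "cmod (of_real (sin x - x)) \<le> \<bar>x\<bar> ^ 3 / 2"
    by (simp add: sin_of_real numeral_3_eq_3)
  then have "\<bar>sin x - x\<bar> \<le> \<bar>x\<bar> ^ 3 / 2" unfolding norm_of_real .
  also have "\<dots> \<le> \<bar>x\<bar> / 2"
    using x mult_mono[of "\<bar>x\<bar>" 1 "\<bar>x\<bar>" 1] mult_right_mono[of "\<bar>x\<bar> * \<bar>x\<bar>" 1 "\<bar>x\<bar>"]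
      by (simp add: power3_eq_cube)
  finally have sx: "\<bar>x\<bar> / 2 \<le> \<bar>sin x\<bar>" by linarith
  have sy: "\<bar>y\<bar> / 2 \<le> (exp \<bar>y\<bar> - exp (- \<bar>y\<bar>)) / 2"
  proof -
    define a where "a = \<bar>y\<bar>"
    have "exp (- a) \<le> 1" by (simp add: a_def)
    then have "a \<le> exp a - exp (- a)" using exp_ge_add_one_self[of a] by linarith
    then show ?thesis by (simp add: a_def)
  qed
  have "(cmod z / 2)\<^sup>2 = (\<bar>x\<bar> / 2)\<^sup>2 + (\<bar>y\<bar> / 2)\<^sup>2"
    by (simp add: cmod_power2 x_def y_def power_divide add_divide_distrib)
  also have "\<dots> \<le> \<bar>sin x\<bar>\<^sup>2 + ((exp \<bar>y\<bar> - exp (- \<bar>y\<bar>)) / 2)\<^sup>2"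
    by (intro add_mono power_mono sx sy) auto
  also have "\<dots> = (cmod (sin z))\<^sup>2" by (simp add: norm_sin_squared' x_def y_def)
  finally show ?thesis by (rule power2_le_imp_le) simp
qed

text \<open>Far from the real axis sinh already has the size of the exponential. Near it, the
  distance to the zeros must come from the real part: pi^2/16 - 1/4 >= pi^2/36 puts
  \<open>Re z\<close> at least pi/6 from every multiple of pi, so the sine is at least 1/2 while the
  exponential is at most 3. The constant 1/8 is the threshold in
  \<open>sin_dominated\<close>.\<close>

lemma norm_sin_ge_exp:
  assumes far: "\<And>m::int. pi / 4 \<le> cmod (z - of_int m * of_real pi)"
  shows "exp \<bar>Im z\<bar> / 8 \<le> cmod (sin z)"
proof (cases "\<bar>Im z\<bar> \<ge> 1 / 2")
  case True
  define y where "y = \<bar>Im z\<bar>"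
  have "2 \<le> exp (2 * y)" using exp_ge_add_one_self[of "2 * y"] True unfolding y_def by linarith
  then have "exp (- y) * 2 \<le> exp (- y) * exp (2 * y)" by (rule mult_left_mono) simp
  also have "exp (- y) * exp (2 * y) = exp y" by (simp flip: exp_add)
  finally have "4 * exp (- y) \<le> 3 * exp y" using exp_gt_zero[of y] by linarith
  then have "exp y / 8 \<le> (exp y - exp (- y)) / 2" by simp
  then have "(exp y / 8)\<^sup>2 \<le> ((exp y - exp (- y)) / 2)\<^sup>2" by (rule power_mono) simp
  also have "\<dots> \<le> (cmod (sin z))\<^sup>2" unfolding norm_sin_squared' y_def by simp
  finally show ?thesis unfolding y_def by (rule power2_le_imp_le) simp
next
  case False
  define m where "m = round (Re z / pi)"
  define x where "x = Re z - of_int m * pi"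
  have "\<bar>Re z / pi - of_int m\<bar> \<le> 1 / 2" unfolding m_def using of_int_round_abs_le[of "Re z / pi"]
    by (simp add: abs_minus_commute)
  then have "\<bar>Re z / pi - of_int m\<bar> * pi \<le> 1 / 2 * pi" by (rule mult_right_mono) simp
  moreover have "\<bar>Re z / pi - of_int m\<bar> * pi = \<bar>x\<bar>"
    using abs_mult[of "Re z / pi - of_int m" pi] by (simp add: x_def left_diff_distrib)
  ultimately have x2: "\<bar>x\<bar> \<le> pi / 2" by simp
  have "(pi / 4)\<^sup>2 \<le> (cmod (z - of_int m * of_real pi))\<^sup>2" by (rule power_mono[OF far]) simp
  also have "\<dots> = \<bar>x\<bar>\<^sup>2 + \<bar>Im z\<bar>\<^sup>2" by (simp add: cmod_power2 x_def)
  also have "\<bar>Im z\<bar>\<^sup>2 \<le> (1 / 2)\<^sup>2" using False by (intro power_mono) auto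
  finally have "(pi / 4)\<^sup>2 \<le> \<bar>x\<bar>\<^sup>2 + (1 / 2)\<^sup>2" by simp
  moreover have "(3::real)\<^sup>2 \<le> pi\<^sup>2" using pi_gt3 by (intro power_mono) auto
  ultimately have "(pi / 6)\<^sup>2 \<le> \<bar>x\<bar>\<^sup>2" by (simp add: power_divide)
  then have x6: "pi / 6 \<le> \<bar>x\<bar>" by (rule power2_le_imp_le) simp
  have "sin (pi / 6) \<le> sin \<bar>x\<bar>" by (rule sin_monotone_2pi_le) (use x2 x6 pi_gt_zero in linarith)+
  then have "1 / 2 \<le> sin \<bar>x\<bar>" by (simp add: sin_30)
  then have "(1 / 2)\<^sup>2 \<le> (sin \<bar>x\<bar>)\<^sup>2" by (rule power_mono) simp
  also have "(sin \<bar>x\<bar>)\<^sup>2 = (sin x)\<^sup>2" by (simp add: abs_if)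
  also have "(sin x)\<^sup>2 = (sin (Re z))\<^sup>2"
  proof -
    have "cos (2 * x) = cos (2 * Re z - 2 * pi * of_int m)" by (simp add: x_def algebra_simps)
    also have "\<dots> = cos (2 * Re z)"
      using cos_diff[of "2 * Re z" "2 * pi * of_int m"] by (simp add: cos_int_2pin sin_int_2pin)
    finally show ?thesis unfolding cos_double_sin by simp
  qed
  also have "\<dots> \<le> (cmod (sin z))\<^sup>2" unfolding norm_sin_squared' by simp
  finally have "1 / 2 \<le> cmod (sin z)" by (rule power2_le_imp_le) simp
  moreover have "exp \<bar>Im z\<bar> \<le> 3"
    using exp_le exp_le_cancel_iff[of "\<bar>Im z\<bar>" 1] False by linarith
  ultimately show ?thesis by simp
qed

text \<open>In the variable \<open>z = 2 w\<^sup>2\<close> the discs become round.\<close>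

definition right_disc :: "nat \<Rightarrow> complex set" where
  "right_disc k = {w. Re w > 0 \<and> cmod (2 * w\<^sup>2 - of_nat k * of_real pi) < pi / 4}"

text \<open>The principal square root maps the ball of radius pi/4 about k pi onto
  \<open>right_disc k\<close>. In that ball the sine has a single simple zero, and Rouche's theorem
  carries this over to \<open>f\<close>, then to \<open>F\<close> through the root.\<close>

lemma right_disc_unique_zero:
  assumes k: "k \<ge> 1" and F: "F holomorphic_on UNIV"
    and less: "\<And>w. cmod (2 * w\<^sup>2 - of_nat k * of_real pi) = pi / 4 \<Longrightarrow>
      cmod (F w - sin (2 * w\<^sup>2)) < exp \<bar>Im (2 * w\<^sup>2)\<bar> / 8"
  shows "\<exists>w. {w \<in> right_disc k. F w = 0} = {w} \<and> deriv F w \<noteq> 0"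
proof -
  define S where "S = {z. Re z > 0}"
  define c :: complex where "c = of_nat k * of_real pi"
  define f where "f z = F (csqrt (z / 2))" for z
  have S: "open S" "connected S"
    unfolding S_def by (auto intro: open_halfspace_Re_gt convex_connected convex_halfspace_Re_gt)
  have rc: "Re c = real k * pi" "Im c = 0" by (simp_all add: c_def)
  have kpi: "pi \<le> real k * pi" using k by simp
  have S3: "cball c (pi / 4) \<subseteq> S"
  proof
    fix z assume "z \<in> cball c (pi / 4)"
    then have "\<bar>Re z - Re c\<bar> \<le> pi / 4"
      using abs_Re_le_cmod[of "z - c"] by (simp add: dist_norm norm_minus_commute)
    then show "z \<in> S" unfolding S_def mem_Collect_eq rc using kpi pi_gt_zero by linarith
  qed
  have cs: "(\<lambda>z. csqrt (z / 2)) holomorphic_on S"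
    unfolding S_def by (intro holomorphic_intros) (auto simp: complex_nonpos_Reals_iff)
  have fhol: "f holomorphic_on S"
    unfolding f_def using holomorphic_on_compose_gen[OF cs F] by (simp add: o_def)
  have shol: "sin holomorphic_on S" by (intro holomorphic_intros)
  have lt: "cmod (f z - sin z) < cmod (sin z)" if z: "cmod (z - c) = pi / 4" for z
  proof -
    \<comment> \<open>On the circle about k pi every other multiple of pi is at distance at least
      3/4 pi.\<close>
    have far: "pi / 4 \<le> cmod (z - of_int m * of_real pi)" for m :: int
    proof (cases "m = int k")
      case True then show ?thesis using z by (simp add: c_def)
    next
      case False
      from pi_multiples_separated[OF this, of z] have "pi \<le> cmod (z - of_int m * of_real pi) +
        cmod (z - c)"
        by (simp add: c_def)
      then show ?thesis using z pi_gt_zero by linarith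
    qed
    have sq: "2 * (csqrt (z / 2))\<^sup>2 = z" by simp
    have "cmod (f z - sin z) < exp \<bar>Im z\<bar> / 8"
      using less[of "csqrt (z / 2)"] z unfolding sq f_def c_def by blast
    with norm_sin_ge_exp[OF far] show ?thesis by linarith
  qed
  have z4: "pi / 4 > 0" by simp
  note R = rouche_ball[OF S S3 z4 shol fhol lt]
  have sz: "{z. z \<in> ball c (pi / 4) \<and> sin z = 0} = {c}"
  proof (intro equalityI subsetI)
    fix z assume z: "z \<in> {z. z \<in> ball c (pi / 4) \<and> sin z = 0}"
    then have "cmod (z - c) / 2 \<le> cmod (sin (z - c))"
      by (intro norm_sin_ge_half) (auto simp: dist_norm norm_minus_commute)
    also have "sin (z - c) = 0"
      using z by (simp add: c_def sin_diff sin_npi_complex' mult.commute)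
    finally show "z \<in> {c}" by simp
  qed (simp add: c_def sin_npi_complex' mult.commute)
  have "deriv sin c = cos c" by (rule DERIV_imp_deriv) (rule DERIV_sin)
  also have "cos c \<noteq> 0"
  proof -
    have "sin c = 0" using sz by blast
    then show ?thesis using sin_cos_squared_add[of c] by auto
  qed
  finally have "zorder sin c = 1"
    using sz by (intro zorder_zero_eqI[OF shol S(1)]) (use S3 z4 in auto)
  then have sum1: "(\<Sum>z | z \<in> ball c (pi / 4) \<and> f z = 0. zorder f z) = 1" using R(3) sz by simp
  define Z where "Z = {z. z \<in> ball c (pi / 4) \<and> f z = 0}"
  have finZ: "finite Z" using R(2) by (simp add: Z_def)
  have pos: "zorder f z \<ge> 1" if "z \<in> Z" for z using R(4)[of z] that by (simp add: Z_def)
  have sum1': "sum (zorder f) Z = 1" using sum1 by (simp only: Z_def)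
  then have "Z \<noteq> {}" by auto
  \<comment> \<open>The orders are positive and add up to 1, so there is one zero and it is
    simple.\<close>
  moreover have "int (card Z) \<le> 1"
    using sum_mono[of Z "\<lambda>_. 1" "zorder f"] pos sum1' by simp
  ultimately have "card Z = 1" using finZ by (simp add: card_gt_0_iff le_less_Suc_eq Suc_le_eq
    order.antisym)
  then obtain z0 where Z: "Z = {z0}" by (auto simp: card_1_singleton_iff)
  have zo: "zorder f z0 = 1" using sum1' Z by simp
  have z0: "z0 \<in> ball c (pi / 4)" "f z0 = 0" using Z by (auto simp: Z_def)
  then have z0S: "z0 \<in> S" using S3 by auto
  have "f (c + of_real (pi / 4)) \<noteq> 0" using lt[of "c + of_real (pi / 4)"] by auto
  moreover have "c + of_real (pi / 4) \<in> S" using S3 by (auto simp: dist_norm)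
  ultimately have df: "deriv f z0 \<noteq> 0"
    using zorder_eq_1_iff_deriv[OF fhol S z0S z0(2)] zo by blast
  define w0 where "w0 = csqrt (z0 / 2)"
  \<comment> \<open>The chain rule would pass a vanishing derivative of \<open>F\<close> on to
    \<open>f\<close>.\<close>
  have "deriv F w0 \<noteq> 0"
  proof
    assume d0: "deriv F w0 = 0"
    have "(F has_field_derivative deriv F w0) (at (csqrt (z0 / 2)))"
      unfolding w0_def by (rule holomorphic_derivI[OF F]) auto
    moreover have "((\<lambda>z. csqrt (z / 2)) has_field_derivative deriv (\<lambda>z. csqrt (z / 2)) z0) (at z0)"
      by (rule holomorphic_derivI[OF cs S(1) z0S])
    ultimately have "((\<lambda>z. F (csqrt (z / 2))) has_field_derivative deriv F w0 * deriv (\<lambda>z. csqrt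
      (z / 2)) z0) (at z0)"
      by (rule DERIV_chain2)
    then have "deriv f z0 = 0" unfolding f_def[abs_def] using d0 DERIV_imp_deriv by auto
    with df show False by simp
  qed
  moreover have "{w \<in> right_disc k. F w = 0} = {w0}"
  proof (intro equalityI subsetI)
    fix w assume w: "w \<in> {w \<in> right_disc k. F w = 0}"
    then have "csqrt (2 * w\<^sup>2 / 2) = w" using csqrt_square[of w] by (simp add: right_disc_def)
    then have "2 * w\<^sup>2 \<in> Z" using w by (simp add: Z_def f_def right_disc_def c_def dist_norm
      norm_minus_commute)
    then have "2 * w\<^sup>2 = z0" using Z by simp
    with \<open>csqrt (2 * w\<^sup>2 / 2) = w\<close> show "w \<in> {w0}" by (simp add: w0_def)
  next
    fix w assume "w \<in> {w0}"
    then have w: "w = csqrt (z0 / 2)" by (simp add: w0_def)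
    have "Re w > 0"
    proof (rule ccontr)
      assume "\<not> Re w > 0"
      then have "Re w = 0" using csqrt_principal[of "z0 / 2"] by (simp add: w)
      then have "Re (w\<^sup>2) \<le> 0" by (simp add: power2_eq_square)
      then show False using z0S by (simp add: w S_def)
    qed
    then show "w \<in> {w \<in> right_disc k. F w = 0}"
      using z0 by (simp add: w right_disc_def f_def c_def dist_norm norm_minus_commute)
  qed
  ultimately show ?thesis by blast
qed

text \<open>\<open>D_disc i n\<close> is \<open>disc_dir i n\<close> times a disc in the right half plane.\<close>

definition disc_dir :: "nat \<Rightarrow> int \<Rightarrow> complex" where
  "disc_dir i n = (if i = 1 then 1 else \<i>) * of_int (sgn n)"

text \<open>Square of the direction \<open>disc_dir\<close>: on \<open>D_disc i n\<close> the number
  \<open>2 * \<zeta>\<^sup>2\<close> lies near this sign times |n| pi.\<close>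

definition disc_sign :: "nat \<Rightarrow> int" where
  "disc_sign i = (if i = 1 then 1 else - 1)"

section \<open>Geometry of the discs\<close>

lemma disc_dir:
  assumes "n \<noteq> 0"
  shows "disc_dir i n * cnj (disc_dir i n) = 1" "(disc_dir i n)\<^sup>2 = of_int (disc_sign i)" "cmod
    (disc_dir i n) = 1"
proof -
  have "sgn n = 1 \<or> sgn n = - 1" using assms by (auto simp: sgn_if)
  then show "disc_dir i n * cnj (disc_dir i n) = 1" "(disc_dir i n)\<^sup>2 = of_int (disc_sign i)"
    "cmod (disc_dir i n) = 1"
    by (auto simp: disc_dir_def disc_sign_def power_mult_distrib norm_mult)
qed

lemma D_disc_eq:
  assumes n: "n \<noteq> 0" and i: "i \<in> {1, 2}"
  shows "\<zeta> \<in> D_disc i n \<longleftrightarrow> \<zeta> * cnj (disc_dir i n) \<in> right_disc (nat \<bar>n\<bar>)"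
proof -
  have *: "cmod (- (2 * \<zeta>\<^sup>2) - x) = cmod (2 * \<zeta>\<^sup>2 + x)" "cmod (x - 2 * \<zeta>\<^sup>2) = cmod (2 * \<zeta>\<^sup>2 - x)"
    for x
    using norm_minus_cancel[of "2 * \<zeta>\<^sup>2 + x"] norm_minus_commute[of "2 * \<zeta>\<^sup>2" x] by simp_all
  have nn: "(of_nat (nat \<bar>n\<bar>) :: complex) = of_int \<bar>n\<bar>"
    by (metis abs_ge_zero nat_0_le of_int_of_nat_eq)
  show ?thesis
    using n i unfolding right_disc_def nn
    by (cases "n > 0") (auto simp: D_disc_def U_dom_def disc_dir_def sgn_if power_mult_distrib * )
qed

lemma D_disc_sq:
  assumes n: "n \<noteq> 0" and i: "i \<in> {1, 2}" and \<zeta>: "\<zeta> \<in> D_disc i n"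
  shows "cmod (2 * \<zeta>\<^sup>2 - of_int (disc_sign i * \<bar>n\<bar>) * of_real pi) < pi / 4" "Re (\<zeta> * cnj (disc_dir
    i n)) > 0"
  using assms
  by (auto simp: D_disc_def U_dom_def disc_sign_def disc_dir_def sgn_if split: if_splits)

lemma int_eq_if_pi_close:
  fixes m k :: int
  assumes "cmod (z - of_int m * of_real pi) < pi / 4" "cmod (z - of_int k * of_real pi) < pi / 4"
  shows "m = k"
  using pi_multiples_separated[of m k z] assms pi_gt_zero by fastforce

text \<open>The multiple of pi close to \<open>2 * \<zeta>\<^sup>2\<close> determines
  \<open>i\<close> and the modulus of \<open>n\<close>; the sign of the real part after rotation
  determines the sign of \<open>n\<close>.\<close>

lemma D_disc_disjoint:
  assumes "n \<noteq> 0" "n' \<noteq> 0" "i \<in> {1, 2}" "i' \<in> {1, 2}" "\<zeta> \<in> D_disc i n" "\<zeta> \<in> D_disc i' n'"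
  shows "i = i' \<and> n = n'"
proof -
  have eq: "disc_sign i * \<bar>n\<bar> = disc_sign i' * \<bar>n'\<bar>"
    using int_eq_if_pi_close D_disc_sq(1) assms by blast
  then have i: "i = i'" and "\<bar>n\<bar> = \<bar>n'\<bar>"
    using assms(1-4) by (auto simp: disc_sign_def split: if_splits)
  then have "n = n' \<or> n = - n'" by linarith
  moreover have "n \<noteq> - n'"
  proof
    assume "n = - n'"
    then have "disc_dir i' n = - disc_dir i' n'" by (simp add: disc_dir_def)
    then have "Re (\<zeta> * cnj (disc_dir i n)) = - Re (\<zeta> * cnj (disc_dir i' n'))" using i by simp
    then show False using D_disc_sq(2)[of n i \<zeta>] D_disc_sq(2)[of n' i' \<zeta>] assms by linarith
  qed
  ultimately show ?thesis using i by blast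
qed

lemma B_disc_sq: "\<zeta> \<in> B_disc N \<longleftrightarrow> cmod (2 * \<zeta>\<^sup>2) < (real N + 1 / 4) * pi"
proof -
  have "\<zeta> \<in> B_disc N \<longleftrightarrow> cmod \<zeta> < sqrt ((real N + 1 / 4) * pi / 2)" by (simp add: B_disc_def)
  also have "\<dots> \<longleftrightarrow> sqrt ((cmod \<zeta>)\<^sup>2) < sqrt ((real N + 1 / 4) * pi / 2)" by simp
  also have "\<dots> \<longleftrightarrow> (cmod \<zeta>)\<^sup>2 < (real N + 1 / 4) * pi / 2" by (simp only: real_sqrt_less_iff)
  also have "\<dots> \<longleftrightarrow> cmod (2 * \<zeta>\<^sup>2) < (real N + 1 / 4) * pi" by (auto simp: norm_mult norm_power)
  finally show ?thesis .
qed

lemma B_disc_ball: "B_disc N = ball 0 (sqrt ((real N + 1 / 4) * pi / 2))"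
  by (auto simp: B_disc_def)

lemma norm_disc_center: "i \<in> {1, 2} \<Longrightarrow> cmod (of_int (disc_sign i * \<bar>n\<bar>) * of_real pi) = real_of_int
  \<bar>n\<bar> * pi"
  by (auto simp: disc_sign_def norm_mult)

lemma D_disc_norm:
  assumes n: "n \<noteq> 0" and i: "i \<in> {1, 2}" and \<zeta>: "\<zeta> \<in> D_disc i n"
  shows "cmod (2 * \<zeta>\<^sup>2) < (real_of_int \<bar>n\<bar> + 1 / 4) * pi" "(real_of_int \<bar>n\<bar> - 1 / 4) * pi < cmod
    (2 * \<zeta>\<^sup>2)"
proof -
  let ?c = "of_int (disc_sign i * \<bar>n\<bar>) * complex_of_real pi"
  have "cmod (2 * \<zeta>\<^sup>2) \<le> cmod ?c + cmod (2 * \<zeta>\<^sup>2 - ?c)" "cmod ?c - cmod (2 * \<zeta>\<^sup>2 - ?c) \<le> cmod (2 *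
    \<zeta>\<^sup>2)"
    using norm_triangle_ineq[of ?c "2 * \<zeta>\<^sup>2 - ?c"] norm_triangle_ineq4[of "2 * \<zeta>\<^sup>2" "2 * \<zeta>\<^sup>2 -
      ?c"] by simp_all
  then show "cmod (2 * \<zeta>\<^sup>2) < (real_of_int \<bar>n\<bar> + 1 / 4) * pi" "(real_of_int \<bar>n\<bar> - 1 / 4) * pi <
    cmod (2 * \<zeta>\<^sup>2)"
    using D_disc_sq(1)[OF assms] unfolding norm_disc_center[OF i] by (simp_all add: algebra_simps)
qed

lemma D_disc_subset_B_disc:
  assumes "n \<noteq> 0" "i \<in> {1, 2}" "\<bar>n\<bar> \<le> int N" "\<zeta> \<in> D_disc i n"
  shows "\<zeta> \<in> B_disc N"
proof -
  have "real_of_int \<bar>n\<bar> \<le> real N" using assms(3) by linarith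
  then have "(real_of_int \<bar>n\<bar> + 1 / 4) * pi \<le> (real N + 1 / 4) * pi" by (intro mult_right_mono) auto
  from less_le_trans[OF D_disc_norm(1)[OF assms(1,2,4)] this] show ?thesis unfolding B_disc_sq .
qed

lemma D_disc_not_B_disc:
  assumes "i \<in> {1, 2}" "\<bar>n\<bar> > int N" "\<zeta> \<in> D_disc i n"
  shows "\<zeta> \<notin> B_disc N"
proof
  have n: "n \<noteq> 0" using assms(2) by auto
  assume "\<zeta> \<in> B_disc N"
  then have "(real_of_int \<bar>n\<bar> - 1 / 4) * pi < (real N + 1 / 4) * pi"
    unfolding B_disc_sq by (rule less_trans[OF D_disc_norm(2)[OF n assms(1,3)]])
  then have "real_of_int \<bar>n\<bar> - 1 / 4 < real N + 1 / 4" by simp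
  then show False using assms(2) by linarith
qed

text \<open>\<open>chi_D \<psi>\<close> is so close to \<open>sin (2 \<zeta>\<^sup>2)\<close> outside \<open>B_disc N\<close> that Rouche's theorem applies
  there.\<close>

definition sin_dominated :: "potential \<Rightarrow> nat \<Rightarrow> bool" where
  "sin_dominated \<psi> N \<longleftrightarrow>
     (\<forall>\<zeta>. \<zeta> \<notin> B_disc N \<longrightarrow> cmod (chi_D \<psi> \<zeta> - sin (2 * \<zeta>\<^sup>2)) < exp \<bar>Im (2 * \<zeta>\<^sup>2)\<bar> / 8)"

text \<open>Rotation to the right half plane multiplies \<open>2 * w\<^sup>2\<close> by the sign
  \<open>s\<close>. As the sine is odd, \<open>s * chi_D \<psi> (e * w)\<close> is compared with the
  same free function as before.\<close>

lemma D_disc_unique_zero: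
  assumes dom: "sin_dominated \<psi> N" and i: "i \<in> {1, 2}" and n: "\<bar>n\<bar> > int N"
  shows "\<exists>z. {\<zeta> \<in> D_disc i n. chi_D \<psi> \<zeta> = 0} = {z} \<and> deriv (chi_D \<psi>) z \<noteq> 0"
proof -
  have n0: "n \<noteq> 0" using n by auto
  define e where "e = disc_dir i n"
  define s :: complex where "s = of_int (disc_sign i)"
  have e: "e * cnj e = 1" "e\<^sup>2 = s" "cmod e = 1" using disc_dir[OF n0, of i]
    by (simp_all add: e_def s_def)
  have e0: "e \<noteq> 0" using e(3) by auto
  have s: "s = 1 \<or> s = - 1" "s * s = 1" "cmod s = 1" by (auto simp: s_def disc_sign_def)
  define F where "F w = s * chi_D \<psi> (e * w)" for w
  have "\<exists>w. {w \<in> right_disc (nat \<bar>n\<bar>). F w = 0} = {w} \<and> deriv F w \<noteq> 0"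
  proof (rule right_disc_unique_zero)
    show "nat \<bar>n\<bar> \<ge> 1" using n0 by auto
    show "F holomorphic_on UNIV"
      unfolding F_def
      by (intro holomorphic_intros holomorphic_on_compose_gen[OF _ chi_D_holomorphic, unfolded
        o_def]) auto
    fix w assume w: "cmod (2 * w\<^sup>2 - of_nat (nat \<bar>n\<bar>) * of_real pi) = pi / 4"
    have sq: "2 * (e * w)\<^sup>2 = s * (2 * w\<^sup>2)" by (simp add: power_mult_distrib e(2))
    have "real (nat \<bar>n\<bar>) * pi = cmod (of_nat (nat \<bar>n\<bar>) * of_real pi)" by (simp add: norm_mult)
    also have "\<dots> \<le> cmod (2 * w\<^sup>2) + cmod (2 * w\<^sup>2 - of_nat (nat \<bar>n\<bar>) * of_real pi)"
      using norm_triangle_ineq4[of "2 * w\<^sup>2" "2 * w\<^sup>2 - of_nat (nat \<bar>n\<bar>) * of_real pi"] by simp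
    finally have "real (nat \<bar>n\<bar>) * pi - pi / 4 \<le> cmod (2 * w\<^sup>2)" using w by linarith
    moreover have "(real N + 1) * pi \<le> real (nat \<bar>n\<bar>) * pi" using n by (intro mult_right_mono) auto
    \<comment> \<open>Boundary points of the disc satisfy |2 w^2| >= (N + 3/4) pi, hence lie outside
      \<open>B_disc N\<close>, where domination holds.\<close>
    moreover have "(real N + 1) * pi - pi / 4 \<ge> (real N + 1 / 4) * pi" by (simp add: algebra_simps)
    ultimately have "(real N + 1 / 4) * pi \<le> cmod (2 * (e * w)\<^sup>2)"
      unfolding sq norm_mult[of s] s(3) by linarith
    then have "e * w \<notin> B_disc N" by (simp add: B_disc_sq)
    then have *: "cmod (chi_D \<psi> (e * w) - sin (2 * (e * w)\<^sup>2)) < exp \<bar>Im (2 * (e * w)\<^sup>2)\<bar> / 8"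
      using dom unfolding sin_dominated_def by blast
    have "F w - sin (2 * w\<^sup>2) = s * (chi_D \<psi> (e * w) - sin (s * (2 * w\<^sup>2)))"
      using s(1) by (auto simp: F_def)
    then have "cmod (F w - sin (2 * w\<^sup>2)) = cmod (chi_D \<psi> (e * w) - sin (2 * (e * w)\<^sup>2))"
      by (simp add: norm_mult s(3) sq)
    moreover have "\<bar>Im (2 * (e * w)\<^sup>2)\<bar> = \<bar>Im (2 * w\<^sup>2)\<bar>" unfolding sq using s(1) by auto
    ultimately show "cmod (F w - sin (2 * w\<^sup>2)) < exp \<bar>Im (2 * w\<^sup>2)\<bar> / 8" using * by simp
  qed
  then obtain w where w: "{w \<in> right_disc (nat \<bar>n\<bar>). F w = 0} = {w}" "deriv F w \<noteq> 0" by blast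
  have F0: "F w = 0 \<longleftrightarrow> chi_D \<psi> (e * w) = 0" for w using s(1) by (auto simp: F_def)
  have bk: "e * (\<zeta> * cnj e) = \<zeta>" "(e * \<zeta>) * cnj e = \<zeta>" for \<zeta>
  proof -
    have "e * (\<zeta> * cnj e) = (e * cnj e) * \<zeta>" "(e * \<zeta>) * cnj e = (e * cnj e) * \<zeta>"
      by (simp_all only: mult_ac)
    then show "e * (\<zeta> * cnj e) = \<zeta>" "(e * \<zeta>) * cnj e = \<zeta>" unfolding e(1) by simp_all
  qed
  have "{\<zeta> \<in> D_disc i n. chi_D \<psi> \<zeta> = 0} = {e * w}"
  proof (intro equalityI subsetI)
    fix \<zeta> assume "\<zeta> \<in> {\<zeta> \<in> D_disc i n. chi_D \<psi> \<zeta> = 0}"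
    then have "\<zeta> * cnj e \<in> {w \<in> right_disc (nat \<bar>n\<bar>). F w = 0}"
      using D_disc_eq[OF n0 i, of \<zeta>] by (simp add: F0 bk e_def[symmetric])
    then have "\<zeta> * cnj e = w" using w(1) by blast
    then show "\<zeta> \<in> {e * w}" using bk(1)[of \<zeta>] by simp
  next
    fix \<zeta> assume "\<zeta> \<in> {e * w}"
    then have "\<zeta> = e * w" by simp
    moreover have "w \<in> right_disc (nat \<bar>n\<bar>)" "F w = 0" using w(1) by blast+
    ultimately show "\<zeta> \<in> {\<zeta> \<in> D_disc i n. chi_D \<psi> \<zeta> = 0}"
      using D_disc_eq[OF n0 i, of \<zeta>] bk(2)[of w] by (simp add: F0 e_def[symmetric])
  qed
  moreover have "deriv (chi_D \<psi>) (e * w) \<noteq> 0"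
  proof
    assume d0: "deriv (chi_D \<psi>) (e * w) = 0"
    have "(chi_D \<psi> has_field_derivative deriv (chi_D \<psi>) (e * w)) (at (e * w))"
      by (rule holomorphic_derivI[OF chi_D_holomorphic[of \<psi> UNIV]]) auto
    moreover have "((*) e has_field_derivative e) (at w)" by (auto intro!: derivative_eq_intros)
    ultimately have "((\<lambda>w. chi_D \<psi> (e * w)) has_field_derivative deriv (chi_D \<psi>) (e * w) * e) (at
      w)"
      by (rule DERIV_chain2)
    from DERIV_cmult[OF this, of s] have "(F has_field_derivative 0) (at w)"
      using d0 by (simp add: F_def[abs_def])
    from DERIV_imp_deriv[OF this] w(2) show False by simp
  qed
  ultimately show ?thesis by blast
qed

section \<open>Zeros outside the central disc\<close>

lemma dirichlet_mult_simple:
  assumes "chi_D \<psi> z = 0" "deriv (chi_D \<psi>) z \<noteq> 0"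
  shows "dirichlet_mult \<psi> z = 1"
proof -
  have "zorder (chi_D \<psi>) z = 1"
    by (rule zorder_zero_eqI[OF chi_D_holomorphic[of \<psi> UNIV]]) (use assms in auto)
  then show ?thesis using assms(1) by (simp add: dirichlet_mult_def dirichlet_eigenvalue_def)
qed

text \<open>The real part of \<open>2 * \<zeta>\<^sup>2\<close> is twice the difference of the
  squares of \<open>Re \<zeta>\<close> and \<open>Im \<zeta>\<close>. Its sign selects the axis, and
  the sign of the larger coordinate selects the disc on it.\<close>

lemma disc_of_sq_close:
  assumes m: "m \<noteq> 0" and close: "cmod (2 * \<zeta>\<^sup>2 - of_int m * of_real pi) < pi / 4"
  shows "\<exists>i\<in>{1, 2}. \<exists>n. \<bar>n\<bar> = \<bar>m\<bar> \<and> \<zeta> \<in> D_disc i n"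
proof -
  have re: "\<bar>Re (2 * \<zeta>\<^sup>2) - of_int m * pi\<bar> < pi / 4"
    using abs_Re_le_cmod[of "2 * \<zeta>\<^sup>2 - of_int m * of_real pi"] close by simp
  have re2: "Re (2 * \<zeta>\<^sup>2) = 2 * ((Re \<zeta>)\<^sup>2 - (Im \<zeta>)\<^sup>2)" by (simp add: power2_eq_square)
  show ?thesis
  proof (cases "m > 0")
    case True
    then have "pi \<le> of_int m * pi" by simp
    then have "Re (2 * \<zeta>\<^sup>2) > 0" using re pi_gt_zero by linarith
    then have "(Re \<zeta>)\<^sup>2 > (Im \<zeta>)\<^sup>2" unfolding re2 by simp
    then have "Re \<zeta> \<noteq> 0" using zero_le_power2[of "Im \<zeta>"] by auto
    then have "\<zeta> \<in> D_disc 1 (if Re \<zeta> > 0 then m else - m)"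
      using True close by (auto simp: D_disc_def U_dom_def)
    then show ?thesis by (intro bexI[of _ 1] exI[of _ "if Re \<zeta> > 0 then m else - m"]) auto
  next
    case False
    then have "of_int m \<le> (- 1 :: real)" using m by linarith
    then have "of_int m * pi \<le> - 1 * pi" by (rule mult_right_mono) simp
    then have "Re (2 * \<zeta>\<^sup>2) < 0" using re pi_gt_zero by linarith
    then have "(Re \<zeta>)\<^sup>2 < (Im \<zeta>)\<^sup>2" unfolding re2 by simp
    then have "Im \<zeta> \<noteq> 0" using zero_le_power2[of "Re \<zeta>"] by auto
    then have "\<zeta> \<in> D_disc 2 (if Im \<zeta> > 0 then - m else m)"
      using False m close by (auto simp: D_disc_def U_dom_def)
    then show ?thesis by (intro bexI[of _ 2] exI[of _ "if Im \<zeta> > 0 then - m else m"]) auto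
  qed
qed

text \<open>At a zero outside \<open>B_disc N\<close> the sine falls below its lower bound away from
  the multiples of pi, so \<open>2 * \<zeta>\<^sup>2\<close> is within pi/4 of some m pi; being
  outside forces the modulus of \<open>m\<close> above \<open>N\<close>.\<close>

lemma sin_dominated_zeros:
  assumes dom: "sin_dominated \<psi> N" and z: "chi_D \<psi> \<zeta> = 0"
  shows "\<zeta> \<in> B_disc N \<union> (\<Union>i\<in>{1, 2}. \<Union>n\<in>{n. \<bar>n\<bar> > int N}. D_disc i n)"
proof (cases "\<zeta> \<in> B_disc N")
  case False
  then have "cmod (sin (2 * \<zeta>\<^sup>2)) < exp \<bar>Im (2 * \<zeta>\<^sup>2)\<bar> / 8"
    using dom z unfolding sin_dominated_def by force
  then have "\<not> (\<forall>m::int. pi / 4 \<le> cmod (2 * \<zeta>\<^sup>2 - of_int m * of_real pi))"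
    using norm_sin_ge_exp[of "2 * \<zeta>\<^sup>2"] by (meson not_le)
  then obtain m :: int where m: "cmod (2 * \<zeta>\<^sup>2 - of_int m * of_real pi) < pi / 4"
    by (auto simp: not_le)
  have "(real N + 1 / 4) * pi \<le> cmod (2 * \<zeta>\<^sup>2)" using False by (simp add: B_disc_sq)
  also have "\<dots> \<le> cmod (of_int m * of_real pi) + cmod (2 * \<zeta>\<^sup>2 - of_int m * of_real pi)"
    using norm_triangle_ineq[of "of_int m * of_real pi" "2 * \<zeta>\<^sup>2 - of_int m * of_real pi"] by simp
  also have "\<dots> < real_of_int \<bar>m\<bar> * pi + pi / 4" using m by (simp add: norm_mult)
  finally have "real N * pi < real_of_int \<bar>m\<bar> * pi" by (simp add: algebra_simps)
  then have mN: "\<bar>m\<bar> > int N" by simp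
  then have "m \<noteq> 0" by auto
  from disc_of_sq_close[OF this m] mN show ?thesis by auto
qed simp

text \<open>For \<open>n = 0\<close> the direction vanishes along with the root, so both labels give
  0.\<close>

definition free_eigenvalue :: "nat \<Rightarrow> int \<Rightarrow> complex" where
  "free_eigenvalue i n = disc_dir i n * of_real (sqrt (real_of_int \<bar>n\<bar> * pi / 2))"

lemma free_eigenvalue_sq: "n \<noteq> 0 \<Longrightarrow> 2 * (free_eigenvalue i n)\<^sup>2 = of_int (disc_sign i * \<bar>n\<bar>) *
  of_real pi"
  using disc_dir(2)[of n i]
  by (simp add: free_eigenvalue_def power_mult_distrib del: of_int_abs flip: of_real_power)

lemma free_eigenvalue_in_disc:
  assumes n: "n \<noteq> 0" and i: "i \<in> {1, 2}"
  shows "free_eigenvalue i n \<in> D_disc i n"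
proof -
  define r where "r = sqrt (real_of_int \<bar>n\<bar> * pi / 2)"
  have r: "r > 0" using n by (simp add: r_def)
  have "free_eigenvalue i n * cnj (disc_dir i n) = of_real r"
    using disc_dir(1)[OF n, of i] by (simp add: free_eigenvalue_def r_def mult_ac)
  moreover have "2 * r\<^sup>2 = real_of_int \<bar>n\<bar> * pi" by (simp add: r_def)
  then have "2 * (of_real r)\<^sup>2 = of_nat (nat \<bar>n\<bar>) * complex_of_real pi"
  proof -
    assume "2 * r\<^sup>2 = real_of_int \<bar>n\<bar> * pi"
    moreover have "real_of_int \<bar>n\<bar> = real (nat \<bar>n\<bar>)" by simp
    ultimately have "complex_of_real (2 * r\<^sup>2) = complex_of_real (real (nat \<bar>n\<bar>) * pi)" by metis
    also have "\<dots> = of_nat (nat \<bar>n\<bar>) * of_real pi" by (simp only: of_real_mult of_real_of_nat_eq)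
    finally show ?thesis by simp
  qed
  ultimately show ?thesis
    unfolding D_disc_eq[OF n i] right_disc_def using r by simp
qed

lemma free_zeros:
  "{\<zeta>. \<zeta> \<in> B_disc N \<and> sin (2 * \<zeta>\<^sup>2) = 0}
   = insert 0 ((\<lambda>(i, n). free_eigenvalue i n) ` ({1, 2} \<times> ({- int N..int N} - {0})))"
proof (intro equalityI subsetI)
  fix \<zeta> assume "\<zeta> \<in> {\<zeta>. \<zeta> \<in> B_disc N \<and> sin (2 * \<zeta>\<^sup>2) = 0}"
  then have B: "\<zeta> \<in> B_disc N" and "sin (2 * \<zeta>\<^sup>2) = 0" by auto
  then obtain m :: int where m: "2 * \<zeta>\<^sup>2 = of_real (of_int m * pi)" by (auto simp: sin_eq_0)
  show "\<zeta> \<in> insert 0 ((\<lambda>(i, n). free_eigenvalue i n) ` ({1, 2} \<times> ({- int N..int N} - {0})))"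
  proof (cases "m = 0")
    case False
    have "cmod (2 * \<zeta>\<^sup>2 - of_int m * of_real pi) < pi / 4" using m by simp
    from disc_of_sq_close[OF False this] obtain i n where n: "i \<in> {1, 2}" "\<bar>n\<bar> = \<bar>m\<bar>" "\<zeta> \<in> D_disc
      i n" by blast
    then have n0: "n \<noteq> 0" using False by auto
    have nN: "\<bar>n\<bar> \<le> int N" using D_disc_not_B_disc[OF n(1) _ n(3)] B by (meson not_le)
    have "disc_sign i * \<bar>n\<bar> = m"
      using int_eq_if_pi_close[OF D_disc_sq(1)[OF n0 n(1,3)] \<open>cmod (2 * \<zeta>\<^sup>2 - of_int m * of_real
        pi) < pi / 4\<close>] .
    then have "2 * \<zeta>\<^sup>2 = 2 * (free_eigenvalue i n)\<^sup>2" using free_eigenvalue_sq[OF n0, of i] m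
      by simp
    then have "\<zeta> = free_eigenvalue i n \<or> \<zeta> = - free_eigenvalue i n" by (simp add: power2_eq_iff)
    moreover have "- free_eigenvalue i n = free_eigenvalue i (- n)"
      by (simp add: free_eigenvalue_def disc_dir_def)
    ultimately have "\<zeta> = free_eigenvalue i n \<or> \<zeta> = free_eigenvalue i (- n)" by simp
    moreover have "(i, n) \<in> {1, 2} \<times> ({- int N..int N} - {0})" "(i, - n) \<in> {1, 2} \<times> ({- int N..int
      N} - {0})"
      using n(1) n0 nN by auto
    then have "free_eigenvalue i n \<in> (\<lambda>(i, n). free_eigenvalue i n) ` ({1, 2} \<times> ({- int N..int N}
      - {0}))"
      "free_eigenvalue i (- n) \<in> (\<lambda>(i, n). free_eigenvalue i n) ` ({1, 2} \<times> ({- int N..int N} -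
        {0}))"
      using imageI[of "(i, n)" _ "\<lambda>(i, n). free_eigenvalue i n"] imageI[of "(i, - n)" _ "\<lambda>(i, n).
        free_eigenvalue i n"]
      unfolding case_prod_conv by blast+
    ultimately show ?thesis by (metis insertI2)
  qed (use m in simp)
next
  fix \<zeta> assume "\<zeta> \<in> insert 0 ((\<lambda>(i, n). free_eigenvalue i n) ` ({1, 2} \<times> ({- int N..int N} - {0})))"
  then consider "\<zeta> = 0" | x where "x \<in> {1, 2} \<times> ({- int N..int N} - {0})" "\<zeta> = (\<lambda>(i, n).
    free_eigenvalue i n) x"
    by blast
  then show "\<zeta> \<in> {\<zeta>. \<zeta> \<in> B_disc N \<and> sin (2 * \<zeta>\<^sup>2) = 0}"
  proof cases
    case 1
    then show ?thesis by (simp add: B_disc_def)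
  next
    case 2
    define i n where "i = fst x" and "n = snd x"
    have n: "n \<noteq> 0" and i: "i \<in> {1, 2}" and N: "\<bar>n\<bar> \<le> int N" and \<zeta>: "\<zeta> = free_eigenvalue i n"
      using 2 by (auto simp: i_def n_def)
    have "sin (2 * \<zeta>\<^sup>2) = 0"
      unfolding \<zeta> free_eigenvalue_sq[OF n] sin_eq_0
        by (intro exI[of _ "disc_sign i * \<bar>n\<bar>"]) (simp del: of_int_abs)
    moreover have "\<zeta> \<in> B_disc N"
      unfolding \<zeta> by (rule D_disc_subset_B_disc[OF n i N free_eigenvalue_in_disc[OF n i]])
    ultimately show ?thesis by simp
  qed
qed

text \<open>The double zero at 0 and 4 N simple ones. The derivative is cos (2 \<zeta>^2) times 4
  \<zeta>, whose cosine factor does not vanish where the sine does.\<close>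

lemma free_zero_count:
  "(\<Sum>\<zeta> | \<zeta> \<in> B_disc N \<and> sin (2 * \<zeta>\<^sup>2) = 0. zorder (\<lambda>\<zeta>. sin (2 * \<zeta>\<^sup>2)) \<zeta>) = int (2 * (2 * N + 1))"
proof -
  let ?f = "\<lambda>\<zeta>::complex. sin (2 * \<zeta>\<^sup>2)"
  let ?L = "{1, 2::nat} \<times> ({- int N..int N} - {0})"
  have hol: "?f holomorphic_on UNIV" by (intro holomorphic_intros)
  have d1: "(?f has_field_derivative cos (2 * \<zeta>\<^sup>2) * (4 * \<zeta>)) (at \<zeta>)" for \<zeta>
    by (auto intro!: derivative_eq_intros)
  have df: "deriv ?f = (\<lambda>\<zeta>. cos (2 * \<zeta>\<^sup>2) * (4 * \<zeta>))"
    by (rule ext, rule DERIV_imp_deriv[OF d1])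
  have z0: "zorder ?f 0 = 2"
  proof (rule zorder_zero_eqI[OF hol])
    have "((\<lambda>\<zeta>::complex. cos (2 * \<zeta>\<^sup>2) * (4 * \<zeta>)) has_field_derivative 4) (at 0)"
      by (auto intro!: derivative_eq_intros)
    then have "deriv (deriv ?f) 0 = 4" unfolding df by (rule DERIV_imp_deriv)
    then show "(deriv ^^ nat 2) ?f 0 \<noteq> 0" by (simp add: numeral_2_eq_2)
    show "(deriv ^^ i) ?f 0 = 0" if "i < nat 2" for i
      using that less_2_cases[of i] by (auto simp: df)
  qed auto
  have z1: "zorder ?f (free_eigenvalue i n) = 1" if "i \<in> {1, 2}" "n \<noteq> 0" for i n
  proof (rule zorder_zero_eqI[OF hol])
    have s0: "?f (free_eigenvalue i n) = 0"
      unfolding free_eigenvalue_sq[OF that(2)] sin_eq_0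
        by (intro exI[of _ "disc_sign i * \<bar>n\<bar>"]) (simp del: of_int_abs)
    then show "(deriv ^^ j) ?f (free_eigenvalue i n) = 0" if "j < nat 1" for j using that by simp
    have "cos (2 * (free_eigenvalue i n)\<^sup>2) \<noteq> 0"
      using s0 sin_cos_squared_add[of "2 * (free_eigenvalue i n)\<^sup>2"] by auto
    moreover have "free_eigenvalue i n \<noteq> 0"
      using free_eigenvalue_sq[OF that(2), of i] that(2)
        by (auto simp: disc_sign_def split: if_splits)
    ultimately show "(deriv ^^ nat 1) ?f (free_eigenvalue i n) \<noteq> 0" by (simp add: df)
  qed auto
  have nz: "0 \<notin> (\<lambda>(i, n). free_eigenvalue i n) ` ?L"
    by (auto simp: free_eigenvalue_def disc_dir_def sgn_if split: if_splits)
  have inj: "inj_on (\<lambda>(i, n). free_eigenvalue i n) ?L"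
  proof (rule inj_onI)
    fix x y assume "x \<in> ?L" "y \<in> ?L" and eq: "(\<lambda>(i, n). free_eigenvalue i n) x = (\<lambda>(i, n).
      free_eigenvalue i n) y"
    then have x: "snd x \<noteq> 0" "fst x \<in> {1, 2}" and y: "snd y \<noteq> 0" "fst y \<in> {1, 2}" by auto
    have "free_eigenvalue (fst x) (snd x) = free_eigenvalue (fst y) (snd y)" using eq
      by (simp add: case_prod_unfold)
    then show "x = y"
      using D_disc_disjoint[OF x(1) y(1) x(2) y(2) free_eigenvalue_in_disc[OF x]]
        free_eigenvalue_in_disc[OF y]
      by (simp add: prod_eq_iff)
  qed
  have card: "card ?L = 4 * N"
  proof -
    have "card ({- int N..int N} - {0}) = 2 * N" by (subst card_Diff_singleton) auto
    then show ?thesis by (simp only: card_cartesian_product) simp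
  qed
  have "(\<Sum>\<zeta> | \<zeta> \<in> B_disc N \<and> sin (2 * \<zeta>\<^sup>2) = 0. zorder ?f \<zeta>)
      = zorder ?f 0 + (\<Sum>\<zeta>\<in>(\<lambda>(i, n). free_eigenvalue i n) ` ?L. zorder ?f \<zeta>)"
    unfolding free_zeros using nz by (subst sum.insert) auto
  also have "(\<Sum>\<zeta>\<in>(\<lambda>(i, n). free_eigenvalue i n) ` ?L. zorder ?f \<zeta>) = (\<Sum>x\<in>?L. 1)"
  proof (subst sum.reindex[OF inj], rule sum.cong)
    fix x assume "x \<in> ?L"
    then have "fst x \<in> {1, 2}" "snd x \<noteq> 0" by auto
    from z1[OF this] show "(zorder ?f \<circ> (\<lambda>(i, n). free_eigenvalue i n)) x = 1"
      by (simp add: case_prod_unfold)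
  qed simp
  also have "\<dots> = int (4 * N)" using card by simp
  finally show ?thesis by (simp add: z0)
qed

text \<open>On the boundary of \<open>B_disc N\<close> one has |2 \<zeta>^2| = (N + 1/4) pi, which
  is at least pi/4 away from each |m| pi. The sine bound and domination then allow comparing the
  number of zeros with the free count.\<close>

lemma sin_dominated_counting:
  assumes dom: "sin_dominated \<psi> N"
  shows "counting \<psi> N"
proof -
  define r where "r = sqrt ((real N + 1 / 4) * pi / 2)"
  have r: "r > 0" by (simp add: r_def add_nonneg_pos)
  have less: "cmod (chi_D \<psi> \<zeta> - sin (2 * \<zeta>\<^sup>2)) < cmod (sin (2 * \<zeta>\<^sup>2))" if "cmod (\<zeta> - 0) = r" for \<zeta>
  proof -
    have "\<zeta> \<notin> B_disc N" using that by (simp add: B_disc_def r_def)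
    then have *: "cmod (chi_D \<psi> \<zeta> - sin (2 * \<zeta>\<^sup>2)) < exp \<bar>Im (2 * \<zeta>\<^sup>2)\<bar> / 8"
      using dom unfolding sin_dominated_def by blast
    have "r\<^sup>2 = (real N + 1 / 4) * pi / 2" by (simp add: r_def)
    then have sq: "cmod (2 * \<zeta>\<^sup>2) = (real N + 1 / 4) * pi" using that
      by (simp add: norm_mult norm_power)
    have "pi / 4 \<le> cmod (2 * \<zeta>\<^sup>2 - of_int m * of_real pi)" for m :: int
    proof -
      have "\<bar>cmod (2 * \<zeta>\<^sup>2) - cmod (of_int m * of_real pi)\<bar> \<le> cmod (2 * \<zeta>\<^sup>2 - of_int m * of_real
        pi)"
        by (rule norm_triangle_ineq3)
      then have "\<bar>(real N + 1 / 4) * pi - real_of_int \<bar>m\<bar> * pi\<bar> \<le> cmod (2 * \<zeta>\<^sup>2 - of_int m *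
        of_real pi)"
        unfolding sq by (simp add: norm_mult)
      moreover have "\<bar>(real N + 1 / 4) * pi - real_of_int \<bar>m\<bar> * pi\<bar> = \<bar>real N + 1 / 4 -
        real_of_int \<bar>m\<bar>\<bar> * pi"
        using abs_mult[of "real N + 1 / 4 - real_of_int \<bar>m\<bar>" pi] by (simp add: left_diff_distrib)
      moreover have "1 / 4 \<le> \<bar>real N + 1 / 4 - real_of_int \<bar>m\<bar>\<bar>"
        by (cases "\<bar>m\<bar> \<le> int N") linarith+
      then have "1 / 4 * pi \<le> \<bar>real N + 1 / 4 - real_of_int \<bar>m\<bar>\<bar> * pi"
        by (rule mult_right_mono) simp
      ultimately have "1 / 4 * pi \<le> cmod (2 * \<zeta>\<^sup>2 - of_int m * of_real pi)" by linarith
      then show ?thesis by simp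
    qed
    from norm_sin_ge_exp[OF this] * show ?thesis by linarith
  qed
  have hol: "(\<lambda>\<zeta>. sin (2 * \<zeta>\<^sup>2)) holomorphic_on UNIV" by (intro holomorphic_intros)
  note R = rouche_ball[where c=0, OF open_UNIV connected_UNIV subset_UNIV r hol chi_D_holomorphic
    less]
  have B: "B_disc N = ball 0 r" by (simp add: B_disc_ball r_def)
  let ?Z = "{\<zeta>. \<zeta> \<in> B_disc N \<and> chi_D \<psi> \<zeta> = 0}"
  have "(\<Sum>\<zeta>\<in>?Z. int (dirichlet_mult \<psi> \<zeta>)) = (\<Sum>\<zeta>\<in>?Z. zorder (chi_D \<psi>) \<zeta>)"
  proof (rule sum.cong)
    fix \<zeta> assume "\<zeta> \<in> ?Z"
    then have "zorder (chi_D \<psi>) \<zeta> > 0" "chi_D \<psi> \<zeta> = 0" using R(4)[of \<zeta>] B by blast+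
    then show "int (dirichlet_mult \<psi> \<zeta>) = zorder (chi_D \<psi>) \<zeta>"
      by (simp add: dirichlet_mult_def dirichlet_eigenvalue_def)
  qed simp
  also have "\<dots> = int (2 * (2 * N + 1))"
    using R(3) free_zero_count[of N] unfolding B by simp
  finally have "int (\<Sum>\<zeta>\<in>?Z. dirichlet_mult \<psi> \<zeta>) = int (2 * (2 * N + 1))"
    unfolding of_nat_sum .
  then have sum: "(\<Sum>\<zeta>\<in>?Z. dirichlet_mult \<psi> \<zeta>) = 2 * (2 * N + 1)"
    by (simp only: of_nat_eq_iff)
  have fin: "finite ?Z" using R(2) unfolding B by simp
  have disc: "\<exists>z. {\<zeta>\<in>D_disc i n. dirichlet_eigenvalue \<psi> \<zeta>} = {z} \<and> dirichlet_mult \<psi> z = 1"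
    if i: "i \<in> {1, 2}" and n: "\<bar>n\<bar> > int N" for i n
  proof -
    obtain z where z: "{\<zeta> \<in> D_disc i n. chi_D \<psi> \<zeta> = 0} = {z}" "deriv (chi_D \<psi>) z \<noteq> 0"
      using D_disc_unique_zero[OF dom i n] by blast
    then have "chi_D \<psi> z = 0" by blast
    from dirichlet_mult_simple[OF this z(2)] z(1) show ?thesis
      unfolding dirichlet_eigenvalue_def by blast
  qed
  show ?thesis
    unfolding counting_def
  proof (intro conjI ballI allI impI)
    show "{\<zeta>. dirichlet_eigenvalue \<psi> \<zeta>} \<subseteq> B_disc N \<union> (\<Union>i\<in>{1, 2}. \<Union>n\<in>{n. \<bar>n\<bar> > int N}. D_disc i n)"
      using sin_dominated_zeros[OF dom] unfolding dirichlet_eigenvalue_def by blast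
    show "finite {\<zeta> \<in> B_disc N. dirichlet_eigenvalue \<psi> \<zeta>}" using fin
      by (simp add: dirichlet_eigenvalue_def)
    show "(\<Sum>\<zeta> | \<zeta> \<in> B_disc N \<and> dirichlet_eigenvalue \<psi> \<zeta>. dirichlet_mult \<psi> \<zeta>) = 2 * (2 * N + 1)"
      using sum by (simp add: dirichlet_eigenvalue_def)
  qed (use disc in blast)
qed

lemma sin_dominated_bounded:
  obtains N where "\<And>\<psi>. norm \<psi> \<le> R \<Longrightarrow> sin_dominated \<psi> N"
proof -
  obtain C where C: "C \<ge> 0" "\<And>\<zeta> \<psi>. norm \<psi> \<le> R \<Longrightarrow>
    cmod (chi_D \<psi> \<zeta> - sin (2 * \<zeta>\<^sup>2)) \<le> C / (1 + cmod \<zeta>) * exp \<bar>Im (2 * \<zeta>\<^sup>2)\<bar>"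
    by (rule chi_D_asymp[of R]) blast
  \<comment> \<open>Outside \<open>B_disc N\<close> the modulus of \<open>\<zeta>\<close> is then at
    least \<open>8 * C\<close>, which pushes \<open>C / (1 + cmod \<zeta>)\<close> below
    1/8.\<close>
  obtain N :: nat where N: "(8 * C)\<^sup>2 \<le> real N" using real_arch_simple by blast
  have "sin_dominated \<psi> N" if \<psi>: "norm \<psi> \<le> R" for \<psi>
    unfolding sin_dominated_def
  proof (intro allI impI)
    fix \<zeta> assume "\<zeta> \<notin> B_disc N"
    then have "sqrt ((real N + 1 / 4) * pi / 2) \<le> cmod \<zeta>" by (simp add: B_disc_def)
    moreover have "8 * C \<le> sqrt ((real N + 1 / 4) * pi / 2)"
    proof (rule real_le_rsqrt)
      have "real N * 1 \<le> (real N + 1 / 4) * (pi / 2)" using pi_ge_two by (intro mult_mono) auto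
      with N show "(8 * C)\<^sup>2 \<le> (real N + 1 / 4) * pi / 2" by simp
    qed
    ultimately have "8 * C \<le> cmod \<zeta>" by linarith
    then have "C / (1 + cmod \<zeta>) < 1 / 8" by (simp add: divide_less_eq add_pos_nonneg)
    then have "C / (1 + cmod \<zeta>) * exp \<bar>Im (2 * \<zeta>\<^sup>2)\<bar> < 1 / 8 * exp \<bar>Im (2 * \<zeta>\<^sup>2)\<bar>"
      by (rule mult_strict_right_mono) simp
    from le_less_trans[OF C(2)[OF \<psi>, of \<zeta>] this] show "cmod (chi_D \<psi> \<zeta> - sin (2 * \<zeta>\<^sup>2)) < exp \<bar>Im
      (2 * \<zeta>\<^sup>2)\<bar> / 8" by simp
  qed
  with that show ?thesis by blast
qed

lemma sin_dominated_near_0: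
  obtains d where "d > 0" "\<And>\<psi>. norm \<psi> < d \<Longrightarrow> sin_dominated \<psi> 0"
proof -
  obtain C where C: "C \<ge> 0" "\<And>\<zeta> \<psi>. norm \<psi> < 1 \<Longrightarrow>
    cmod (chi_D \<psi> \<zeta> - sin (2 * \<zeta>\<^sup>2)) \<le> C * norm \<psi> * exp \<bar>Im (2 * \<zeta>\<^sup>2)\<bar>"
    by (rule chi_D_asymp_near_0) blast
  \<comment> \<open>This makes \<open>C * norm \<psi>\<close> smaller than 1/8; here domination even
    holds at every \<open>\<zeta>\<close>.\<close>
  define d where "d = min 1 (1 / (8 * (C + 1)))"
  have d: "d > 0" using C(1) by (simp add: d_def)
  have "sin_dominated \<psi> 0" if \<psi>: "norm \<psi> < d" for \<psi>
    unfolding sin_dominated_def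
  proof (intro allI impI)
    fix \<zeta>
    have "C * norm \<psi> \<le> (C + 1) * norm \<psi>" by (simp add: mult_right_mono)
    also have "\<dots> < (C + 1) * (1 / (8 * (C + 1)))" using \<psi> C(1)
      by (intro mult_strict_left_mono) (auto simp: d_def)
    also have "\<dots> = 1 / 8" using C(1) by simp
    finally have "C * norm \<psi> * exp \<bar>Im (2 * \<zeta>\<^sup>2)\<bar> < 1 / 8 * exp \<bar>Im (2 * \<zeta>\<^sup>2)\<bar>"
      by (rule mult_strict_right_mono) simp
    moreover have "norm \<psi> < 1" using \<psi> by (simp add: d_def)
    ultimately have "cmod (chi_D \<psi> \<zeta> - sin (2 * \<zeta>\<^sup>2)) < 1 / 8 * exp \<bar>Im (2 * \<zeta>\<^sup>2)\<bar>"
      by (rule le_less_trans[OF C(2), rotated])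
    then show "cmod (chi_D \<psi> \<zeta> - sin (2 * \<zeta>\<^sup>2)) < exp \<bar>Im (2 * \<zeta>\<^sup>2)\<bar> / 8" by simp
  qed
  with d that show ?thesis by blast
qed

section \<open>Labelled eigenvalues\<close>

text \<open>A finite multiset has exactly one sorted list for a total order, which makes the
  definite description in \<open>central_eigenvalues\<close> meaningful.\<close>

interpretation lex: linorder "(\<preceq>)" "\<lambda>z w. z \<preceq> w \<and> z \<noteq> w"
  by standard (auto simp: lex_le_def complex_eq_iff)

lemma label_bound_least:
  assumes "counting \<psi> N"
  shows "counting \<psi> (label_bound \<psi>)" "label_bound \<psi> \<le> N"
  unfolding label_bound_def using LeastI[of "counting \<psi>", OF assms] Least_le[of "counting \<psi>", OF
    assms] by auto

text \<open>Finitely many zeros in a disc exclude the zero function; only then is the order at a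
  zero positive.\<close>

lemma zorder_chi_D_pos:
  assumes fin: "finite {\<zeta> \<in> B_disc N. dirichlet_eigenvalue \<psi> \<zeta>}" and z: "chi_D \<psi> z = 0"
  shows "zorder (chi_D \<psi>) z > 0" "\<exists>w\<in>UNIV. chi_D \<psi> w \<noteq> 0"
proof -
  have "infinite (B_disc N)"
    unfolding B_disc_ball by (intro uncountable_infinite uncountable_ball) (simp add:
      add_nonneg_pos)
  then have "{\<zeta> \<in> B_disc N. dirichlet_eigenvalue \<psi> \<zeta>} \<noteq> B_disc N" using fin by auto
  then show nc: "\<exists>w\<in>UNIV. chi_D \<psi> w \<noteq> 0" by (auto simp: dirichlet_eigenvalue_def)
  show "zorder (chi_D \<psi>) z > 0"
    using zorder_exist_zero[OF chi_D_holomorphic open_UNIV connected_UNIV UNIV_I nc, of z] z by auto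
qed

lemma central_eigenvalues:
  assumes cnt: "counting \<psi> N"
  defines "xs \<equiv> central_eigenvalues \<psi> N"
  shows "count (mset xs) \<zeta> = (if \<zeta> \<in> B_disc N then dirichlet_mult \<psi> \<zeta> else 0)" "length xs = 4 * N
    + 2"
proof -
  define f where "f \<zeta> = (if \<zeta> \<in> B_disc N then dirichlet_mult \<psi> \<zeta> else 0)" for \<zeta>
  have fin: "finite {\<zeta> \<in> B_disc N. dirichlet_eigenvalue \<psi> \<zeta>}"
    and sum: "(\<Sum>\<zeta> | \<zeta> \<in> B_disc N \<and> dirichlet_eigenvalue \<psi> \<zeta>. dirichlet_mult \<psi> \<zeta>) = 2 * (2 * N + 1)"
    using cnt by (auto simp: counting_def)
  have sub: "{\<zeta>. 0 < f \<zeta>} \<subseteq> {\<zeta> \<in> B_disc N. dirichlet_eigenvalue \<psi> \<zeta>}"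
    by (auto simp: f_def dirichlet_mult_def split: if_splits)
  then have finf: "finite {\<zeta>. 0 < f \<zeta>}" using fin by (rule finite_subset)
  define M where "M = Abs_multiset f"
  have M: "count M = f" unfolding M_def using finf by (rule count_Abs_multiset)
  obtain ys where ys: "mset ys = M" using ex_mset by blast
  let ?P = "\<lambda>xs. sorted_wrt (\<preceq>) xs \<and> (\<forall>\<zeta>. count (mset xs) \<zeta> = (if \<zeta> \<in> B_disc N then dirichlet_mult
    \<psi> \<zeta> else 0))"
  have "?P (lex.sort ys)"
    using lex.sorted_sort[of ys] M by (simp add: lex.mset_sort ys f_def)
  moreover have "zs = lex.sort ys" if "?P zs" for zs
  proof -
    have "mset zs = mset ys" unfolding ys by (rule multiset_eqI) (use that M in \<open>simp add: f_def\<close>)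
    then show ?thesis using lex.properties_for_sort[of zs ys] that by simp
  qed
  ultimately have "?P xs" unfolding xs_def central_eigenvalues_def by (rule theI)
  then show c: "count (mset xs) \<zeta> = (if \<zeta> \<in> B_disc N then dirichlet_mult \<psi> \<zeta> else 0)" for \<zeta> by blast
  then have cf: "count (mset xs) = f" by (auto simp: f_def)
  have "length xs = size (mset xs)" by simp
  also have "\<dots> = (\<Sum>\<zeta>\<in>set_mset (mset xs). f \<zeta>)" unfolding size_multiset_overloaded_eq cf ..
  also have "\<dots> = (\<Sum>\<zeta>\<in>{\<zeta>. \<zeta> \<in> B_disc N \<and> dirichlet_eigenvalue \<psi> \<zeta>}. f \<zeta>)"
  proof (rule sum.mono_neutral_left)
    have s: "set_mset (mset xs) = {\<zeta>. 0 < f \<zeta>}" using cf by (auto simp: set_mset_def)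
    show "set_mset (mset xs) \<subseteq> {\<zeta>. \<zeta> \<in> B_disc N \<and> dirichlet_eigenvalue \<psi> \<zeta>}" unfolding s using sub
      by blast
    show "\<forall>\<zeta>\<in>{\<zeta>. \<zeta> \<in> B_disc N \<and> dirichlet_eigenvalue \<psi> \<zeta>} - set_mset (mset xs). f \<zeta> = 0"
      unfolding s by auto
  qed (use fin in simp)
  also have "\<dots> = 2 * (2 * N + 1)" unfolding sum[symmetric] by (rule sum.cong) (auto simp: f_def)
  finally show "length xs = 4 * N + 2" by simp
qed

lemma central_labels:
  "length (central_labels N) = 4 * N + 2" "distinct (central_labels N)"
  "set (central_labels N) = {1, 2} \<times> {- int N..int N}"
proof -
  show "length (central_labels N) = 4 * N + 2" by (simp add: central_labels_def)
  show "distinct (central_labels N)" by (auto simp: central_labels_def distinct_map inj_on_def)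
  show "set (central_labels N) = {1, 2} \<times> {- int N..int N}"
    by (auto simp: central_labels_def image_iff)
qed

lemma \<mu>_label:
  assumes cnt: "counting \<psi> (label_bound \<psi>)" and j: "j < 4 * label_bound \<psi> + 2"
    and l: "central_labels (label_bound \<psi>) ! j = (i, n)"
  shows "\<mu> i n \<psi> = central_eigenvalues \<psi> (label_bound \<psi>) ! j" "i \<in> {1, 2}" "\<bar>n\<bar> \<le> int (label_bound
    \<psi>)"
proof -
  let ?N = "label_bound \<psi>"
  have "(i, n) \<in> set (central_labels ?N)" using l j central_labels(1)[of ?N] nth_mem by metis
  then show i: "i \<in> {1, 2}" and n: "\<bar>n\<bar> \<le> int ?N" unfolding central_labels by auto
  have "map_of (zip (central_labels ?N) (central_eigenvalues \<psi> ?N)) (central_labels ?N ! j) = Some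
    (central_eigenvalues \<psi> ?N ! j)"
    by (rule map_of_zip_nth) (use central_labels central_eigenvalues(2)[OF cnt] j in auto)
  then show "\<mu> i n \<psi> = central_eigenvalues \<psi> ?N ! j" unfolding \<mu>_def Let_def using n l by simp
qed

lemma label_index:
  assumes "i \<in> {1, 2}" "\<bar>n\<bar> \<le> int N"
  obtains j where "j < 4 * N + 2" "central_labels N ! j = (i, n)"
proof -
  have "(i, n) \<in> set (central_labels N)" unfolding central_labels using assms by auto
  then show ?thesis using that unfolding in_set_conv_nth central_labels(1) by blast
qed

lemma \<mu>_central:
  assumes cnt: "counting \<psi> (label_bound \<psi>)" and "i \<in> {1, 2}" "\<bar>n\<bar> \<le> int (label_bound \<psi>)"
  shows "\<mu> i n \<psi> \<in> B_disc (label_bound \<psi>)" "chi_D \<psi> (\<mu> i n \<psi>) = 0"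
proof -
  let ?N = "label_bound \<psi>"
  obtain j where j: "j < 4 * ?N + 2" "central_labels ?N ! j = (i, n)"
    using label_index[OF assms(2,3)] .
  then have "\<mu> i n \<psi> \<in> set (central_eigenvalues \<psi> ?N)"
    using \<mu>_label(1)[OF cnt j] central_eigenvalues(2)[OF cnt] nth_mem by metis
  then have "count (mset (central_eigenvalues \<psi> ?N)) (\<mu> i n \<psi>) > 0" by simp
  then show "\<mu> i n \<psi> \<in> B_disc ?N" "chi_D \<psi> (\<mu> i n \<psi>) = 0"
    unfolding central_eigenvalues(1)[OF cnt] by (auto simp: dirichlet_mult_def
      dirichlet_eigenvalue_def split: if_splits)
qed

lemma \<mu>_outer:
  assumes cnt: "counting \<psi> (label_bound \<psi>)" and i: "i \<in> {1, 2}" and n: "\<bar>n\<bar> > int (label_bound \<psi>)"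
  shows "{\<zeta> \<in> D_disc i n. chi_D \<psi> \<zeta> = 0} = {\<mu> i n \<psi>}" "dirichlet_mult \<psi> (\<mu> i n \<psi>) = 1"
proof -
  obtain z where z: "{\<zeta>\<in>D_disc i n. dirichlet_eigenvalue \<psi> \<zeta>} = {z}" "dirichlet_mult \<psi> z = 1"
    using cnt i n unfolding counting_def by meson
  have "\<mu> i n \<psi> = (THE \<zeta>. \<zeta> \<in> D_disc i n \<and> dirichlet_eigenvalue \<psi> \<zeta>)" using n
    by (simp add: \<mu>_def Let_def)
  also have "\<dots> = z" by (rule the_equality) (use z(1) in blast)+
  finally have "\<mu> i n \<psi> = z" .
  then show "{\<zeta> \<in> D_disc i n. chi_D \<psi> \<zeta> = 0} = {\<mu> i n \<psi>}" "dirichlet_mult \<psi> (\<mu> i n \<psi>) = 1"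
    using z by (simp_all add: dirichlet_eigenvalue_def)
qed

lemma \<mu>_outside:
  assumes dom: "sin_dominated \<psi> N" and i: "i \<in> {1, 2}" and n: "\<bar>n\<bar> > int N"
  shows "{\<zeta> \<in> D_disc i n. chi_D \<psi> \<zeta> = 0} = {\<mu> i n \<psi>}" "deriv (chi_D \<psi>) (\<mu> i n \<psi>) \<noteq> 0"
proof -
  note lb = label_bound_least[OF sin_dominated_counting[OF dom]]
  have "\<bar>n\<bar> > int (label_bound \<psi>)" using n lb(2) by linarith
  from \<mu>_outer(1)[OF lb(1) i this] show *: "{\<zeta> \<in> D_disc i n. chi_D \<psi> \<zeta> = 0} = {\<mu> i n \<psi>}" .
  show "deriv (chi_D \<psi>) (\<mu> i n \<psi>) \<noteq> 0" using D_disc_unique_zero[OF dom i n] unfolding * by auto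
qed

text \<open>The labels come from the minimal bound, which may be smaller than \<open>N\<close>.
  Indices between the two are not ordered lexicographically but sit in their own discs, which still
  lie in \<open>B_disc N\<close>.\<close>

lemma \<mu>_in_B_disc:
  assumes dom: "sin_dominated \<psi> N" and i: "i \<in> {1, 2}" and n: "\<bar>n\<bar> \<le> int N"
  shows "\<mu> i n \<psi> \<in> B_disc N"
proof -
  note lb = label_bound_least[OF sin_dominated_counting[OF dom]]
  show ?thesis
  proof (cases "\<bar>n\<bar> \<le> int (label_bound \<psi>)")
    case True
    have "(real (label_bound \<psi>) + 1 / 4) * pi \<le> (real N + 1 / 4) * pi" using lb(2)
      by (intro mult_right_mono) auto
    then show ?thesis using \<mu>_central(1)[OF lb(1) i True] unfolding B_disc_sq
      by (rule less_le_trans[rotated])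
  next
    case False
    then have n0: "n \<noteq> 0" and "\<bar>n\<bar> > int (label_bound \<psi>)" by auto
    from \<mu>_outer(1)[OF lb(1) i this(2)] have "\<mu> i n \<psi> \<in> D_disc i n" by blast
    then show ?thesis by (rule D_disc_subset_B_disc[OF n0 i n])
  qed
qed

lemma eigenvalues_in_discs_if_dominated:
  assumes dom: "sin_dominated \<psi> 0"
  shows "eigenvalues_in_discs \<psi>"
  unfolding eigenvalues_in_discs_def
proof (intro ballI conjI allI impI)
  fix i :: nat assume i: "i \<in> {1, 2}"
  show "\<mu> i n \<psi> \<in> D_disc i n" if "1 \<le> \<bar>n\<bar>" for n
  proof -
    have "\<bar>n\<bar> > int 0" using that by simp
    from \<mu>_outside(1)[OF dom i this] show ?thesis by blast
  qed
  show "\<mu> i 0 \<psi> \<in> D_disc i 0"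
    using \<mu>_in_B_disc[OF dom i, of 0] by (simp add: D_disc_def)
qed

text \<open>For labels assigned by the ordering, multiplicities are read from the list of central
  eigenvalues: each entry lies in the disc of its label and the discs are disjoint, so
  \<open>D_disc i n\<close> contains one list entry only. It is thus the only zero there and has
  multiplicity 1.\<close>

lemma eigenvalues_in_discs_simple:
  assumes dom: "sin_dominated \<psi> N0" and discs: "eigenvalues_in_discs \<psi>" and i: "i \<in> {1, 2}"
    and n: "n \<noteq> 0"
  shows "{\<zeta> \<in> D_disc i n. chi_D \<psi> \<zeta> = 0} = {\<mu> i n \<psi>}" "deriv (chi_D \<psi>) (\<mu> i n \<psi>) \<noteq> 0"
proof -
  define N where "N = label_bound \<psi>"
  have cnt: "counting \<psi> N" unfolding N_def by (rule label_bound_least(1)[OF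
    sin_dominated_counting[OF dom]])
  have fin: "finite {\<zeta> \<in> B_disc N. dirichlet_eigenvalue \<psi> \<zeta>}" using cnt by (simp add: counting_def)
  have mem: "\<mu> i' n' \<psi> \<in> D_disc i' n'" if "i' \<in> {1, 2}" for i' n'
  proof (cases "n' = 0")
    case False
    then have "1 \<le> \<bar>n'\<bar>" by linarith
    with discs that show ?thesis unfolding eigenvalues_in_discs_def by blast
  qed (use discs that in \<open>auto simp: eigenvalues_in_discs_def\<close>)
  have "{\<zeta> \<in> D_disc i n. chi_D \<psi> \<zeta> = 0} = {\<mu> i n \<psi>} \<and> dirichlet_mult \<psi> (\<mu> i n \<psi>) = 1"
  proof (cases "\<bar>n\<bar> \<le> int N")
    case False
    then show ?thesis using \<mu>_outer[of \<psi> i n] cnt i by (simp add: N_def)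
  next
    case True
    define xs where "xs = central_eigenvalues \<psi> N"
    have cx: "count (mset xs) \<zeta> = (if \<zeta> \<in> B_disc N then dirichlet_mult \<psi> \<zeta> else 0)"
      and lx: "length xs = 4 * N + 2" for \<zeta>
      unfolding xs_def using central_eigenvalues[OF cnt] by blast+
    obtain j where j: "j < 4 * N + 2" "central_labels N ! j = (i, n)" using label_index[OF i True] .
    have xj: "xs ! j = \<mu> i n \<psi>" using \<mu>_label(1)[of \<psi> j i n] cnt j by (simp add: xs_def N_def)
    have uniq: "k = j" if k: "k < 4 * N + 2" "xs ! k \<in> D_disc i n" for k
    proof -
      obtain i' n' where l: "central_labels N ! k = (i', n')" by fastforce
      have i': "i' \<in> {1, 2}" and xk: "xs ! k = \<mu> i' n' \<psi>"
        using \<mu>_label(1,2)[of \<psi> k i' n'] cnt k(1) l by (simp_all add: xs_def N_def)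
      have xk': "xs ! k \<in> D_disc i' n'" unfolding xk by (rule mem[OF i'])
      \<comment> \<open>Both labels with index 0 stand for the central disc, which is disjoint from
        the disc of any \<open>n \<noteq> 0\<close>.\<close>
      have "n' \<noteq> 0"
      proof
        assume "n' = 0"
        then have "xs ! k \<in> B_disc 0" using xk' by (simp add: D_disc_def)
        moreover have "\<bar>n\<bar> > int 0" using n by simp
        ultimately show False using D_disc_not_B_disc[OF i _ k(2)] by blast
      qed
      then have "(i', n') = (i, n)" using D_disc_disjoint[OF _ n i' i xk' k(2)] by simp
      then show "k = j"
        using nth_eq_iff_index_eq[OF central_labels(2)[of N], of k j] l j k(1)
          by (simp add: central_labels(1))
    qed
    have "\<zeta> = \<mu> i n \<psi>" if \<zeta>: "\<zeta> \<in> D_disc i n" "chi_D \<psi> \<zeta> = 0" for \<zeta>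
    proof -
      have "\<zeta> \<in> B_disc N" by (rule D_disc_subset_B_disc[OF n i True \<zeta>(1)])
      moreover have "dirichlet_mult \<psi> \<zeta> > 0"
        using zorder_chi_D_pos(1)[OF fin \<zeta>(2)] \<zeta>(2)
          by (simp add: dirichlet_mult_def dirichlet_eigenvalue_def)
      ultimately have "count (mset xs) \<zeta> > 0" unfolding cx by simp
      then have "\<zeta> \<in> set xs" by simp
      then obtain k where k: "k < 4 * N + 2" "xs ! k = \<zeta>" unfolding in_set_conv_nth lx by blast
      then show ?thesis using uniq[of k] \<zeta>(1) xj by simp
    qed
    moreover have "chi_D \<psi> (\<mu> i n \<psi>) = 0" using \<mu>_central(2)[of \<psi> i n] cnt i True
      by (simp add: N_def)
    moreover have "dirichlet_mult \<psi> (\<mu> i n \<psi>) = 1"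
    proof -
      \<comment> \<open>The multiplicity is the number of positions at which the eigenvalue occurs
        in the list.\<close>
      have "{k. k < length xs \<and> \<mu> i n \<psi> = xs ! k} = {j}"
      proof (intro equalityI subsetI)
        fix k assume "k \<in> {k. k < length xs \<and> \<mu> i n \<psi> = xs ! k}"
        then have "k < 4 * N + 2" "xs ! k = \<mu> i n \<psi>" using lx by auto
        then show "k \<in> {j}" using uniq[of k] mem[OF i, of n] by simp
      qed (use xj j(1) lx in simp)
      then have "count (mset xs) (\<mu> i n \<psi>) = 1"
        unfolding count_mset count_list_eq_length_filter length_filter_conv_card by simp
      then show ?thesis unfolding cx by (simp split: if_splits)
    qed
    ultimately show ?thesis using mem[OF i, of n] by blast
  qed
  then have set: "{\<zeta> \<in> D_disc i n. chi_D \<psi> \<zeta> = 0} = {\<mu> i n \<psi>}"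
    and m: "dirichlet_mult \<psi> (\<mu> i n \<psi>) = 1" by auto
  show "{\<zeta> \<in> D_disc i n. chi_D \<psi> \<zeta> = 0} = {\<mu> i n \<psi>}" by (rule set)
  have z: "chi_D \<psi> (\<mu> i n \<psi>) = 0" using set by blast
  have "zorder (chi_D \<psi>) (\<mu> i n \<psi>) = 1"
    using m z by (simp add: dirichlet_mult_def dirichlet_eigenvalue_def)
  then show "deriv (chi_D \<psi>) (\<mu> i n \<psi>) \<noteq> 0"
    using zorder_eq_1_iff_deriv[OF chi_D_holomorphic open_UNIV connected_UNIV UNIV_I z
      zorder_chi_D_pos(2)[OF fin z]] by blast
qed

lemma open_D_disc: "open (D_disc i n)"
proof -
  have U: "open (U_dom m)" for m unfolding U_dom_def by (intro open_Collect_less continuous_intros)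
  have B: "open (B_disc 0)" unfolding B_disc_ball by simp
  show ?thesis unfolding D_disc_def
    by (auto intro!: open_Int U B open_halfspace_Re_gt open_halfspace_Re_lt open_halfspace_Im_gt
      open_halfspace_Im_lt)
qed

lemma \<mu>_zero: "i \<in> {1, 2} \<Longrightarrow> \<mu> i n 0 = free_eigenvalue i n"
proof -
  assume i: "i \<in> {1, 2}"
  obtain d where "d > 0" "\<And>\<psi>. norm \<psi> < d \<Longrightarrow> sin_dominated \<psi> 0" by (rule sin_dominated_near_0) blast
  then have dom: "sin_dominated 0 0" by simp
  show ?thesis
  proof (cases "n = 0")
    case True
    note lb = label_bound_least[OF sin_dominated_counting[OF dom]]
    have "\<mu> i n 0 \<in> B_disc 0" "chi_D 0 (\<mu> i n 0) = 0"
      using \<mu>_central[OF lb(1) i, of n] lb(2) True by simp_all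
    then have "\<mu> i n 0 \<in> {\<zeta>. \<zeta> \<in> B_disc 0 \<and> sin (2 * \<zeta>\<^sup>2) = 0}" by (simp add: chi_D_0)
    then show ?thesis unfolding free_zeros using True
      by (simp add: free_eigenvalue_def disc_dir_def)
  next
    case False
    then have "\<bar>n\<bar> > int 0" by simp
    from \<mu>_outside(1)[OF dom i this] have *: "{\<zeta> \<in> D_disc i n. chi_D 0 \<zeta> = 0} = {\<mu> i n 0}" .
    have D: "free_eigenvalue i n \<in> D_disc i n" by (rule free_eigenvalue_in_disc[OF False i])
    moreover have "chi_D 0 (free_eigenvalue i n) = 0"
      unfolding chi_D_0 free_eigenvalue_sq[OF False] sin_eq_0
        by (intro exI[of _ "disc_sign i * \<bar>n\<bar>"]) (simp del: of_int_abs)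
    ultimately have "free_eigenvalue i n \<in> {\<zeta> \<in> D_disc i n. chi_D 0 \<zeta> = 0}" by simp
    then show ?thesis unfolding * by simp
  qed
qed

lemma free_eigenvalue_csqrt:
  assumes "i \<in> {1, 2}"
  shows "free_eigenvalue i n = of_int (sgn n) * csqrt ((-1) ^ (i - 1) * of_int \<bar>n\<bar> * of_real pi /
    2)"
proof -
  define r where "r = real_of_int \<bar>n\<bar> * pi / 2"
  have r: "r \<ge> 0" by (simp add: r_def)
  have "of_int \<bar>n\<bar> * of_real pi / 2 = complex_of_real r" by (simp add: r_def del: of_int_abs)
  moreover have "csqrt (complex_of_real r) = of_real (sqrt r)" using r by (rule csqrt_of_real)
  moreover have "csqrt (- complex_of_real r) = \<i> * of_real (sqrt r)"
    using csqrt_of_real_nonpos[of "- complex_of_real r"] r by simp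
  moreover have "free_eigenvalue i n = disc_dir i n * of_real (sqrt r)"
    by (simp only: free_eigenvalue_def r_def)
  moreover have "(-1) ^ (i - 1) * of_int \<bar>n\<bar> * of_real pi / 2 = (-1) ^ (i - 1) * (of_int \<bar>n\<bar> *
    of_real pi / 2 :: complex)"
    by simp
  ultimately show ?thesis
    using assms by (auto simp: disc_dir_def)
qed

text \<open>With \<open>w\<close> the deviation of \<open>2 * \<zeta>\<^sup>2\<close> from its free
  value, half its modulus is at most that of its sine, so \<open>w\<close> is O(|n|^(-1/2)).
  Factoring the difference of squares and dividing by \<open>\<zeta> + \<zeta>0\<close> gains
  another such factor.\<close>

lemma \<mu>_asymptotics:
  assumes i: "i \<in> {1, 2}" and n: "n \<noteq> 0" and C: "C \<ge> 0" and \<zeta>: "\<zeta> \<in> D_disc i n" "chi_D \<psi> \<zeta> = 0"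
    and asymp: "cmod (chi_D \<psi> \<zeta> - sin (2 * \<zeta>\<^sup>2)) \<le> C / (1 + cmod \<zeta>) * exp \<bar>Im (2 * \<zeta>\<^sup>2)\<bar>"
  shows "sqrt (1 + (real_of_int n)\<^sup>2) * cmod (\<zeta> - free_eigenvalue i n) \<le> 6 * C"
proof -
  define k where "k = disc_sign i * \<bar>n\<bar>"
  define w where "w = 2 * \<zeta>\<^sup>2 - of_int k * of_real pi"
  define a where "a = real_of_int \<bar>n\<bar>"
  have a1: "a \<ge> 1" using n by (simp add: a_def)
  have w: "cmod w < pi / 4" using D_disc_sq(1)[OF n i \<zeta>(1)] by (simp only: w_def k_def)
  have im: "Im (2 * \<zeta>\<^sup>2) = Im w" by (simp add: w_def)
  have "\<bar>Im w\<bar> \<le> 1" using abs_Im_le_cmod[of w] w pi_less_4 by linarith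
  then have "exp \<bar>Im w\<bar> \<le> exp 1" by simp
  also have "\<dots> \<le> 3" by (rule exp_le)
  finally have e3: "exp \<bar>Im w\<bar> \<le> 3" .
  have sin_w: "cmod (sin w) = cmod (sin (2 * \<zeta>\<^sup>2))"
  proof -
    have s: "sin (of_int k * complex_of_real pi) = 0" unfolding sin_eq_0 by (intro exI[of _ k]) simp
    then have "(cos (of_int k * complex_of_real pi))\<^sup>2 = 1"
      using sin_cos_squared_add[of "of_int k * complex_of_real pi"] by simp
    then have "cmod (cos (of_int k * complex_of_real pi)) = 1"
      by (metis norm_one norm_power power2_eq_1_iff norm_minus_cancel)
    then show ?thesis unfolding w_def sin_diff s by (simp add: norm_mult)
  qed
  have "cmod w / 2 \<le> cmod (sin w)" by (rule norm_sin_ge_half) (use w in simp)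
  also have "\<dots> \<le> C / (1 + cmod \<zeta>) * exp \<bar>Im w\<bar>" using asymp unfolding sin_w \<zeta>(2) im by simp
  also have "\<dots> \<le> C / (1 + cmod \<zeta>) * 3" using e3 C by (intro mult_left_mono) (auto simp:
    add_nonneg_nonneg)
  also have "\<dots> \<le> C / sqrt a * 3"
  proof -
    have "sqrt a \<le> cmod \<zeta>"
    proof (rule real_le_lsqrt[THEN order.trans])
      show "sqrt ((cmod \<zeta>)\<^sup>2) \<le> cmod \<zeta>" by simp
    next
      \<comment> \<open>The left side is \<open>2 * a\<close>; since \<open>a \<ge> 1\<close>, the
        disc lies far enough out for \<open>a\<close> to be at most the squared modulus of
        \<open>\<zeta>\<close>.\<close>
      have "a * (4 / 3) * (3 / 2) \<le> (a - 1 / 4) * 3" using a1 by simp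
      also have "(a - 1 / 4) * 3 \<le> (a - 1 / 4) * pi" using a1 pi_gt3 by (intro mult_left_mono) auto
      also have "\<dots> \<le> cmod (2 * \<zeta>\<^sup>2)" using D_disc_norm(2)[OF n i \<zeta>(1)] by (simp add: a_def)
      finally show "a \<le> (sqrt ((cmod \<zeta>)\<^sup>2))\<^sup>2" by (simp add: norm_mult norm_power)
    qed (use a1 in auto)
    then show ?thesis using C a1 by (intro mult_right_mono divide_left_mono) (auto simp:
      add_pos_nonneg)
  qed
  finally have w6: "cmod w \<le> 6 * C / sqrt a" by simp
  define \<zeta>0 where "\<zeta>0 = free_eigenvalue i n"
  have sq: "(\<zeta> - \<zeta>0) * (\<zeta> + \<zeta>0) = w / 2"
    using free_eigenvalue_sq[OF n, of i] by (simp add: w_def k_def \<zeta>0_def power2_eq_square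
      algebra_simps)
  define r where "r = sqrt (a * pi / 2)"
  have "\<zeta>0 * cnj (disc_dir i n) = (disc_dir i n * cnj (disc_dir i n)) * of_real r"
    by (simp add: \<zeta>0_def free_eigenvalue_def r_def a_def)
  then have \<zeta>0r: "\<zeta>0 * cnj (disc_dir i n) = of_real r" unfolding disc_dir(1)[OF n] by simp
  \<comment> \<open>After rotation \<open>\<zeta>\<close> has positive real part and
    \<open>\<zeta>0\<close> is the positive number \<open>r\<close>, so the sum cannot be
    small.\<close>
  have "r \<le> Re ((\<zeta> + \<zeta>0) * cnj (disc_dir i n))"
    using D_disc_sq(2)[OF n i \<zeta>(1)] \<zeta>0r by (simp add: distrib_right del: complex_cnj_mult)
  also have "\<dots> \<le> cmod ((\<zeta> + \<zeta>0) * cnj (disc_dir i n))" by (rule complex_Re_le_cmod)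
  also have "\<dots> = cmod (\<zeta> + \<zeta>0)" using disc_dir(3)[OF n, of i] by (simp add: norm_mult)
  finally have "r \<le> cmod (\<zeta> + \<zeta>0)" .
  moreover have "sqrt a \<le> r" unfolding r_def using a1 pi_ge_two mult_left_mono[OF pi_ge_two, of a]
    by simp
  ultimately have sum: "sqrt a \<le> cmod (\<zeta> + \<zeta>0)" by linarith
  have sa: "sqrt a > 0" using a1 by simp
  have "cmod (\<zeta> - \<zeta>0) * sqrt a \<le> cmod (\<zeta> - \<zeta>0) * cmod (\<zeta> + \<zeta>0)" using sum
    by (rule mult_left_mono) simp
  also have "\<dots> = cmod w / 2" unfolding norm_mult[symmetric] sq by (simp add: norm_divide)
  also have "\<dots> \<le> 3 * C / sqrt a" using w6 by simp
  finally have "cmod (\<zeta> - \<zeta>0) * sqrt a * sqrt a \<le> 3 * C" using sa by (simp only: pos_le_divide_eq)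
  then have "(sqrt a * sqrt a) * cmod (\<zeta> - \<zeta>0) \<le> 3 * C" by (simp only: mult_ac)
  moreover have "sqrt a * sqrt a = a" using a1 by simp
  ultimately have fin: "a * cmod (\<zeta> - \<zeta>0) \<le> 3 * C" by (simp only:)
  have "sqrt (1 + (real_of_int n)\<^sup>2) \<le> 2 * a"
  proof (rule real_le_lsqrt)
    have "1 \<le> a * a" using mult_mono[OF a1 a1] a1 by simp
    moreover have "(real_of_int n)\<^sup>2 = a * a" by (simp add: a_def power2_eq_square)
    moreover have "(2 * a)\<^sup>2 = 4 * (a * a)" by (simp add: power2_eq_square)
    ultimately show "1 + (real_of_int n)\<^sup>2 \<le> (2 * a)\<^sup>2" by linarith
  qed (use a1 in auto)
  then have "sqrt (1 + (real_of_int n)\<^sup>2) * cmod (\<zeta> - \<zeta>0) \<le> 2 * a * cmod (\<zeta> - \<zeta>0)"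
    by (rule mult_right_mono) simp
  also have "\<dots> \<le> 6 * C" using fin by simp
  finally show ?thesis by (simp add: \<zeta>0_def)
qed

section \<open>Analyticity and uniform estimates on bounded sets\<close>

lemma \<mu>_pot_analytic_outside:
  assumes dom: "\<And>\<psi>. \<psi> \<in> W \<Longrightarrow> sin_dominated \<psi> N" and W: "open W" and i: "i \<in> {1, 2}"
    and n: "\<bar>n\<bar> > int N"
  shows "\<mu> i n pot_analytic_on W"
proof (rule simple_zero_pot_analytic[OF W open_D_disc[of i n]])
  fix \<psi> assume "\<psi> \<in> W"
  note out = \<mu>_outside[OF dom[OF this] i n]
  show "\<mu> i n \<psi> \<in> D_disc i n \<and> chi_D \<psi> (\<mu> i n \<psi>) = 0" using out(1) by blast
  show "z = \<mu> i n \<psi>" if "z \<in> D_disc i n" "chi_D \<psi> z = 0" for z using out(1) that by blast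
  show "deriv (chi_D \<psi>) (\<mu> i n \<psi>) \<noteq> 0" by (rule out(2))
qed

lemma \<mu>_pot_analytic_discs:
  assumes dom: "\<And>\<psi>. \<psi> \<in> W \<Longrightarrow> sin_dominated \<psi> N" and W: "open W"
    and discs: "\<And>\<psi>. \<psi> \<in> W \<Longrightarrow> eigenvalues_in_discs \<psi>" and i: "i \<in> {1, 2}" and n: "n \<noteq> 0"
  shows "\<mu> i n pot_analytic_on W"
proof (rule simple_zero_pot_analytic[OF W open_D_disc[of i n]])
  fix \<psi> assume \<psi>: "\<psi> \<in> W"
  note sim = eigenvalues_in_discs_simple[OF dom[OF \<psi>] discs[OF \<psi>] i n]
  show "\<mu> i n \<psi> \<in> D_disc i n \<and> chi_D \<psi> (\<mu> i n \<psi>) = 0" using sim(1) by blast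
  show "z = \<mu> i n \<psi>" if "z \<in> D_disc i n" "chi_D \<psi> z = 0" for z using sim(1) that by blast
  show "deriv (chi_D \<psi>) (\<mu> i n \<psi>) \<noteq> 0" by (rule sim(2))
qed

text \<open>Above the common bound \<open>N\<close> labels match discs and the asymptotics apply.
  For the finitely many other indices both eigenvalues lie in \<open>B_disc N\<close>, so its
  diameter and the largest weight suffice.\<close>

lemma \<mu>_uniform_asymptotics:
  obtains C where "\<And>\<psi> i n. norm \<psi> \<le> R \<Longrightarrow> i \<in> {1, 2} \<Longrightarrow>
    sqrt (1 + (real_of_int n)\<^sup>2) * cmod (\<mu> i n \<psi> - \<mu> i n 0) \<le> C"
proof -
  obtain N where N: "\<And>\<psi>. norm \<psi> \<le> R \<Longrightarrow> sin_dominated \<psi> N" by (rule sin_dominated_bounded[of R]) blast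
  obtain C where C: "C \<ge> 0" "\<And>\<zeta> \<psi>. norm \<psi> \<le> R \<Longrightarrow>
    cmod (chi_D \<psi> \<zeta> - sin (2 * \<zeta>\<^sup>2)) \<le> C / (1 + cmod \<zeta>) * exp \<bar>Im (2 * \<zeta>\<^sup>2)\<bar>"
    by (rule chi_D_asymp[of R]) blast
  define r where "r = sqrt ((real N + 1 / 4) * pi / 2)"
  define C' where "C' = max (6 * C) (sqrt (1 + (real N)\<^sup>2) * (2 * r))"
  have "sqrt (1 + (real_of_int n)\<^sup>2) * cmod (\<mu> i n \<psi> - \<mu> i n 0) \<le> C'"
    if \<psi>: "norm \<psi> \<le> R" and i: "i \<in> {1, 2}" for \<psi> i n
  proof (cases "\<bar>n\<bar> \<le> int N")
    case True
    have "norm (0::potential) \<le> R" using order.trans[OF norm_ge_zero \<psi>] by simp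
    then have "\<mu> i n \<psi> \<in> B_disc N" "\<mu> i n 0 \<in> B_disc N"
      using \<mu>_in_B_disc[OF N i True] \<psi> by auto
    then have "cmod (\<mu> i n \<psi>) < r" "cmod (\<mu> i n 0) < r" unfolding B_disc_ball r_def by simp_all
    then have "cmod (\<mu> i n \<psi> - \<mu> i n 0) \<le> 2 * r"
      using norm_triangle_ineq4[of "\<mu> i n \<psi>" "\<mu> i n 0"] by linarith
    moreover have "(real_of_int n)\<^sup>2 \<le> (real N)\<^sup>2"
      using True by (intro power2_le_iff_abs_le[THEN iffD2]) auto
    then have "sqrt (1 + (real_of_int n)\<^sup>2) \<le> sqrt (1 + (real N)\<^sup>2)" by simp
    ultimately have "sqrt (1 + (real_of_int n)\<^sup>2) * cmod (\<mu> i n \<psi> - \<mu> i n 0) \<le> sqrt (1 + (real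
      N)\<^sup>2) * (2 * r)"
      by (intro mult_mono) auto
    then show ?thesis unfolding C'_def by (rule max.coboundedI2)
  next
    case False
    then have n: "\<bar>n\<bar> > int N" and n0: "n \<noteq> 0" by auto
    have "\<mu> i n \<psi> \<in> D_disc i n" "chi_D \<psi> (\<mu> i n \<psi>) = 0" using \<mu>_outside(1)[OF N[OF \<psi>] i n] by blast+
    from \<mu>_asymptotics[OF i n0 C(1) this C(2)[OF \<psi>]] show ?thesis
      unfolding \<mu>_zero[OF i] C'_def by (rule max.coboundedI1)
  qed
  with that show ?thesis by blast
qed

text \<open>The bound \<open>C / s\<close> on the double ball, with \<open>s\<close> the weight of
  the index, becomes a Lipschitz constant proportional to \<open>1 / s\<close>. The weight cancels,
  which is why \<open>L\<close> is independent of \<open>n\<close>.\<close>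

lemma \<mu>_lipschitz_outside:
  assumes R: "R > 0"
  obtains N L where "\<And>\<psi>. norm \<psi> \<le> 2 * R \<Longrightarrow> sin_dominated \<psi> N"
    "\<And>\<psi> \<phi> i n. norm \<psi> < R \<Longrightarrow> norm \<phi> < R \<Longrightarrow> i \<in> {1, 2} \<Longrightarrow> \<bar>n\<bar> > int N \<Longrightarrow>
      sqrt (1 + (real_of_int n)\<^sup>2) * cmod (\<mu> i n \<psi> - \<mu> i n \<phi>) \<le> L * norm (\<psi> - \<phi>)"
proof -
  obtain N where N: "\<And>\<psi>. norm \<psi> \<le> 2 * R \<Longrightarrow> sin_dominated \<psi> N"
    by (rule sin_dominated_bounded[of "2 * R"]) blast
  obtain C where C: "\<And>\<psi> i n. norm \<psi> \<le> 2 * R \<Longrightarrow> i \<in> {1, 2} \<Longrightarrow>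
      sqrt (1 + (real_of_int n)\<^sup>2) * cmod (\<mu> i n \<psi> - \<mu> i n 0) \<le> C"
    by (rule \<mu>_uniform_asymptotics[of "2 * R"]) blast
  have "sqrt (1 + (real_of_int n)\<^sup>2) * cmod (\<mu> i n \<psi> - \<mu> i n \<phi>) \<le> (2 * C / R) * norm (\<psi> - \<phi>)"
    if \<psi>: "norm \<psi> < R" and \<phi>: "norm \<phi> < R" and i: "i \<in> {1, 2}" and n: "\<bar>n\<bar> > int N" for \<psi> \<phi> i n
  proof -
    define s where "s = sqrt (1 + (real_of_int n)\<^sup>2)"
    have s: "s > 0" by (simp add: s_def add_pos_nonneg)
    have an: "(\<lambda>\<psi>. \<mu> i n \<psi> - \<mu> i n 0) pot_analytic_on ball 0 (2 * R)"
      by (intro pot_analytic_on_diff_const \<mu>_pot_analytic_outside[OF _ open_ball i n] N) simp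
    have "cmod ((\<mu> i n \<psi> - \<mu> i n 0) - (\<mu> i n \<phi> - \<mu> i n 0)) \<le> 2 * (C / s) / R * norm (\<psi> - \<phi>)"
    proof (rule pot_analytic_lipschitz[OF an subset_refl _ \<psi> \<phi>])
      show "cmod (\<mu> i n \<theta> - \<mu> i n 0) \<le> C / s" if "norm \<theta> < 2 * R" for \<theta>
        using C[OF less_imp_le[OF that] i, of n] s unfolding s_def[symmetric]
          by (simp add: pos_le_divide_eq mult.commute)
    qed
    then have "s * cmod (\<mu> i n \<psi> - \<mu> i n \<phi>) \<le> s * (2 * (C / s) / R * norm (\<psi> - \<phi>))"
      using s by (intro mult_left_mono) auto
    also have "\<dots> = (2 * C / R) * norm (\<psi> - \<phi>)" using s by simp
    finally show ?thesis by (simp add: s_def)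
  qed
  with N that show ?thesis by blast
qed

lemma pot_analytic_on_imp_tendsto:
  assumes "F pot_analytic_on W" "\<psi> \<in> W" "\<psi>s \<longlonglongrightarrow> \<psi>"
  shows "(\<lambda>k. F (\<psi>s k)) \<longlonglongrightarrow> F \<psi>"
proof -
  have "isCont F \<psi>" using assms(1,2) has_derivative_continuous unfolding pot_analytic_on_def
    by blast
  then show ?thesis using assms(3) by (rule isCont_tendsto_compose)
qed

text \<open>The suprema are taken in \<open>ereal\<close>, where they exist for unbounded families
  too, so finiteness and convergence to 0 assert genuine bounds.\<close>

theorem theorem3p5:
  fixes B :: "potential set"
  assumes "bounded B" and "0 \<in> interior B"
  shows
    "(\<forall>i\<in>{1, 2}.
        (\<forall>n. \<mu> i n 0 = of_int (sgn n) * csqrt ((-1) ^ (i - 1) * of_int \<bar>n\<bar> * of_real pi / 2)) \<and>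
        (SUP \<psi>\<in>B. SUP n. ereal (sqrt (1 + (real_of_int n)\<^sup>2) * cmod (\<mu> i n \<psi> - \<mu> i n 0))) < \<infinity>) \<and>
     (\<exists>W. W \<subseteq> B \<and> 0 \<in> interior W \<and> (\<forall>\<psi>\<in>W. eigenvalues_in_discs \<psi>)) \<and>
     (\<forall>W. W \<subseteq> B \<and> open W \<and> 0 \<in> W \<and> (\<forall>\<psi>\<in>W. eigenvalues_in_discs \<psi>) \<longrightarrow>
        (\<forall>i\<in>{1, 2}.
           (\<forall>n. n \<noteq> 0 \<longrightarrow> \<mu> i n pot_analytic_on W) \<and>
           (\<forall>\<psi>\<in>W. \<forall>\<psi>s. (\<forall>k. \<psi>s k \<in> W) \<and> \<psi>s \<longlonglongrightarrow> \<psi> \<longrightarrow>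
              (\<lambda>k. SUP n\<in>{n. n \<noteq> 0}.
                 ereal (sqrt (1 + (real_of_int n)\<^sup>2) * cmod (\<mu> i n (\<psi>s k) - \<mu> i n \<psi>)))
              \<longlonglongrightarrow> 0)))"
proof (intro conjI ballI allI impI)
  obtain b where b: "b > 0" "\<And>\<psi>. \<psi> \<in> B \<Longrightarrow> norm \<psi> \<le> b" using assms(1) unfolding bounded_pos by blast
  \<comment> \<open>The extra 1 makes the norm bound strict, as the Lipschitz estimate on the ball
    of radius \<open>R\<close> requires.\<close>
  define R where "R = b + 1"
  have R: "R > 0" "\<And>\<psi>. \<psi> \<in> B \<Longrightarrow> norm \<psi> < R" using b by (fastforce simp: R_def)+
  {
    fix i :: nat and n :: int assume i: "i \<in> {1, 2}"
    show "\<mu> i n 0 = of_int (sgn n) * csqrt ((-1) ^ (i - 1) * of_int \<bar>n\<bar> * of_real pi / 2)"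
      unfolding \<mu>_zero[OF i] by (rule free_eigenvalue_csqrt[OF i])
  next
    fix i :: nat assume i: "i \<in> {1, 2}"
    obtain C where C: "\<And>\<psi> i n. norm \<psi> \<le> R \<Longrightarrow> i \<in> {1, 2} \<Longrightarrow>
        sqrt (1 + (real_of_int n)\<^sup>2) * cmod (\<mu> i n \<psi> - \<mu> i n 0) \<le> C"
      by (rule \<mu>_uniform_asymptotics[of R]) blast
    have "(SUP \<psi>\<in>B. SUP n. ereal (sqrt (1 + (real_of_int n)\<^sup>2) * cmod (\<mu> i n \<psi> - \<mu> i n 0))) \<le>
      ereal C"
      by (intro SUP_least) (use C[OF less_imp_le[OF R(2)] i] in simp)
    also have "\<dots> < \<infinity>" by simp
    finally show "(SUP \<psi>\<in>B. SUP n. ereal (sqrt (1 + (real_of_int n)\<^sup>2) * cmod (\<mu> i n \<psi> - \<mu> i n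
      0))) < \<infinity>" .
  next
    obtain d where d: "d > 0" "\<And>\<psi>. norm \<psi> < d \<Longrightarrow> sin_dominated \<psi> 0"
      by (rule sin_dominated_near_0) blast
    obtain e where e: "e > 0" "ball 0 e \<subseteq> B" using assms(2) unfolding mem_interior by blast
    show "\<exists>W. W \<subseteq> B \<and> 0 \<in> interior W \<and> (\<forall>\<psi>\<in>W. eigenvalues_in_discs \<psi>)"
    proof (intro exI[of _ "ball 0 (min d e)"] conjI ballI)
      show "ball 0 (min d e) \<subseteq> B" using e(2) by auto
      show "0 \<in> interior (ball 0 (min d e))" using d(1) e(1) by (simp add: interior_open)
      show "eigenvalues_in_discs \<psi>" if "\<psi> \<in> ball 0 (min d e)" for \<psi>
        using that by (intro eigenvalues_in_discs_if_dominated d(2)) simp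
    qed
  next
    fix W and i :: nat assume W: "W \<subseteq> B \<and> open W \<and> 0 \<in> W \<and> (\<forall>\<psi>\<in>W. eigenvalues_in_discs \<psi>)"
      and i: "i \<in> {1, 2}"
    obtain N L where N: "\<And>\<psi>. norm \<psi> \<le> 2 * R \<Longrightarrow> sin_dominated \<psi> N"
      and L: "\<And>\<psi> \<phi> i n. norm \<psi> < R \<Longrightarrow> norm \<phi> < R \<Longrightarrow> i \<in> {1, 2} \<Longrightarrow> \<bar>n\<bar> > int N \<Longrightarrow>
        sqrt (1 + (real_of_int n)\<^sup>2) * cmod (\<mu> i n \<psi> - \<mu> i n \<phi>) \<le> L * norm (\<psi> - \<phi>)"
      by (rule \<mu>_lipschitz_outside[OF R(1)]) blast
    have WR: "norm \<psi> < R" if "\<psi> \<in> W" for \<psi> using R(2) W that by blast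
    have dom: "sin_dominated \<psi> N" if "\<psi> \<in> W" for \<psi>
    proof (rule N)
      show "norm \<psi> \<le> 2 * R" using WR[OF that] R(1) by linarith
    qed
    have an: "\<mu> i n pot_analytic_on W" if n: "n \<noteq> 0" for n
    proof (rule \<mu>_pot_analytic_discs[OF dom _ _ i n])
      show "open W" "\<And>\<psi>. \<psi> \<in> W \<Longrightarrow> eigenvalues_in_discs \<psi>" using W by blast+
    qed
    {
      fix n :: int assume "n \<noteq> 0"
      then show "\<mu> i n pot_analytic_on W" by (rule an)
    next
      fix \<psi> and \<psi>s :: "nat \<Rightarrow> potential" assume \<psi>: "\<psi> \<in> W" and \<psi>s: "(\<forall>k. \<psi>s k \<in> W) \<and> \<psi>s \<longlonglongrightarrow> \<psi>"
      define g where "g n k = sqrt (1 + (real_of_int n)\<^sup>2) * cmod (\<mu> i n (\<psi>s k) - \<mu> i n \<psi>)" for n k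
      \<comment> \<open>Majorant of the supremum: one Lipschitz term for all large indices and a
        finite sum for the rest, each summand tending to 0 by continuity of the analytic
        eigenvalue.\<close>
      define a where "a k = \<bar>L\<bar> * norm (\<psi>s k - \<psi>) + (\<Sum>n\<in>{- int N..int N} - {0}. g n k)" for k
      have g0: "g n k \<ge> 0" for n k by (simp add: g_def)
      have upper: "(SUP n\<in>{n. n \<noteq> 0}. ereal (g n k)) \<le> ereal (a k)" for k
      proof (rule SUP_least)
        fix n :: int assume "n \<in> {n. n \<noteq> 0}"
        then have n: "n \<noteq> 0" by simp
        have sum0: "0 \<le> (\<Sum>n\<in>{- int N..int N} - {0}. g n k)" by (intro sum_nonneg g0)
        have L0: "0 \<le> \<bar>L\<bar> * norm (\<psi>s k - \<psi>)" by simp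
        have "g n k \<le> a k"
        proof (cases "\<bar>n\<bar> > int N")
          case True
          have "g n k \<le> L * norm (\<psi>s k - \<psi>)"
            unfolding g_def using \<psi>s by (intro L WR \<psi> i True) simp
          also have "\<dots> \<le> \<bar>L\<bar> * norm (\<psi>s k - \<psi>)" by (intro mult_right_mono) auto
          finally show ?thesis using sum0 unfolding a_def by linarith
        next
          case False
          then have "n \<in> {- int N..int N} - {0}" using n by auto
          then have "g n k \<le> (\<Sum>n\<in>{- int N..int N} - {0}. g n k)"
            by (rule member_le_sum) (auto simp: g0)
          then show ?thesis using L0 unfolding a_def by linarith
        qed
        then show "ereal (g n k) \<le> ereal (a k)" by simp
      qed
      \<comment> \<open>The index set is nonempty, with 1 as witness; a supremum over the empty set
        in \<open>ereal\<close> would be minus infinity.\<close>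
      have lower: "0 \<le> (SUP n\<in>{n. n \<noteq> 0}. ereal (g n k))" for k
      proof -
        have "(0::ereal) \<le> ereal (g 1 k)" using g0 by simp
        also have "\<dots> \<le> (SUP n\<in>{n. n \<noteq> 0}. ereal (g n k))" by (rule SUP_upper) simp
        finally show ?thesis .
      qed
      have gt: "(\<lambda>k. g n k) \<longlonglongrightarrow> 0" if "n \<noteq> 0" for n
      proof -
        have "(\<lambda>k. \<mu> i n (\<psi>s k)) \<longlonglongrightarrow> \<mu> i n \<psi>"
          by (rule pot_analytic_on_imp_tendsto[OF an[OF that] \<psi>]) (use \<psi>s in blast)
        then have "(\<lambda>k. cmod (\<mu> i n (\<psi>s k) - \<mu> i n \<psi>)) \<longlonglongrightarrow> 0"
          by (intro tendsto_norm_zero) (simp add: LIM_zero_iff)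
        then show ?thesis unfolding g_def by (rule tendsto_mult_right_zero)
      qed
      have "(\<lambda>k. norm (\<psi>s k - \<psi>)) \<longlonglongrightarrow> 0"
        using \<psi>s by (intro tendsto_norm_zero) (simp add: LIM_zero_iff)
      then have "(\<lambda>k. \<bar>L\<bar> * norm (\<psi>s k - \<psi>)) \<longlonglongrightarrow> 0" by (rule tendsto_mult_right_zero)
      moreover have "(\<lambda>k. \<Sum>n\<in>{- int N..int N} - {0}. g n k) \<longlonglongrightarrow> 0"
        by (rule tendsto_null_sum) (use gt in simp)
      ultimately have "a \<longlonglongrightarrow> 0" unfolding a_def using tendsto_add_zero by blast
      then have "(\<lambda>k. ereal (a k)) \<longlonglongrightarrow> 0" by (simp add: zero_ereal_def)
      then have "(\<lambda>k. SUP n\<in>{n. n \<noteq> 0}. ereal (g n k)) \<longlonglongrightarrow> 0"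
        by (rule tendsto_sandwich[OF _ _ tendsto_const, rotated 2])
          (use lower upper in \<open>auto intro: always_eventually\<close>)
      then show "(\<lambda>k. SUP n\<in>{n. n \<noteq> 0}. ereal (sqrt (1 + (real_of_int n)\<^sup>2) * cmod (\<mu> i n (\<psi>s k) -
        \<mu> i n \<psi>))) \<longlonglongrightarrow> 0"
        unfolding g_def .
    }
  }
qed

end
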